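(* Let $(\mathbb{X},\mathcal{X})$ and $(\mathbb{Y},\mathcal{Y})$ be locally compact second countable Hausdorff spaces with their Borel $\sigma$-algebras, let $k\in\mathbb{N}$, let $f:\mathbb{X}^k\to\mathbb{Y}$ be a symmetric measurable function, and let $g:\mathbb{X}^k\times\mathbf{N}_{\mathbb{X}}\to\{0,1\}$ be a measurable function that is symmetric in the $\mathbb{X}^k$-coordinates. For $\omega\in\mathbf{N}_{\mathbb{X}}$ define $$\xi[\omega]:=\frac1{k!}\sum_{\mathbf{x}\in\omega^k_{\neq}}g(\mathbf{x},\omega)\,\delta_{f(\mathbf{x})}.$$ Let $\eta$ be a Poisson process on $\mathbb{X}$ with a $\sigma$-finite intensity measure $\mathbf{K}$, let $\xi:=\xi[\eta]$, let $\mathbf{L}$ be the intensity measure of $\xi$ (on $\mathbb{Y}$), and assume $\mathbf{L}(\mathbb{Y})<\infty$. Set $p(\mathbf{x}):=\mathbb{E}\{g(\mathbf{x},\eta+\delta_{\mathbf{x}})\}$ for $\mathbf{x}\in\mathbb{X}^k$. Suppose that for ($\mathbf{K}^k$-almost) every $\mathbf{x}\in\mathbb{X}^k$ with $p(\mathbf{x})>0$ there is a pair of coupled point processes $\xi^{\mathbf{x}}$ and $\tilde{\xi}^{\mathbf{x}}$ (on a common probability space) such that $\xi^{\mathbf{x}}\stackrel{d}{=}\xi$ and the distribution of $\tilde{\xi}^{\mathbf{x}}$ is the conditional distribution of $\xi[\eta+\delta_{\mathbf{x}}]-\delta_{f(\mathbf{x})}$ given $g(\mathbf{x},\eta+\delta_{\mathbf{x}})=1$.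 Assume also that $\mathbf{x}\mapsto\mathbb{E}\{(\xi^{\mathbf{x}}\triangle\tilde{\xi}^{\mathbf{x}})(\mathbb{Y})\}$ is measurable. Let $\zeta$ be a Poisson process on $\mathbb{Y}$ with a finite intensity measure $\mathbf{M}$. Then $$\mathbf{d_{KR}}(\xi,\zeta)\le d_{TV}(\mathbf{L},\mathbf{M})+\frac{2}{k!}\int_{\mathbb{X}^k}\mathbb{E}\{(\xi^{\mathbf{x}}\triangle\tilde{\xi}^{\mathbf{x}})(\mathbb{Y})\}\,p(\mathbf{x})\,\mathbf{K}^k(\mathrm{d}\mathbf{x}).$$
   Context: $\mathbf{N}_{\mathbb{X}}$ (resp. $\widehat{\mathbf{N}}_{\mathbb{X}}$) is the space of $\sigma$-finite (resp. finite) counting measures on $\mathbb{X}$, with the $\sigma$-algebra generated by the maps $\omega\mapsto\omega(B)$, $B\in\mathcal{X}$; similarly for $\mathbb{Y}$. A point process is a random counting measure. Counting measures $\omega=\sum_{i\in I}\delta_{x_i}$ are identified with multisets; $\omega^k_{\neq}:=\{(x_{i_1},\ldots,x_{i_k}): i_1,\ldots,i_k\in I \text{ pairwise distinct}\}$ and sums over $\omega^k_{\neq}$ run over all $k$-tuples of pairwise distinct indices. For $\mathbf{x}=(x_1,\ldots,x_k)$, $\delta_{\mathbf{x}}:=\sum_{i=1}^k\delta_{x_i}$. For counting measures $\omega_1,\omega_2$, $\omega_1\setminus\omega_2$ is the multiset difference (with multiplicities) and $\omega_1\triangle\omega_2:=\omega_1\setminus\omega_2+\omega_2\setminus\omega_1$.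 The intensity measure of $\xi$ is $\mathbf{L}(A)=\mathbb{E}\{\xi(A)\}$, $A\in\mathcal{Y}$; equivalently $\mathbf{L}(A)=\frac1{k!}\int_{\mathbb{X}^k}\mathbf{1}\{f(\mathbf{x})\in A\}\,p(\mathbf{x})\,\mathbf{K}^k(\mathrm{d}\mathbf{x})$. For measures $\mu_1,\mu_2$, $d_{TV}(\mu_1,\mu_2):=\sup\{|\mu_1(A)-\mu_2(A)|\}$, the supremum being over measurable $A$ with $\mu_1(A),\mu_2(A)<\infty$. The Kantorovich–Rubinstein distance between (a.s.) finite point processes on $\mathbb{Y}$ is $\mathbf{d_{KR}}(\xi,\zeta):=\sup_{h}|\mathbb{E}\{h(\xi)\}-\mathbb{E}\{h(\zeta)\}|$, the supremum being over all measurable $h:\widehat{\mathbf{N}}_{\mathbb{Y}}\to\mathbb{R}$ with $|h(\omega_1)-h(\omega_2)|\le d_{TV}(\omega_1,\omega_2)$ for all $\omega_1,\omega_2\in\widehat{\mathbf{N}}_{\mathbb{Y}}$. *)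

theory Defs
  imports "HOL-Probability.Probability"
begin

section \<open>Spaces of counting measures\<close>

definition evaluation_algebra :: "'a::topological_space measure set \<Rightarrow> 'a measure measure" where
  "evaluation_algebra S =
     sigma S {{\<omega> \<in> S. emeasure \<omega> B \<in> C} | B C. B \<in> sets borel \<and> C \<in> sets borel}"

definition counting_measures :: "'a::topological_space measure set" where
  "counting_measures =
     {\<omega>. sets \<omega> = sets borel \<and> sigma_finite_measure \<omega> \<and>
          (\<forall>B\<in>sets borel. emeasure \<omega> B \<in> \<nat> \<union> {\<infinity>})}"

definition finite_counting_measures :: "'a::topological_space measure set" where
  "finite_counting_measures = {\<omega> \<in> counting_measures. finite_measure \<omega>}"

abbreviation N_space :: "'a::topological_space measure measure" where
  "N_space \<equiv> evaluation_algebra counting_measures"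

abbreviation Nfin_space :: "'a::topological_space measure measure" where
  "Nfin_space \<equiv> evaluation_algebra finite_counting_measures"

definition plus_measure :: "'a measure \<Rightarrow> 'a measure \<Rightarrow> 'a measure" where
  "plus_measure \<mu> \<nu> = measure_of (space \<mu>) (sets \<mu>) (\<lambda>A. emeasure \<mu> A + emeasure \<nu> A)"

text \<open>\<open>\<delta>\<^sub>x = \<delta>\<^bsub>x 0\<^esub> + \<dots> + \<delta>\<^bsub>x (k - 1)\<^esub>\<close> for a tuple \<open>x\<close>, as the image of the counting measure on
  the index set.\<close>

definition dirac_tuple :: "nat \<Rightarrow> (nat \<Rightarrow> 'a::topological_space) \<Rightarrow> 'a measure" where
  "dirac_tuple k x = distr (count_space {..<k}) borel x"

text \<open>Multiset difference: the multiplicities \<open>\<omega>{x}\<close> are subtracted with truncation at \<open>0\<close>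
  (which is what subtraction on \<^typ>\<open>ennreal\<close> does for finite values).\<close>

definition mset_diff :: "'a::topological_space measure \<Rightarrow> 'a measure \<Rightarrow> 'a measure" where
  "mset_diff \<omega>\<^sub>1 \<omega>\<^sub>2 =
     distr (density (count_space UNIV) (\<lambda>x. emeasure \<omega>\<^sub>1 {x} - emeasure \<omega>\<^sub>2 {x})) borel (\<lambda>x. x)"

definition mset_symdiff :: "'a::topological_space measure \<Rightarrow> 'a measure \<Rightarrow> 'a measure" where
  "mset_symdiff \<omega>\<^sub>1 \<omega>\<^sub>2 = plus_measure (mset_diff \<omega>\<^sub>1 \<omega>\<^sub>2) (mset_diff \<omega>\<^sub>2 \<omega>\<^sub>1)"

text \<open>A canonical index set \<open>I\<close> with \<open>\<omega> = \<Sum>\<^bsub>i\<in>I\<^esub> \<delta>\<^bsub>fst i\<^esub>\<close>: the point \<open>x\<close> carries the indices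
  \<open>(x, 0), \<dots>, (x, \<omega>{x} - 1)\<close>.  The \<open>k\<close>-tuples of pairwise distinct indices are then the
  injective maps \<open>{..<k} \<rightarrow> I\<close>.\<close>

definition point_indices :: "'a measure \<Rightarrow> ('a \<times> nat) set" where
  "point_indices \<omega> = {(x, j). real j < measure \<omega> {x}}"

definition distinct_index_tuples :: "nat \<Rightarrow> 'a measure \<Rightarrow> (nat \<Rightarrow> 'a \<times> nat) set" where
  "distinct_index_tuples k \<omega> = {t \<in> {..<k} \<rightarrow>\<^sub>E point_indices \<omega>. inj_on t {..<k}}"

definition tuple_points :: "nat \<Rightarrow> (nat \<Rightarrow> 'a \<times> nat) \<Rightarrow> nat \<Rightarrow> 'a" where
  "tuple_points k t = (\<lambda>i\<in>{..<k}. fst (t i))"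

text \<open>\<open>\<xi>[\<omega>] = 1/k! \<Sum> g(x,\<omega>) \<delta>\<^bsub>f(x)\<^esub>\<close>, the sum running over \<open>\<omega>\<^sup>k\<^sub>\<noteq>\<close>; see \<open>emeasure_xi_of\<close> below.\<close>

definition xi_of ::
  "nat \<Rightarrow> ((nat \<Rightarrow> 'a) \<Rightarrow> 'b::topological_space) \<Rightarrow> ((nat \<Rightarrow> 'a) \<Rightarrow> 'a measure \<Rightarrow> nat)
     \<Rightarrow> 'a measure \<Rightarrow> 'b measure" where
  "xi_of k f g \<omega> =
     scale_measure (1 / fact k)
       (distr (density (count_space (distinct_index_tuples k \<omega>))
                 (\<lambda>t. of_nat (g (tuple_points k t) \<omega>)))
              borel (\<lambda>t. f (tuple_points k t)))"


section \<open>Point processes\<close>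

text \<open>For infinite \<open>K B\<close> nothing is required: by \<open>\<sigma>\<close>-finiteness of \<open>K\<close> and independence the
  two conditions already force \<open>\<eta> B = \<infinity>\<close> almost surely.\<close>

definition poisson_process ::
  "'w measure \<Rightarrow> 'a::topological_space measure \<Rightarrow> ('w \<Rightarrow> 'a measure) \<Rightarrow> bool" where
  "poisson_process P K \<eta> \<longleftrightarrow>
     prob_space P \<and> \<eta> \<in> P \<rightarrow>\<^sub>M N_space \<and>
     (\<forall>B\<in>sets borel. emeasure K B < \<infinity> \<longrightarrow>
        (\<forall>n::nat. measure P {w \<in> space P. emeasure (\<eta> w) B = of_nat n}
                  = measure K B ^ n / fact n * exp (- measure K B))) \<and>
     (\<forall>F. finite F \<and> F \<subseteq> sets borel \<and> disjoint F \<longrightarrow>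
        prob_space.indep_vars P (\<lambda>_. borel) (\<lambda>B w. emeasure (\<eta> w) B) F)"

text \<open>An a.s. finite point process need only agree almost surely with a random element of the
  space of finite counting measures: \<open>\<xi>[\<eta>]\<close> may fail to be \<open>\<sigma>\<close>-finite (or measurable) on a null
  set.  For the same reason probabilities and expectations of functionals of such processes are
  taken with respect to the completed measure, so that they do not depend on null sets.\<close>

definition as_finite_point_process ::
  "'w measure \<Rightarrow> ('w \<Rightarrow> 'b::topological_space measure) \<Rightarrow> bool" where
  "as_finite_point_process P \<xi> \<longleftrightarrow>
     prob_space P \<and> (\<exists>\<xi>'\<in>P \<rightarrow>\<^sub>M Nfin_space. AE w in P. \<xi> w = \<xi>' w)"

definition same_law ::
  "'v measure \<Rightarrow> ('v \<Rightarrow> 'b::topological_space measure) \<Rightarrow> 'w measure \<Rightarrow> ('w \<Rightarrow> 'b measure) \<Rightarrow> bool" where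
  "same_law Q \<xi>\<^sub>1 P \<xi>\<^sub>2 \<longleftrightarrow>
     (\<forall>A\<in>sets Nfin_space.
        \<P>(v in completion Q. \<xi>\<^sub>1 v \<in> A) = \<P>(w in completion P. \<xi>\<^sub>2 w \<in> A))"

text \<open>The law of \<open>\<xi>\<^sub>1\<close> under \<open>Q\<close> is the conditional law of \<open>\<xi>\<^sub>2\<close> under \<open>P\<close> given the event \<open>E\<close>
  (of positive probability).\<close>

definition has_conditional_law ::
  "'v measure \<Rightarrow> ('v \<Rightarrow> 'b::topological_space measure) \<Rightarrow>
     'w measure \<Rightarrow> ('w \<Rightarrow> 'b measure) \<Rightarrow> ('w \<Rightarrow> bool) \<Rightarrow> bool" where
  "has_conditional_law Q \<xi>\<^sub>1 P \<xi>\<^sub>2 E \<longleftrightarrow>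
     (\<forall>A\<in>sets Nfin_space.
        \<P>(v in completion Q. \<xi>\<^sub>1 v \<in> A) = \<P>(w in completion P. \<xi>\<^sub>2 w \<in> A \<bar> E w))"

definition intensity_measure ::
  "'w measure \<Rightarrow> ('w \<Rightarrow> 'b::topological_space measure) \<Rightarrow> 'b measure" where
  "intensity_measure P \<xi> = measure_of UNIV (sets borel) (\<lambda>A. \<integral>\<^sup>+w. emeasure (\<xi> w) A \<partial>P)"


section \<open>Distances\<close>

definition d_TV :: "'a measure \<Rightarrow> 'a measure \<Rightarrow> ennreal" where
  "d_TV \<mu>\<^sub>1 \<mu>\<^sub>2 =
     (SUP A\<in>{A \<in> sets \<mu>\<^sub>1 \<inter> sets \<mu>\<^sub>2. emeasure \<mu>\<^sub>1 A < \<infinity> \<and> emeasure \<mu>\<^sub>2 A < \<infinity>}.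
        ennreal \<bar>measure \<mu>\<^sub>1 A - measure \<mu>\<^sub>2 A\<bar>)"

definition TV_Lipschitz :: "('b::topological_space measure \<Rightarrow> real) set" where
  "TV_Lipschitz =
     {h \<in> Nfin_space \<rightarrow>\<^sub>M borel.
        \<forall>\<omega>\<^sub>1\<in>finite_counting_measures. \<forall>\<omega>\<^sub>2\<in>finite_counting_measures.
          ennreal \<bar>h \<omega>\<^sub>1 - h \<omega>\<^sub>2\<bar> \<le> d_TV \<omega>\<^sub>1 \<omega>\<^sub>2}"

text \<open>The values of \<open>h\<close> outside the finite counting measures are immaterial, since \<open>\<xi>\<close> and \<open>\<zeta>\<close>
  are a.s. finite.\<close>

definition d_KR ::
  "'v measure \<Rightarrow> ('v \<Rightarrow> 'b::topological_space measure) \<Rightarrow> 'w measure \<Rightarrow> ('w \<Rightarrow> 'b measure) \<Rightarrow> ennreal"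
  where
  "d_KR P \<xi> R \<zeta> =
     (SUP h\<in>TV_Lipschitz.
        ennreal \<bar>(LINT w|completion P. h (\<xi> w)) - (LINT w|completion R. h (\<zeta> w))\<bar>)"


section \<open>Basic facts\<close>

lemma space_evaluation_algebra [simp]: "space (evaluation_algebra S) = S"
  unfolding evaluation_algebra_def by (rule space_measure_of) auto

lemma measurable_emeasure_evaluation [measurable]:
  assumes "B \<in> sets borel"
  shows "(\<lambda>\<omega>. emeasure \<omega> B) \<in> borel_measurable (evaluation_algebra S)"
proof (rule measurableI)
  fix C :: "ennreal set" assume C: "C \<in> sets borel"
  have "(\<lambda>\<omega>. emeasure \<omega> B) -` C \<inter> space (evaluation_algebra S) = {\<omega> \<in> S. emeasure \<omega> B \<in> C}"
    by auto
  also have "\<dots> \<in> sets (evaluation_algebra S)"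
    unfolding evaluation_algebra_def using assms C by (intro in_measure_of) auto
  finally show "(\<lambda>\<omega>. emeasure \<omega> B) -` C \<inter> space (evaluation_algebra S)
      \<in> sets (evaluation_algebra S)" .
qed simp

lemma emeasure_plus_measure:
  assumes "sets \<mu> = sets \<nu>" "A \<in> sets \<mu>"
  shows "emeasure (plus_measure \<mu> \<nu>) A = emeasure \<mu> A + emeasure \<nu> A"
  unfolding plus_measure_def
proof (rule emeasure_measure_of_sigma)
  show "sigma_algebra (space \<mu>) (sets \<mu>)" ..
  show "positive (sets \<mu>) (\<lambda>A. emeasure \<mu> A + emeasure \<nu> A)"
    by (simp add: positive_def)
  show "countably_additive (sets \<mu>) (\<lambda>A. emeasure \<mu> A + emeasure \<nu> A)"
  proof (rule countably_additiveI)
    fix F :: "nat \<Rightarrow> 'a set"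
    assume F: "range F \<subseteq> sets \<mu>" "disjoint_family F"
    have F': "range F \<subseteq> sets \<nu>" using F(1) assms(1) by simp
    have "(\<Sum>i. emeasure \<mu> (F i) + emeasure \<nu> (F i))
        = (\<Sum>i. emeasure \<mu> (F i)) + (\<Sum>i. emeasure \<nu> (F i))"
      by (rule suminf_add[symmetric]) auto
    then show "(\<Sum>i. emeasure \<mu> (F i) + emeasure \<nu> (F i)) =
        emeasure \<mu> (\<Union>i. F i) + emeasure \<nu> (\<Union>i. F i)"
      using F F' by (simp add: suminf_emeasure)
  qed
qed fact

lemma sets_plus_measure [simp]: "sets (plus_measure \<mu> \<nu>) = sets \<mu>"
  by (simp add: plus_measure_def)

lemma emeasure_dirac_tuple:
  assumes "A \<in> sets borel"
  shows "emeasure (dirac_tuple k x) A = (\<Sum>i<k. indicator A (x i))"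
proof -
  have "emeasure (dirac_tuple k x) A = (\<integral>\<^sup>+i. indicator A (x i) \<partial>count_space {..<k})"
    using assms unfolding dirac_tuple_def
    by (subst emeasure_distr)
       (auto simp: nn_integral_indicator[symmetric] indicator_def simp del: nn_integral_indicator
             intro!: nn_integral_cong)
  then show ?thesis by (simp add: nn_integral_count_space_finite)
qed

lemma emeasure_mset_symdiff:
  fixes \<omega>\<^sub>1 \<omega>\<^sub>2 :: "'a::topological_space measure"
  shows "emeasure (mset_symdiff \<omega>\<^sub>1 \<omega>\<^sub>2) UNIV =
    (\<integral>\<^sup>+x. emeasure \<omega>\<^sub>1 {x} - emeasure \<omega>\<^sub>2 {x} \<partial>count_space UNIV) +
    (\<integral>\<^sup>+x. emeasure \<omega>\<^sub>2 {x} - emeasure \<omega>\<^sub>1 {x} \<partial>count_space UNIV)"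
  unfolding mset_symdiff_def
  by (subst emeasure_plus_measure)
     (auto simp: mset_diff_def emeasure_distr emeasure_density)

lemma emeasure_xi_of:
  assumes "A \<in> sets borel"
  shows "emeasure (xi_of k f g \<omega>) A =
    1 / fact k * (\<integral>\<^sup>+t. of_nat (g (tuple_points k t) \<omega>) * indicator A (f (tuple_points k t))
                    \<partial>count_space (distinct_index_tuples k \<omega>))"
  using assms unfolding xi_of_def
  by (subst emeasure_scale_measure, subst emeasure_distr)
     (auto simp: emeasure_density indicator_def intro!: arg_cong2[where f="(*)"] nn_integral_cong)

end

theory Submission
  imports Defs "HOL-Library.Multiset" "HOL-Combinatorics.Permutations"
begin

text \<open>The bound is obtained by Stein's method, with an elementary solution of the Stein equation.

  Let \<open>h\<close> be Lipschitz with respect to total variation and let \<open>A\<close>, \<open>Z\<close> be finite configurations. Pass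
  from \<open>Z\<close> to \<open>A\<close> by deleting the points of \<open>Z\<close> and inserting the points of \<open>A\<close>, one at a time and in
  uniformly random order. The operation on a point \<open>y\<close> changes \<open>h\<close> by \<open>h (m + \<delta>\<^sub>y) - h m\<close>, up to sign,
  where \<open>m\<close> is the configuration met at that time; its mean depends only on \<open>y\<close> and on the other points
  of \<open>A\<close> and \<open>Z\<close>. With \<open>G\<^sub>Z(y, A)\<close> for this mean, when \<open>A\<close> and \<open>Z\<close> are the other points,
  \<open>h A - h Z = \<Sum>\<^bsub>x\<in>A\<^esub> G\<^sub>Z(x, A - \<delta>\<^sub>x) - \<Sum>\<^bsub>z\<in>Z\<^esub> G\<^bsub>Z - \<delta> z\<^esub>(z, A)\<close> (\<open>path_avg_telescope\<close>).
  Now let \<open>Z = \<zeta>\<close> be the Poisson process and average. The Mecke formula turns the second sum into an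
  integral against \<open>M\<close>, and \<open>G = \<E> G\<^sub>\<zeta>\<close> solves
  \<open>h A - \<E> h(\<zeta>) = \<Sum>\<^bsub>x\<in>A\<^esub> G(x, A - \<delta>\<^sub>x) - \<integral> G(y, A) M(dy)\<close> (\<open>stein_sol\<close>). Since \<open>h\<close> changes by at most \<open>1\<close>
  when a point is inserted or exchanged, \<open>\<bar>G\<bar> \<le> 1\<close> and \<open>\<bar>G(y, A) - G(z, A)\<bar> \<le> 1\<close>.

  Insert \<open>A = \<xi>\<close> and take expectations. By the Mecke formula for \<open>k\<close>-tuples of points of \<open>\<eta>\<close>, the sum
  over \<open>\<xi>\<close> becomes \<open>1/k! \<integral> \<E>[g(x, \<eta> + \<delta>\<^sub>x) G(f x, \<xi>[\<eta> + \<delta>\<^sub>x] - \<delta>\<^bsub>f x\<^esub>)] K\<^sup>k(dx)\<close>, that is,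
  \<open>1/k! \<integral> p(x) \<E> G(f x, \<xi>2 x) K\<^sup>k(dx)\<close> (\<open>xi_mecke_real\<close>, \<open>conditional_law_integral\<close>). With
  \<open>F y = \<E> G(y, \<xi>)\<close>, the same formula gives \<open>\<integral> F dL = 1/k! \<integral> p(x) \<E> G(f x, \<xi>1 x) K\<^sup>k(dx)\<close>. Therefore
  \<open>\<E> h(\<xi>) - \<E> h(\<zeta>)\<close> is the sum of \<open>1/k! \<integral> p(x) \<E>[G(f x, \<xi>2 x) - G(f x, \<xi>1 x)] K\<^sup>k(dx)\<close> and of
  \<open>\<integral> F dL - \<integral> F dM\<close>. In the first term the bracket vanishes unless \<open>\<xi>1 x \<noteq> \<xi>2 x\<close> and is at most \<open>2\<close> otherwise,
  hence at most twice the size of the symmetric difference (\<open>coupling_bound\<close>). The second term is at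
  most \<open>d_TV L M\<close>, with constant \<open>1\<close>, because the values of \<open>F\<close> lie in an interval of length \<open>1\<close>
  (\<open>integral_diff_le_d_TV\<close>).

  Three facts make these formulas meaningful. A counting measure on a second countable Hausdorff
  space is a sum of point masses, so that sums over distinct points can be peeled off one integral at
  a time (\<open>fact_sum_Suc\<close>). Almost surely, \<open>\<eta>\<close> is finite on each piece of a fixed countable
  partition, and on such measures all integrals are measurable functions of the measure
  (\<open>kernel_nn_integral_measurable\<close>). Finally, \<open>\<xi>[\<omega>]\<close> is integer valued where it is finite, since each
  unordered \<open>k\<close>-tuple is counted \<open>k!\<close> times (\<open>xi_of_Nats\<close>); it can therefore be handled as a multiset.\<close>

section \<open>Counting measures are sums of point masses\<close>

lemma counting_measuresD:
  assumes "\<omega> \<in> counting_measures"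
  shows "sets \<omega> = sets borel" "space \<omega> = UNIV" "sigma_finite_measure \<omega>"
    "B \<in> sets borel \<Longrightarrow> emeasure \<omega> B \<noteq> \<infinity> \<Longrightarrow> \<exists>n. emeasure \<omega> B = of_nat n"
proof -
  show *: "sets \<omega> = sets borel" using assms by (auto simp: counting_measures_def)
  then show "space \<omega> = UNIV" by (metis sets_eq_imp_space_eq space_borel)
  show "sigma_finite_measure \<omega>" using assms by (auto simp: counting_measures_def)
  show "B \<in> sets borel \<Longrightarrow> emeasure \<omega> B \<noteq> \<infinity> \<Longrightarrow> \<exists>n. emeasure \<omega> B = of_nat n"
    using assms by (auto simp: counting_measures_def Nats_def)
qed

text \<open>A subset of minimal positive mass cannot be split. As the topology has a countable base and
  separates points, it is a single point up to a null set.\<close>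

lemma counting_measure_has_atom:
  fixes \<omega> :: "'a::{second_countable_topology, t2_space} measure"
  assumes \<omega>: "\<omega> \<in> counting_measures" and B: "B \<in> sets borel"
    and pos: "emeasure \<omega> B \<noteq> 0" and fin: "emeasure \<omega> B \<noteq> \<infinity>"
  shows "\<exists>x\<in>B. emeasure \<omega> {x} \<noteq> 0"
proof -
  note D = counting_measuresD[OF \<omega>]
  define Q where "Q n \<longleftrightarrow> (\<exists>C\<in>sets borel. C \<subseteq> B \<and> emeasure \<omega> C = of_nat n \<and> n > 0)" for n :: nat
  obtain n where "emeasure \<omega> B = of_nat n" using D(4)[OF B fin] by auto
  then have "Q n" using B pos unfolding Q_def by (auto intro!: bexI[of _ B] gr0I)
  define m where "m = (LEAST n. Q n)"
  have Qm: "Q m" unfolding m_def by (rule LeastI) fact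
  then obtain C where C: "C \<in> sets borel" "C \<subseteq> B" "emeasure \<omega> C = of_nat m" "m > 0"
    by (auto simp: Q_def)
  have min: "emeasure \<omega> C' = 0 \<or> emeasure \<omega> C' = of_nat m" if C': "C' \<in> sets borel" "C' \<subseteq> C" for C'
  proof -
    have le: "emeasure \<omega> C' \<le> of_nat m" using C' C D by (metis emeasure_mono)
    then have "emeasure \<omega> C' \<noteq> \<infinity>" by (auto simp: top_unique)
    then obtain j where j: "emeasure \<omega> C' = of_nat j" using D(4) C' by auto
    show ?thesis
    proof (cases "j = 0")
      case False
      then have "Q j" using C' C j by (auto simp: Q_def intro!: bexI[of _ C'])
      then have "m \<le> j" unfolding m_def by (rule Least_le)
      with le j show ?thesis by simp
    qed (use j in simp)
  qed
  obtain U :: "'a set set" where U: "countable U" "topological_basis U"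
    using ex_countable_basis by auto
  have Uopen: "open u" if "u \<in> U" for u using U that by (simp add: topological_basis_open)
  \<comment> \<open>Each basic open set either carries all of the minimal mass or none of it; discarding the
    null alternatives leaves a set in which no two points can be separated.\<close>
  define N where "N u = (if emeasure \<omega> (C \<inter> u) = 0 then C \<inter> u else C - u)" for u
  have N0: "N u \<in> null_sets \<omega>" if u: "u \<in> U" for u
  proof (cases "emeasure \<omega> (C \<inter> u) = 0")
    case True
    then show ?thesis using Uopen[OF u] C D by (auto simp: N_def null_sets_def)
  next
    case False
    then have e: "emeasure \<omega> (C \<inter> u) = of_nat m" using min[of "C \<inter> u"] Uopen[OF u] C by auto
    have "emeasure \<omega> C = emeasure \<omega> (C \<inter> u) + emeasure \<omega> (C - u)"
      using Uopen[OF u] C D by (subst plus_emeasure) (auto simp: Int_Diff_Un)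
    then have "emeasure \<omega> (C - u) = 0" using e C by simp
    then show ?thesis using False Uopen[OF u] C D by (auto simp: N_def null_sets_def)
  qed
  have NU: "(\<Union>u\<in>U. N u) \<in> null_sets \<omega>" using U(1) N0 by (rule null_sets_UN')
  define E where "E = C - (\<Union>u\<in>U. N u)"
  have E: "emeasure \<omega> E = of_nat m"
    unfolding E_def using NU C D by (subst emeasure_Diff_null_set) auto
  then have "E \<noteq> {}" using C by auto
  then obtain x where x: "x \<in> E" by auto
  have "y = x" if y: "y \<in> E" for y
  proof (rule ccontr)
    assume "y \<noteq> x"
    then obtain V W where V: "open V" "y \<in> V" "x \<notin> V" using hausdorff[of y x] by auto
    then obtain u where "u \<in> U" "y \<in> u" "u \<subseteq> V" using U(2) by (metis topological_basisE)
    then show False using x y V by (auto simp: E_def N_def split: if_splits)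
  qed
  then have "E = {x}" using x by blast
  then show ?thesis using E C x by (intro bexI[of _ x]) (auto simp: E_def)
qed

text \<open>An atom has mass at least \<open>1\<close>, so a set of finite measure contains only finitely many.\<close>

lemma counting_measure_countable_atoms:
  fixes \<omega> :: "'a::{second_countable_topology, t2_space} measure"
  assumes \<omega>: "\<omega> \<in> counting_measures"
  shows "countable {x. emeasure \<omega> {x} \<noteq> 0}"
proof -
  note D = counting_measuresD[OF \<omega>]
  interpret sigma_finite_measure \<omega> by (rule D)
  obtain A :: "nat \<Rightarrow> 'a set" where A: "range A \<subseteq> sets \<omega>" "(\<Union>i. A i) = space \<omega>"
    "\<And>i. emeasure \<omega> (A i) \<noteq> \<infinity>" using sigma_finite by blast
  have "finite {x\<in>A i. emeasure \<omega> {x} \<noteq> 0}" for i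
  proof (rule ccontr)
    assume inf: "infinite {x\<in>A i. emeasure \<omega> {x} \<noteq> 0}"
    have Ai: "A i \<in> sets borel" using A D by auto
    obtain n where n: "emeasure \<omega> (A i) = of_nat n" using D(4)[OF Ai] A(3)[of i] by auto
    obtain T where T: "finite T" "card T = Suc n" "T \<subseteq> {x\<in>A i. emeasure \<omega> {x} \<noteq> 0}"
      using infinite_arbitrarily_large[OF inf] by blast
    have ge1: "1 \<le> emeasure \<omega> {x}" if "x \<in> T" for x
    proof -
      have "emeasure \<omega> {x} \<le> emeasure \<omega> (A i)" using that T D Ai by (intro emeasure_mono) auto
      then have "emeasure \<omega> {x} \<noteq> \<infinity>" using n by (auto simp: top_unique)
      then obtain j where "emeasure \<omega> {x} = of_nat j" using D(4)[of "{x}"] by auto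
      moreover have "emeasure \<omega> {x} \<noteq> 0" using T that by auto
      ultimately show ?thesis by (cases j) auto
    qed
    have "of_nat (Suc n) = (\<Sum>x\<in>T. 1::ennreal)" using T by simp
    also have "\<dots> \<le> (\<Sum>x\<in>T. emeasure \<omega> {x})" by (intro sum_mono ge1)
    also have "\<dots> = emeasure \<omega> T"
      using T D by (intro emeasure_eq_sum_singleton[symmetric]) auto
    also have "\<dots> \<le> of_nat n" unfolding n[symmetric] using T Ai D by (intro emeasure_mono) auto
    finally show False by (metis Suc_n_not_le_n of_nat_le_iff)
  qed
  then have "countable (\<Union>i. {x\<in>A i. emeasure \<omega> {x} \<noteq> 0})"
    by (intro countable_UN) (auto intro: countable_finite)
  moreover have "{x. emeasure \<omega> {x} \<noteq> 0} \<subseteq> (\<Union>i. {x\<in>A i. emeasure \<omega> {x} \<noteq> 0})"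
    using A(2) D by auto
  ultimately show ?thesis by (rule countable_subset[rotated])
qed

lemma counting_measure_null_outside_atoms:
  fixes \<omega> :: "'a::{second_countable_topology, t2_space} measure"
  assumes \<omega>: "\<omega> \<in> counting_measures" and B: "B \<in> sets borel"
    and no: "\<And>x. x \<in> B \<Longrightarrow> emeasure \<omega> {x} = 0"
  shows "emeasure \<omega> B = 0"
proof -
  note D = counting_measuresD[OF \<omega>]
  interpret sigma_finite_measure \<omega> by (rule D)
  obtain A :: "nat \<Rightarrow> 'a set" where A: "range A \<subseteq> sets \<omega>" "(\<Union>i. A i) = space \<omega>"
    "\<And>i. emeasure \<omega> (A i) \<noteq> \<infinity>" using sigma_finite by blast
  have "B \<inter> A i \<in> null_sets \<omega>" for i
  proof -
    have Ai: "A i \<in> sets borel" using A D by auto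
    have "emeasure \<omega> (B \<inter> A i) \<le> emeasure \<omega> (A i)" using Ai D by (intro emeasure_mono) auto
    then have "emeasure \<omega> (B \<inter> A i) \<noteq> \<infinity>" using A(3)[of i] by (auto simp: top_unique)
    then have "emeasure \<omega> (B \<inter> A i) = 0"
      using counting_measure_has_atom[OF \<omega>, of "B \<inter> A i"] B Ai no by auto
    then show ?thesis using B Ai D by auto
  qed
  then have "(\<Union>i. B \<inter> A i) \<in> null_sets \<omega>" by (intro null_sets_UN)
  moreover have "(\<Union>i. B \<inter> A i) = B" using A(2) D by auto
  ultimately show ?thesis by auto
qed

lemma emeasure_singleton_of_nat:
  fixes \<omega> :: "'a::{second_countable_topology, t2_space} measure"
  assumes \<omega>: "\<omega> \<in> counting_measures"
  shows "\<exists>n. emeasure \<omega> {x} = of_nat n"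
proof -
  note D = counting_measuresD[OF \<omega>]
  interpret sigma_finite_measure \<omega> by (rule D)
  obtain A :: "nat \<Rightarrow> 'a set" where A: "range A \<subseteq> sets \<omega>" "(\<Union>i. A i) = space \<omega>"
    "\<And>i. emeasure \<omega> (A i) \<noteq> \<infinity>" using sigma_finite by blast
  have "x \<in> (\<Union>i. A i)" using A(2) D(2) by simp
  then obtain i where "x \<in> A i" by blast
  then have "emeasure \<omega> {x} \<le> emeasure \<omega> (A i)" using A by (intro emeasure_mono) auto
  then have "emeasure \<omega> {x} \<noteq> \<infinity>" using A(3)[of i] by (auto simp: top_unique)
  then show ?thesis using D(4)[of "{x}"] by auto
qed

definition multiplicity_at :: "'a measure \<Rightarrow> 'a \<Rightarrow> nat" where
  "multiplicity_at \<omega> x = nat \<lfloor>measure \<omega> {x}\<rfloor>"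

lemma emeasure_singleton_eq_multiplicity:
  fixes \<omega> :: "'a::{second_countable_topology, t2_space} measure"
  assumes \<omega>: "\<omega> \<in> counting_measures"
  shows "emeasure \<omega> {x} = of_nat (multiplicity_at \<omega> x)"
    and "measure \<omega> {x} = real (multiplicity_at \<omega> x)"
proof -
  obtain n where n: "emeasure \<omega> {x} = of_nat n" using emeasure_singleton_of_nat[OF \<omega>] by blast
  then have "measure \<omega> {x} = real n"
    by (metis enn2real_ennreal ennreal_of_nat_eq_real_of_nat measure_def of_nat_0_le_iff)
  then show "emeasure \<omega> {x} = of_nat (multiplicity_at \<omega> x)"
    "measure \<omega> {x} = real (multiplicity_at \<omega> x)" using n by (auto simp: multiplicity_at_def)
qed

lemma nn_integral_counting_measure:
  fixes \<omega> :: "'a::{second_countable_topology, t2_space} measure"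
  assumes \<omega>: "\<omega> \<in> counting_measures" and u: "u \<in> borel_measurable borel"
  shows "(\<integral>\<^sup>+x. u x \<partial>\<omega>) = (\<integral>\<^sup>+x. of_nat (multiplicity_at \<omega> x) * u x \<partial>count_space UNIV)"
proof -
  note D = counting_measuresD[OF \<omega>]
  have u': "u \<in> borel_measurable \<omega>" using u D(1) measurable_cong_sets by blast
  define S where "S = {x. emeasure \<omega> {x} \<noteq> 0}"
  have S: "countable S" unfolding S_def by (rule counting_measure_countable_atoms[OF \<omega>])
  have Sm: "S \<in> sets borel" by (metis S sets.countable borel_singleton sets.empty_sets)
  have "emeasure \<omega> (- S) = 0"
    by (rule counting_measure_null_outside_atoms[OF \<omega>]) (auto simp: S_def Sm[unfolded S_def] intro: borel_comp)
  then have "AE x in \<omega>. x \<in> S" using D Sm by (intro AE_I[of _ _ "- S"]) (auto simp: borel_comp)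
  then have "(\<integral>\<^sup>+x. u x \<partial>\<omega>) = (\<integral>\<^sup>+x. u x * indicator S x \<partial>\<omega>)"
    by (intro nn_integral_cong_AE) auto
  also have "\<dots> = (\<integral>\<^sup>+x. (\<integral>\<^sup>+y. u y * indicator {y} x \<partial>count_space S) \<partial>\<omega>)"
  proof (rule nn_integral_cong)
    fix x
    have "(\<integral>\<^sup>+y. u y * indicator {y} x \<partial>count_space S) = (\<integral>\<^sup>+y. (u x * indicator S x) * indicator {x} y \<partial>count_space UNIV)"
      by (subst nn_integral_count_space_indicator, simp, intro nn_integral_cong)
         (auto simp: indicator_def)
    also have "\<dots> = u x * indicator S x"
      by (subst nn_integral_cmult_indicator) auto
    finally show "u x * indicator S x = (\<integral>\<^sup>+y. u y * indicator {y} x \<partial>count_space S)" by simp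
  qed
  also have "\<dots> = (\<integral>\<^sup>+y. (\<integral>\<^sup>+x. u y * indicator {y} x \<partial>\<omega>) \<partial>count_space S)"
    using S D by (intro nn_integral_count_space_nn_integral) auto
  also have "\<dots> = (\<integral>\<^sup>+y. u y * emeasure \<omega> {y} \<partial>count_space S)"
    using D by (intro nn_integral_cong nn_integral_cmult_indicator) auto
  also have "\<dots> = (\<integral>\<^sup>+x. of_nat (multiplicity_at \<omega> x) * u x \<partial>count_space UNIV)"
    by (subst nn_integral_count_space_indicator, simp, intro nn_integral_cong)
       (auto simp: S_def emeasure_singleton_eq_multiplicity(1)[OF \<omega>] indicator_def mult.commute)
  finally show ?thesis .
qed

lemma point_indices_eq:
  fixes \<omega> :: "'a::{second_countable_topology, t2_space} measure"
  assumes \<omega>: "\<omega> \<in> counting_measures"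
  shows "point_indices \<omega> = {(x, j). j < multiplicity_at \<omega> x}"
  using emeasure_singleton_eq_multiplicity(2)[OF \<omega>] by (auto simp: point_indices_def)

lemma nn_integral_point_indices:
  fixes \<omega> :: "'a::{second_countable_topology, t2_space} measure"
  assumes \<omega>: "\<omega> \<in> counting_measures" and u: "u \<in> borel_measurable borel"
  shows "(\<integral>\<^sup>+x. u x \<partial>\<omega>) = (\<integral>\<^sup>+i. u (fst i) \<partial>count_space (point_indices \<omega>))"
proof -
  have "(\<integral>\<^sup>+i. u (fst i) \<partial>count_space (point_indices \<omega>))
      = (\<integral>\<^sup>+i. u (fst i) * indicator (point_indices \<omega>) i \<partial>count_space UNIV)"
    by (simp add: nn_integral_count_space_indicator)
  also have "\<dots> = (\<integral>\<^sup>+x. (\<integral>\<^sup>+j. u x * indicator (point_indices \<omega>) (x, j) \<partial>count_space UNIV) \<partial>count_space UNIV)"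
    by (subst nn_integral_fst_count_space[symmetric]) auto
  also have "\<dots> = (\<integral>\<^sup>+x. (\<integral>\<^sup>+j. u x * indicator {..<multiplicity_at \<omega> x} j \<partial>count_space UNIV) \<partial>count_space UNIV)"
    by (intro nn_integral_cong) (auto simp: point_indices_eq[OF \<omega>] indicator_def)
  also have "\<dots> = (\<integral>\<^sup>+x. of_nat (multiplicity_at \<omega> x) * u x \<partial>count_space UNIV)"
    by (intro nn_integral_cong) (subst nn_integral_cmult_indicator, auto simp: mult.commute)
  finally show ?thesis using nn_integral_counting_measure[OF assms] by simp
qed

section \<open>Measurability of integrals against a random counting measure\<close>

lemma measurable_evaluation_algebra:
  assumes "\<And>w. w \<in> space \<Omega> \<Longrightarrow> f w \<in> S"
    and "\<And>B. B \<in> sets borel \<Longrightarrow> (\<lambda>w. emeasure (f w) B) \<in> borel_measurable \<Omega>"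
  shows "f \<in> \<Omega> \<rightarrow>\<^sub>M evaluation_algebra S"
  unfolding evaluation_algebra_def
proof (rule measurable_measure_of)
  show "f \<in> space \<Omega> \<rightarrow> S" using assms(1) by auto
  fix y assume "y \<in> {{\<omega> \<in> S. emeasure \<omega> B \<in> C} | B C. B \<in> sets borel \<and> C \<in> sets borel}"
  then obtain B C where y: "y = {\<omega> \<in> S. emeasure \<omega> B \<in> C}" "B \<in> sets borel" "C \<in> sets borel" by auto
  have "f -` y \<inter> space \<Omega> = (\<lambda>w. emeasure (f w) B) -` C \<inter> space \<Omega>"
    using y assms(1) by auto
  also have "\<dots> \<in> sets \<Omega>" using assms(2)[OF y(2)] y(3) by measurable
  finally show "f -` y \<inter> space \<Omega> \<in> sets \<Omega>" .
qed auto

lemma measurable_eval_compose: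
  assumes "f \<in> \<Omega> \<rightarrow>\<^sub>M evaluation_algebra S" "B \<in> sets borel"
  shows "(\<lambda>w. emeasure (f w) B) \<in> borel_measurable \<Omega>"
  using assms by (rule measurable_compose[OF _ measurable_emeasure_evaluation])

text \<open>An integral against an arbitrary \<open>\<sigma>\<close>-finite counting measure need not depend measurably on
  that measure. It does on the measures that are finite on every member of one fixed countable
  partition, and a Poisson process almost surely is such a measure.\<close>

definition partition :: "(nat \<Rightarrow> 'a::topological_space set) \<Rightarrow> bool" where
  "partition B \<longleftrightarrow> range B \<subseteq> sets borel \<and> disjoint_family B \<and> (\<Union>i. B i) = UNIV"

definition loc_counting :: "(nat \<Rightarrow> 'a::topological_space set) \<Rightarrow> 'a measure set" where
  "loc_counting B = {\<omega> \<in> counting_measures. \<forall>n. emeasure \<omega> (B n) \<noteq> \<infinity>}"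

abbreviation N_loc :: "(nat \<Rightarrow> 'a::topological_space set) \<Rightarrow> 'a measure measure" where
  "N_loc B \<equiv> evaluation_algebra (loc_counting B)"

lemma partition_sets: "partition B \<Longrightarrow> B n \<in> sets borel"
  by (auto simp: partition_def)

lemma loc_counting_subset: "\<omega> \<in> loc_counting B \<Longrightarrow> \<omega> \<in> counting_measures"
  by (auto simp: loc_counting_def)

lemma measurable_N_loc_N_space: "(\<lambda>\<omega>. \<omega>) \<in> N_loc B \<rightarrow>\<^sub>M N_space"
  by (rule measurable_evaluation_algebra) (auto simp: loc_counting_def)

lemma loc_countingI:
  assumes B: "partition B" and s: "sets \<omega> = sets borel" and fin: "\<And>n. emeasure \<omega> (B n) \<noteq> \<infinity>"
    and nat: "\<And>A. A \<in> sets borel \<Longrightarrow> emeasure \<omega> A \<in> \<nat> \<union> {\<infinity>}"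
  shows "\<omega> \<in> loc_counting B"
proof -
  have sp: "space \<omega> = UNIV" using s by (metis sets_eq_imp_space_eq space_borel)
  have "sigma_finite_measure \<omega>"
    by standard (use B s sp fin in \<open>auto simp: partition_def intro!: exI[of _ "range B"]\<close>)
  then show ?thesis using s fin nat by (auto simp: loc_counting_def counting_measures_def)
qed

text \<open>Finiteness on \<open>B\<close> is needed for complements: it allows the subtraction
  \<open>\<kappa> w (B - C) = \<kappa> w B - \<kappa> w (B \<inter> C)\<close> in the Dynkin class argument.\<close>

lemma kernel_nn_integral_partition_piece:
  assumes fin: "\<And>w. w \<in> space \<Omega> \<Longrightarrow> emeasure (\<kappa> w) B \<noteq> \<infinity>"
    and s: "\<And>w. w \<in> space \<Omega> \<Longrightarrow> sets (\<kappa> w) = sets borel"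
    and m: "\<And>A. A \<in> sets borel \<Longrightarrow> (\<lambda>w. emeasure (\<kappa> w) A) \<in> borel_measurable \<Omega>"
    and B: "B \<in> sets borel"
    and F: "F \<in> borel_measurable (borel \<Otimes>\<^sub>M \<Omega>)"
  shows "(\<lambda>w. \<integral>\<^sup>+x. F (x, w) * indicator B x \<partial>\<kappa> w) \<in> borel_measurable \<Omega>"
  using F
proof (induction rule: borel_measurable_induct)
  case (cong f g)
  have "(\<integral>\<^sup>+x. f (x, w) * indicator B x \<partial>\<kappa> w) = (\<integral>\<^sup>+x. g (x, w) * indicator B x \<partial>\<kappa> w)"
    if "w \<in> space \<Omega>" for w
    using that s[OF that] cong(3) by (intro nn_integral_cong) (auto simp: space_pair_measure)
  then show ?case using cong(4) by (simp cong: measurable_cong)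
next
  case (set C)
  define \<phi> where "\<phi> C w = emeasure (\<kappa> w) (B \<inter> {x. (x, w) \<in> C})" for C w
  have sect: "{x. (x, w) \<in> C} \<in> sets borel" if "C \<in> sets (borel \<Otimes>\<^sub>M \<Omega>)" for C w
    using sets_Pair2[OF that, of w] by (simp add: vimage_def)
  have "\<phi> C \<in> borel_measurable \<Omega>" if "C \<in> sets (borel \<Otimes>\<^sub>M \<Omega>)" for C
    using Int_stable_pair_measure_generator pair_measure_closed that
    unfolding sets_pair_measure
  proof (induction rule: sigma_sets_induct_disjoint)
    case (basic C)
    then obtain a b where ab: "C = a \<times> b" "a \<in> sets borel" "b \<in> sets \<Omega>" by auto
    have "\<phi> C w = emeasure (\<kappa> w) (B \<inter> a) * indicator b w" for w
      by (cases "w \<in> b") (auto simp: \<phi>_def ab(1))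
    then show ?case using ab B m[of "B \<inter> a"] by (auto cong: measurable_cong)
  next
    case empty
    then show ?case by (simp add: \<phi>_def)
  next
    case (compl C)
    then have C: "C \<in> sets (borel \<Otimes>\<^sub>M \<Omega>)" by (simp add: sets_pair_measure)
    have "\<phi> (space borel \<times> space \<Omega> - C) w = emeasure (\<kappa> w) B - \<phi> C w" if w: "w \<in> space \<Omega>" for w
    proof -
      have eq: "B \<inter> {x. (x, w) \<in> space borel \<times> space \<Omega> - C} = B - (B \<inter> {x. (x, w) \<in> C})"
        using w by auto
      have "emeasure (\<kappa> w) (B \<inter> {x. (x, w) \<in> C}) \<le> emeasure (\<kappa> w) B"
        using B s[OF w] by (intro emeasure_mono) auto
      then have "emeasure (\<kappa> w) (B \<inter> {x. (x, w) \<in> C}) \<noteq> \<infinity>" using fin[OF w] by (auto simp: top_unique)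
      then show ?thesis unfolding \<phi>_def eq
        using B sect[OF C, of w] s[OF w] by (intro emeasure_Diff) auto
    qed
    then show ?case using compl(2) m[OF B] by (simp cong: measurable_cong)
  next
    case (union A)
    then have A: "A i \<in> sets (borel \<Otimes>\<^sub>M \<Omega>)" for i by (auto simp: sets_pair_measure)
    have "\<phi> (\<Union>i. A i) w = (\<Sum>i. \<phi> (A i) w)" if w: "w \<in> space \<Omega>" for w
    proof -
      have eq: "B \<inter> {x. (x, w) \<in> (\<Union>i. A i)} = (\<Union>i. B \<inter> {x. (x, w) \<in> A i})" by auto
      have "disjoint_family (\<lambda>i. B \<inter> {x. (x, w) \<in> A i})"
        using union(1) unfolding disjoint_family_on_def by blast
      then show ?thesis unfolding \<phi>_def eq
        using B sect[OF A] s[OF w] by (intro suminf_emeasure[symmetric]) auto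
    qed
    then show ?case using union(3) by (simp cong: measurable_cong)
  qed
  then have *: "\<phi> C \<in> borel_measurable \<Omega>" using set by simp
  have "(\<integral>\<^sup>+x. indicator C (x, w) * indicator B x \<partial>\<kappa> w) = \<phi> C w" if w: "w \<in> space \<Omega>" for w
  proof -
    have "(\<integral>\<^sup>+x. indicator C (x, w) * indicator B x \<partial>\<kappa> w)
        = (\<integral>\<^sup>+x. indicator (B \<inter> {x. (x, w) \<in> C}) x \<partial>\<kappa> w)"
      by (intro nn_integral_cong) (auto simp: indicator_def)
    also have "\<dots> = \<phi> C w" unfolding \<phi>_def
      using sect[OF set, of w] B s[OF w] by (intro nn_integral_indicator) auto
    finally show ?thesis .
  qed
  then show ?case using * by (simp cong: measurable_cong)
next
  case (mult u c)
  have "(\<integral>\<^sup>+x. c * u (x, w) * indicator B x \<partial>\<kappa> w) = c * (\<integral>\<^sup>+x. u (x, w) * indicator B x \<partial>\<kappa> w)"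
    if w: "w \<in> space \<Omega>" for w
  proof -
    have "(\<lambda>x. u (x, w)) \<in> borel_measurable (\<kappa> w)"
      using mult(2) w s[OF w] by (simp cong: measurable_cong_sets)
    then show ?thesis using B s[OF w]
      by (subst nn_integral_cmult[symmetric]) (auto simp: mult.assoc)
  qed
  then show ?case using mult(4) by (simp cong: measurable_cong)
next
  case (add u v)
  have "(\<integral>\<^sup>+x. (v (x, w) + u (x, w)) * indicator B x \<partial>\<kappa> w)
      = (\<integral>\<^sup>+x. v (x, w) * indicator B x \<partial>\<kappa> w) + (\<integral>\<^sup>+x. u (x, w) * indicator B x \<partial>\<kappa> w)"
    if w: "w \<in> space \<Omega>" for w
  proof -
    have "(\<lambda>x. u (x, w)) \<in> borel_measurable (\<kappa> w)" "(\<lambda>x. v (x, w)) \<in> borel_measurable (\<kappa> w)"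
      using add.hyps(1,3) w s[OF w] by (auto cong: measurable_cong_sets)
    then show ?thesis using B s[OF w]
      by (subst nn_integral_add[symmetric]) (auto simp: distrib_right)
  qed
  then show ?case using add by (simp cong: measurable_cong)
next
  case (seq U)
  have "(\<integral>\<^sup>+x. (SUP i. U i) (x, w) * indicator B x \<partial>\<kappa> w)
      = (SUP i. \<integral>\<^sup>+x. U i (x, w) * indicator B x \<partial>\<kappa> w)"
    if w: "w \<in> space \<Omega>" for w
  proof -
    have U: "(\<lambda>x. U i (x, w)) \<in> borel_measurable (\<kappa> w)" for i
      using seq(1)[of i] w s[OF w] by (auto cong: measurable_cong_sets)
    have "(\<integral>\<^sup>+x. (SUP i. U i) (x, w) * indicator B x \<partial>\<kappa> w)
        = (\<integral>\<^sup>+x. (SUP i. U i (x, w) * indicator B x) \<partial>\<kappa> w)"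
      by (intro nn_integral_cong) (auto simp: image_comp indicator_def)
    also have "\<dots> = (SUP i. \<integral>\<^sup>+x. U i (x, w) * indicator B x \<partial>\<kappa> w)"
      using U B s[OF w] \<open>incseq U\<close>
      by (intro nn_integral_monotone_convergence_SUP)
         (auto simp: incseq_def le_fun_def intro!: mult_right_mono)
    finally show ?thesis .
  qed
  then show ?case using seq.IH by (simp cong: measurable_cong)
qed

lemma kernel_nn_integral_measurable:
  assumes B: "partition B" and \<kappa>: "\<kappa> \<in> \<Omega> \<rightarrow>\<^sub>M N_loc B"
    and F: "F \<in> borel_measurable (borel \<Otimes>\<^sub>M \<Omega>)"
  shows "(\<lambda>w. \<integral>\<^sup>+x. F (x, w) \<partial>\<kappa> w) \<in> borel_measurable \<Omega>"
proof -
  have \<kappa>': "\<kappa> w \<in> loc_counting B" if "w \<in> space \<Omega>" for w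
    using measurable_space[OF \<kappa> that] by simp
  then have s: "sets (\<kappa> w) = sets borel" if "w \<in> space \<Omega>" for w
    using that counting_measuresD(1) loc_counting_subset by blast
  have "(\<integral>\<^sup>+x. F (x, w) \<partial>\<kappa> w) = (\<Sum>n. \<integral>\<^sup>+x. F (x, w) * indicator (B n) x \<partial>\<kappa> w)"
    if w: "w \<in> space \<Omega>" for w
  proof -
    have "(\<lambda>x. F (x, w)) \<in> borel_measurable (\<kappa> w)"
      using F w s[OF w] by (simp cong: measurable_cong_sets)
    moreover have "F (x, w) = (\<Sum>n. F (x, w) * indicator (B n) x)" for x
    proof -
      have "x \<in> (\<Union>j. B j)" using B by (simp add: partition_def)
      then obtain j where "x \<in> B j" by blast
      then have "(\<Sum>n. indicator (B n) x :: ennreal) = 1"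
        using suminf_cmult_indicator[of B x j "\<lambda>_. 1::ennreal"] B by (auto simp: partition_def)
      then show ?thesis by simp
    qed
    ultimately show ?thesis using B s[OF w]
      by (subst nn_integral_suminf[symmetric]) (auto simp: partition_def)
  qed
  moreover have "(\<lambda>w. \<Sum>n. \<integral>\<^sup>+x. F (x, w) * indicator (B n) x \<partial>\<kappa> w) \<in> borel_measurable \<Omega>"
    using \<kappa>' s measurable_eval_compose[OF \<kappa>] F B
    by (intro borel_measurable_suminf_order kernel_nn_integral_partition_piece)
       (auto simp: loc_counting_def partition_def)
  ultimately show ?thesis by (simp cong: measurable_cong)
qed


section \<open>Adding and removing a point\<close>

definition add_point :: "'a::topological_space measure \<Rightarrow> 'a \<Rightarrow> 'a measure" where
  "add_point \<omega> x = plus_measure \<omega> (return borel x)"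

text \<open>The atom at \<open>x\<close> is cut out and put back with its multiplicity reduced by \<open>1\<close>; by truncation at
  \<open>0\<close> this leaves \<open>\<omega>\<close> unchanged if \<open>x\<close> is not an atom.\<close>

definition remove_point :: "'a::topological_space measure \<Rightarrow> 'a \<Rightarrow> 'a measure" where
  "remove_point \<omega> x = plus_measure (density \<omega> (indicator (- {x})))
     (scale_measure (of_nat (multiplicity_at \<omega> x - 1)) (return borel x))"

lemma
  assumes "sets \<omega> = sets borel"
  shows sets_add_point: "sets (add_point \<omega> x) = sets borel"
    and emeasure_add_point: "A \<in> sets borel \<Longrightarrow> emeasure (add_point \<omega> x) A = emeasure \<omega> A + indicator A x"
  using assms by (auto simp: add_point_def emeasure_plus_measure)

lemma
  fixes \<omega> :: "'a::{second_countable_topology, t2_space} measure"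
  assumes \<omega>: "\<omega> \<in> counting_measures"
  shows sets_remove_point: "sets (remove_point \<omega> x) = sets borel"
    and emeasure_remove_point: "A \<in> sets borel \<Longrightarrow> emeasure (remove_point \<omega> x) A =
      emeasure \<omega> A - (if emeasure \<omega> {x} = 0 then 0 else indicator A x)"
proof -
  note D = counting_measuresD[OF \<omega>]
  show "sets (remove_point \<omega> x) = sets borel" by (simp add: remove_point_def D)
  assume A: "A \<in> sets borel"
  have "emeasure (density \<omega> (indicator (- {x}))) A = emeasure \<omega> (A - {x})"
  proof -
    have "emeasure (density \<omega> (indicator (- {x}))) A = (\<integral>\<^sup>+y. indicator (- {x}) y * indicator A y \<partial>\<omega>)"
      using A D by (intro emeasure_density borel_measurable_indicator) (auto intro: borel_comp)
    also have "\<dots> = (\<integral>\<^sup>+y. indicator (A - {x}) y \<partial>\<omega>)"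
      by (intro nn_integral_cong) (auto simp: indicator_def)
    also have "\<dots> = emeasure \<omega> (A - {x})" using A D by (intro nn_integral_indicator) auto
    finally show ?thesis .
  qed
  then have 1: "emeasure (remove_point \<omega> x) A
      = emeasure \<omega> (A - {x}) + of_nat (multiplicity_at \<omega> x - 1) * indicator A x"
    using A D by (simp add: remove_point_def emeasure_plus_measure)
  have m: "emeasure \<omega> {x} = of_nat (multiplicity_at \<omega> x)"
    by (rule emeasure_singleton_eq_multiplicity[OF \<omega>])
  show "emeasure (remove_point \<omega> x) A = emeasure \<omega> A - (if emeasure \<omega> {x} = 0 then 0 else indicator A x)"
  proof (cases "x \<in> A")
    case False
    then show ?thesis using 1 by simp
  next
    case True
    then have "emeasure \<omega> A = emeasure \<omega> (A - {x}) + emeasure \<omega> {x}"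
      using A D by (subst plus_emeasure) (auto simp: insert_absorb)
    then have A: "emeasure \<omega> A = emeasure \<omega> (A - {x}) + of_nat (multiplicity_at \<omega> x)" using m by simp
    show ?thesis
    proof (cases "multiplicity_at \<omega> x")
      case 0
      then show ?thesis using 1 m A by simp
    next
      case (Suc n)
      then have "emeasure \<omega> A = (emeasure \<omega> (A - {x}) + of_nat n) + 1"
        using A by (simp add: add_ac)
      then show ?thesis using 1 m True Suc by (simp del: of_nat_Suc)
    qed
  qed
qed

lemma Nats_infty_add:
  assumes "a \<in> \<nat> \<union> {\<infinity>}" "b \<in> \<nat> \<union> {\<infinity>}" shows "a + b \<in> \<nat> \<union> {\<infinity> :: ennreal}"
  using assms by auto

lemma ennreal_Nats_diff_le_1:
  assumes "(a::ennreal) \<in> \<nat> \<union> {\<infinity>}" "b = 0 \<or> b = 1" shows "a - b \<in> \<nat> \<union> {\<infinity>}"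
proof (cases "a = \<infinity> \<or> b = 0")
  case False
  then obtain n where "a = of_nat n" "b = 1" using assms by (auto simp: Nats_def)
  then have "a - b = of_nat (n - 1)"
    by (cases n) (auto simp del: of_nat_Suc simp: of_nat_Suc add.commute)
  then show ?thesis by simp
qed (use assms in auto)

context
  fixes B :: "nat \<Rightarrow> 'a::{second_countable_topology, t2_space} set"
  assumes B: "partition B"
begin

lemma add_point_loc:
  assumes "\<omega> \<in> loc_counting B"
  shows "add_point \<omega> x \<in> loc_counting B"
proof -
  have s: "sets \<omega> = sets borel" using assms counting_measuresD(1) loc_counting_subset by blast
  have n: "emeasure \<omega> A \<in> \<nat> \<union> {\<infinity>}" if "A \<in> sets borel" for A
    using assms that by (auto simp: loc_counting_def counting_measures_def)
  show ?thesis
  proof (rule loc_countingI[OF B])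
    fix A :: "'a set" assume A: "A \<in> sets borel"
    have "indicator A x \<in> \<nat> \<union> {\<infinity> :: ennreal}" by (auto simp: indicator_def)
    then show "emeasure (add_point \<omega> x) A \<in> \<nat> \<union> {\<infinity>}"
      unfolding emeasure_add_point[OF s A] using n[OF A] by (intro Nats_infty_add)
  next
    fix n show "emeasure (add_point \<omega> x) (B n) \<noteq> \<infinity>"
      using assms by (auto simp: emeasure_add_point[OF s partition_sets[OF B]] loc_counting_def indicator_def)
  qed (rule sets_add_point[OF s])
qed

lemma remove_point_loc:
  assumes "\<omega> \<in> loc_counting B"
  shows "remove_point \<omega> x \<in> loc_counting B"
proof -
  note \<omega> = loc_counting_subset[OF assms]
  have n: "emeasure \<omega> A \<in> \<nat> \<union> {\<infinity>}" if "A \<in> sets borel" for A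
    using assms that by (auto simp: loc_counting_def counting_measures_def)
  show ?thesis
  proof (rule loc_countingI[OF B])
    fix A :: "'a set" assume A: "A \<in> sets borel"
    show "emeasure (remove_point \<omega> x) A \<in> \<nat> \<union> {\<infinity>}"
      unfolding emeasure_remove_point[OF \<omega> A] using n[OF A]
      by (intro ennreal_Nats_diff_le_1) (auto simp: indicator_def)
  next
    fix n
    have "emeasure (remove_point \<omega> x) (B n) \<le> emeasure \<omega> (B n)"
      unfolding emeasure_remove_point[OF \<omega> partition_sets[OF B]] by (rule diff_le_self_ennreal)
    then show "emeasure (remove_point \<omega> x) (B n) \<noteq> \<infinity>"
      using assms by (auto simp: loc_counting_def top_unique)
  qed (rule sets_remove_point[OF \<omega>])
qed

lemma remove_add_point:
  assumes "\<omega> \<in> loc_counting B"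
  shows "remove_point (add_point \<omega> x) x = \<omega>"
proof -
  note \<omega> = loc_counting_subset[OF assms]
  note D = counting_measuresD[OF \<omega>]
  note ax = loc_counting_subset[OF add_point_loc[OF assms, of x]]
  show ?thesis
  proof (rule measure_eqI)
    fix A assume "A \<in> sets (remove_point (add_point \<omega> x) x)"
    then have A: "A \<in> sets borel" by (simp add: sets_remove_point[OF ax])
    then show "emeasure (remove_point (add_point \<omega> x) x) A = emeasure \<omega> A"
      by (auto simp: emeasure_remove_point[OF ax A] emeasure_add_point[OF D(1)] indicator_def)
  qed (simp add: sets_remove_point[OF ax] D)
qed

lemma measurable_add_point:
  "(\<lambda>(x, \<omega>). add_point \<omega> x) \<in> borel \<Otimes>\<^sub>M N_loc B \<rightarrow>\<^sub>M N_loc B"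
proof (rule measurable_evaluation_algebra)
  fix A :: "'a set" assume A[measurable]: "A \<in> sets borel"
  have "(\<lambda>w. emeasure (snd w) A + indicator A (fst w)) \<in> borel_measurable (borel \<Otimes>\<^sub>M N_loc B)"
    by measurable
  then show "(\<lambda>w. emeasure (case w of (x, \<omega>) \<Rightarrow> add_point \<omega> x) A) \<in> borel_measurable (borel \<Otimes>\<^sub>M N_loc B)"
    by (rule measurable_cong[THEN iffD1, rotated])
       (auto simp: space_pair_measure emeasure_add_point[OF counting_measuresD(1)[OF loc_counting_subset]])
qed (auto simp: space_pair_measure add_point_loc)

text \<open>The mass at a variable point is the integral of the indicator of the diagonal, which is closed.\<close>

lemma measurable_emeasure_singleton:
  "(\<lambda>(x, \<omega>). emeasure \<omega> {x}) \<in> borel_measurable (borel \<Otimes>\<^sub>M N_loc B)"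
proof -
  have [measurable]: "{z. fst z = fst (snd z)} \<inter> space ((borel :: 'a measure) \<Otimes>\<^sub>M (borel :: 'a measure) \<Otimes>\<^sub>M N_loc B)
      \<in> sets ((borel :: 'a measure) \<Otimes>\<^sub>M (borel :: 'a measure) \<Otimes>\<^sub>M N_loc B)" (is "?E \<in> _")
  proof -
    have "{p :: 'a \<times> 'a. fst p = snd p} = {p. \<exists>x. p = (x, x)}" by auto
    then have D: "{p :: 'a \<times> 'a. fst p = snd p} \<in> sets (borel \<Otimes>\<^sub>M borel)"
      unfolding borel_prod using closed_diagonal[where 'a='a] by (simp add: borel_closed)
    have "?E = (\<lambda>z. (fst z, fst (snd z))) -` {p. fst p = snd p} \<inter> space ((borel :: 'a measure) \<Otimes>\<^sub>M (borel :: 'a measure) \<Otimes>\<^sub>M N_loc B)"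
      by auto
    also have "\<dots> \<in> sets ((borel :: 'a measure) \<Otimes>\<^sub>M (borel :: 'a measure) \<Otimes>\<^sub>M N_loc B)"
      by (rule measurable_sets[OF _ D]) measurable
    finally show ?thesis .
  qed
  have "(\<lambda>w. \<integral>\<^sup>+y. indicator ({z. fst z = fst (snd z)} \<inter> space ((borel :: 'a measure) \<Otimes>\<^sub>M (borel :: 'a measure) \<Otimes>\<^sub>M N_loc B)) (y, w) \<partial>snd w)
      \<in> borel_measurable ((borel :: 'a measure) \<Otimes>\<^sub>M N_loc B)"
    by (rule kernel_nn_integral_measurable[OF B]) measurable
  then show ?thesis
  proof (rule measurable_cong[THEN iffD1, rotated])
    fix w assume w: "w \<in> space ((borel :: 'a measure) \<Otimes>\<^sub>M N_loc B)"
    then have \<omega>: "snd w \<in> loc_counting B" by (auto simp: space_pair_measure)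
    note D = counting_measuresD[OF loc_counting_subset[OF \<omega>]]
    have "(\<integral>\<^sup>+y. indicator ({z. fst z = fst (snd z)} \<inter> space ((borel :: 'a measure) \<Otimes>\<^sub>M (borel :: 'a measure) \<Otimes>\<^sub>M N_loc B)) (y, w) \<partial>snd w)
       = (\<integral>\<^sup>+y. indicator {fst w} y \<partial>snd w)"
      using w by (intro nn_integral_cong) (auto simp: indicator_def space_pair_measure)
    also have "\<dots> = emeasure (snd w) {fst w}" using D by (intro nn_integral_indicator) auto
    finally show "(\<integral>\<^sup>+y. indicator ({z. fst z = fst (snd z)} \<inter> space ((borel :: 'a measure) \<Otimes>\<^sub>M (borel :: 'a measure) \<Otimes>\<^sub>M N_loc B)) (y, w) \<partial>snd w)
       = (case w of (x, \<omega>) \<Rightarrow> emeasure \<omega> {x})" by (simp add: case_prod_beta)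
  qed
qed

lemma measurable_remove_point:
  "(\<lambda>(x, \<omega>). remove_point \<omega> x) \<in> borel \<Otimes>\<^sub>M N_loc B \<rightarrow>\<^sub>M N_loc B"
proof (rule measurable_evaluation_algebra)
  fix A :: "'a set" assume A[measurable]: "A \<in> sets borel"
  note measurable_emeasure_singleton[measurable]
  have [measurable]: "(\<lambda>w. emeasure (snd w) {fst w}) \<in> borel_measurable (borel \<Otimes>\<^sub>M N_loc B)"
    using measurable_emeasure_singleton by (simp add: case_prod_beta)
  have "(\<lambda>w. emeasure (snd w) A - (if emeasure (snd w) {fst w} = 0 then 0 else indicator A (fst w)))
      \<in> borel_measurable (borel \<Otimes>\<^sub>M N_loc B)"
    by measurable
  then show "(\<lambda>w. emeasure (case w of (x, \<omega>) \<Rightarrow> remove_point \<omega> x) A) \<in> borel_measurable (borel \<Otimes>\<^sub>M N_loc B)"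
    by (rule measurable_cong[THEN iffD1, rotated])
       (auto simp: space_pair_measure emeasure_remove_point[OF loc_counting_subset])
qed (auto simp: space_pair_measure remove_point_loc)

end

section \<open>Sums over tuples of distinct points\<close>

definition inj_tuples :: "nat \<Rightarrow> 'i set \<Rightarrow> (nat \<Rightarrow> 'i) set" where
  "inj_tuples k I = {t \<in> {..<k} \<rightarrow>\<^sub>E I. inj_on t {..<k}}"

definition tuple_sum :: "nat \<Rightarrow> ('a \<times> nat) set \<Rightarrow> ((nat \<Rightarrow> 'a) \<Rightarrow> ennreal) \<Rightarrow> ennreal" where
  "tuple_sum k I F = (\<integral>\<^sup>+t. F (tuple_points k t) \<partial>count_space (inj_tuples k I))"

lemma distinct_index_tuples_eq: "distinct_index_tuples k \<omega> = inj_tuples k (point_indices \<omega>)"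
  by (simp add: distinct_index_tuples_def inj_tuples_def)

text \<open>An injective tuple is built by choosing its last entry \<open>i\<close> and a tuple that avoids \<open>i\<close>.\<close>

lemma inj_tuples_Suc_bij:
  "bij_betw (\<lambda>(i, t). t(k := i)) (SIGMA i:I. inj_tuples k (I - {i})) (inj_tuples (Suc k) I)"
proof (rule bij_betw_byWitness[where f' = "\<lambda>t. (t k, restrict t {..<k})"])
  show "\<forall>a\<in>SIGMA i:I. inj_tuples k (I - {i}).
      ((case a of (i, t) \<Rightarrow> t(k := i)) k, restrict (case a of (i, t) \<Rightarrow> t(k := i)) {..<k}) = a"
    by (auto simp: inj_tuples_def PiE_def extensional_def fun_eq_iff)
  show "\<forall>t\<in>inj_tuples (Suc k) I. (case (t k, restrict t {..<k}) of (i, t) \<Rightarrow> t(k := i)) = t"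
    by (auto simp: inj_tuples_def PiE_def extensional_def fun_eq_iff)
  show "(\<lambda>(i, t). t(k := i)) ` (SIGMA i:I. inj_tuples k (I - {i})) \<subseteq> inj_tuples (Suc k) I"
    by (fastforce simp: inj_tuples_def PiE_def extensional_def lessThan_Suc inj_on_def Pi_def)
  show "(\<lambda>t. (t k, restrict t {..<k})) ` inj_tuples (Suc k) I \<subseteq> (SIGMA i:I. inj_tuples k (I - {i}))"
    by (fastforce simp: inj_tuples_def lessThan_Suc inj_on_def Pi_def)
qed

lemma nn_integral_count_space_Sigma:
  "(\<integral>\<^sup>+p. f p \<partial>count_space (SIGMA i:I. J i)) = (\<integral>\<^sup>+i. (\<integral>\<^sup>+j. f (i, j) \<partial>count_space (J i)) \<partial>count_space I)"
proof -
  have "(\<integral>\<^sup>+p. f p \<partial>count_space (SIGMA i:I. J i))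
      = (\<integral>\<^sup>+p. f p * indicator (SIGMA i:I. J i) p \<partial>count_space UNIV)"
    by (cases "(SIGMA i:I. J i) = UNIV") (simp_all add: nn_integral_count_space_indicator)
  also have "\<dots> = (\<integral>\<^sup>+i. (\<integral>\<^sup>+j. f (i, j) * indicator (SIGMA i:I. J i) (i, j) \<partial>count_space UNIV) \<partial>count_space UNIV)"
    by (subst nn_integral_fst_count_space[symmetric]) simp
  also have "\<dots> = (\<integral>\<^sup>+i. (\<integral>\<^sup>+j. f (i, j) * indicator (J i) j \<partial>count_space UNIV) * indicator I i \<partial>count_space UNIV)"
    by (intro nn_integral_cong) (auto simp: indicator_def)
  also have "\<dots> = (\<integral>\<^sup>+i. (\<integral>\<^sup>+j. f (i, j) * indicator (J i) j \<partial>count_space UNIV) \<partial>count_space I)"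
    by (cases "I = UNIV") (simp_all add: nn_integral_count_space_indicator)
  also have "\<dots> = (\<integral>\<^sup>+i. (\<integral>\<^sup>+j. f (i, j) \<partial>count_space (J i)) \<partial>count_space I)"
  proof (intro nn_integral_cong)
    fix i
    show "(\<integral>\<^sup>+j. f (i, j) * indicator (J i) j \<partial>count_space UNIV) = (\<integral>\<^sup>+j. f (i, j) \<partial>count_space (J i))"
      by (cases "J i = UNIV") (simp_all add: nn_integral_count_space_indicator)
  qed
  finally show ?thesis .
qed

lemma tuple_points_upd: "tuple_points (Suc k) (t(k := i)) = (tuple_points k t)(k := fst i)"
  by (auto simp: tuple_points_def fun_eq_iff)

lemma tuple_sum_Suc:
  "tuple_sum (Suc k) I F = (\<integral>\<^sup>+i. tuple_sum k (I - {i}) (\<lambda>z. F (z(k := fst i))) \<partial>count_space I)"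
proof -
  have "tuple_sum (Suc k) I F
      = (\<integral>\<^sup>+p. F (tuple_points (Suc k) (case p of (i, t) \<Rightarrow> t(k := i)))
           \<partial>count_space (SIGMA i:I. inj_tuples k (I - {i})))"
    unfolding tuple_sum_def by (rule nn_integral_bij_count_space[OF inj_tuples_Suc_bij, symmetric])
  then show ?thesis
    by (simp add: nn_integral_count_space_Sigma tuple_sum_def tuple_points_upd)
qed

lemma inj_tuples_comp:
  assumes inj: "inj_on b I" and im: "b ` I \<subseteq> J" and t: "t \<in> inj_tuples k I"
  shows "restrict (b \<circ> t) {..<k} \<in> inj_tuples k J"
proof -
  have tI: "t ` {..<k} \<subseteq> I" and ti: "inj_on t {..<k}" using t by (auto simp: inj_tuples_def)
  have "inj_on (b \<circ> t) {..<k}"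
    using ti inj_on_subset[OF inj tI] by (rule comp_inj_on)
  moreover have "(b \<circ> t) i \<in> J" if "i < k" for i
    using tI im that by auto
  ultimately show ?thesis
    unfolding inj_tuples_def by (simp add: restrict_PiE_iff inj_on_restrict_eq)
qed

lemma tuple_sum_reindex:
  assumes b: "bij_betw b I J" and fst_b: "\<And>i. i \<in> I \<Longrightarrow> fst (b i) = fst i"
  shows "tuple_sum k J F = tuple_sum k I F"
proof -
  have "bij_betw (\<lambda>t. restrict (b \<circ> t) {..<k}) (inj_tuples k I) (inj_tuples k J)"
  proof (rule bij_betw_byWitness[where f' = "\<lambda>t. restrict (inv_into I b \<circ> t) {..<k}"])
    have inj: "inj_on b I" and im: "b ` I = J" using b by (auto simp: bij_betw_def)
    show "\<forall>a\<in>inj_tuples k I. restrict (inv_into I b \<circ> restrict (b \<circ> a) {..<k}) {..<k} = a"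
      using inj by (auto simp: inj_tuples_def fun_eq_iff PiE_def Pi_def extensional_def)
    show "\<forall>a\<in>inj_tuples k J. restrict (b \<circ> restrict (inv_into I b \<circ> a) {..<k}) {..<k} = a"
      using im by (auto simp: inj_tuples_def fun_eq_iff PiE_def Pi_def extensional_def f_inv_into_f)
    show "(\<lambda>t. restrict (b \<circ> t) {..<k}) ` inj_tuples k I \<subseteq> inj_tuples k J"
      using inj_tuples_comp[OF inj] im by blast
    have "inj_on (inv_into I b) J" "inv_into I b ` J \<subseteq> I"
      using bij_betw_inv_into[OF b] by (simp_all add: bij_betw_def)
    then show "(\<lambda>t. restrict (inv_into I b \<circ> t) {..<k}) ` inj_tuples k J \<subseteq> inj_tuples k I"
      using inj_tuples_comp by blast
  qed
  from nn_integral_bij_count_space[OF this, of "\<lambda>t. F (tuple_points k t)"]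
  have "tuple_sum k J F = (\<integral>\<^sup>+t. F (tuple_points k (restrict (b \<circ> t) {..<k})) \<partial>count_space (inj_tuples k I))"
    by (simp add: tuple_sum_def)
  also have "\<dots> = tuple_sum k I F"
    unfolding tuple_sum_def
  proof (rule nn_integral_cong)
    fix t assume "t \<in> space (count_space (inj_tuples k I))"
    then have "t x \<in> I" if "x < k" for x using that by (auto simp: inj_tuples_def)
    then have "fst (b (t x)) = fst (t x)" if "x < k" for x using fst_b that by blast
    then have "tuple_points k (restrict (b \<circ> t) {..<k}) = tuple_points k t"
      by (simp add: tuple_points_def fun_eq_iff)
    then show "F (tuple_points k (restrict (b \<circ> t) {..<k})) = F (tuple_points k t)" by simp
  qed
  finally show ?thesis .
qed

text \<open>The integral of \<open>F\<close> against the \<open>k\<close>-th factorial measure of \<open>\<omega>\<close>.\<close>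

definition fact_sum :: "nat \<Rightarrow> ((nat \<Rightarrow> 'a) \<Rightarrow> ennreal) \<Rightarrow> 'a measure \<Rightarrow> ennreal" where
  "fact_sum k F \<omega> = tuple_sum k (point_indices \<omega>) F"

lemma fact_sum_0: "fact_sum 0 F \<omega> = F (\<lambda>_. undefined)"
proof -
  have "inj_tuples 0 (point_indices \<omega>) = {\<lambda>_. undefined}"
    by (auto simp: inj_tuples_def)
  then show ?thesis
    by (simp add: fact_sum_def tuple_sum_def nn_integral_count_space_finite tuple_points_def restrict_def)
qed

lemma ennreal_of_nat_diff: "(of_nat a :: ennreal) - of_nat b = of_nat (a - b)"
  by (cases "b \<le> a") (simp_all add: ennreal_of_nat_eq_real_of_nat ennreal_minus of_nat_diff ennreal_neg)

context
  fixes B :: "nat \<Rightarrow> 'a::{second_countable_topology, t2_space} set"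
  assumes B: "partition B"
begin

lemma multiplicity_remove_point:
  assumes \<omega>: "\<omega> \<in> loc_counting B"
  shows "multiplicity_at (remove_point \<omega> x) y = (if y = x then multiplicity_at \<omega> x - 1 else multiplicity_at \<omega> y)"
proof -
  note c = loc_counting_subset[OF \<omega>] and c' = loc_counting_subset[OF remove_point_loc[OF B \<omega>, of x]]
  define b :: nat where "b = (if multiplicity_at \<omega> x = 0 \<or> y \<noteq> x then 0 else 1)"
  have b: "(if emeasure \<omega> {x} = 0 then 0 else indicator {y} x) = (of_nat b :: ennreal)"
    unfolding emeasure_singleton_eq_multiplicity(1)[OF c] b_def by (simp add: indicator_def)
  have "(of_nat (multiplicity_at (remove_point \<omega> x) y) :: ennreal) = emeasure (remove_point \<omega> x) {y}"
    by (rule emeasure_singleton_eq_multiplicity(1)[OF c', symmetric])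
  also have "\<dots> = of_nat (multiplicity_at \<omega> y) - of_nat b"
    unfolding emeasure_remove_point[OF c borel_singleton[OF sets.empty_sets]] b
    unfolding emeasure_singleton_eq_multiplicity(1)[OF c] ..
  also have "\<dots> = of_nat (multiplicity_at \<omega> y - b)" by (rule ennreal_of_nat_diff)
  finally have "multiplicity_at (remove_point \<omega> x) y = multiplicity_at \<omega> y - b"
    unfolding of_nat_eq_iff .
  then show ?thesis by (simp add: b_def)
qed

text \<open>Deleting the index \<open>(x, j)\<close> and closing the gap in the labels over \<open>x\<close> turns the index set of
  \<open>\<omega>\<close> into that of \<open>\<omega> - \<delta>\<^sub>x\<close>.\<close>

lemma tuple_sum_remove_point:
  assumes \<omega>: "\<omega> \<in> loc_counting B" and i: "i \<in> point_indices \<omega>"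
  shows "tuple_sum k (point_indices \<omega> - {i}) F = tuple_sum k (point_indices (remove_point \<omega> (fst i))) F"
proof -
  obtain x j where ij: "i = (x, j)" by (cases i)
  define b where "b p = (if fst p = x \<and> snd p > j then (x, snd p - 1) else p)" for p :: "'a \<times> nat"
  define c where "c p = (if fst p = x \<and> snd p \<ge> j then (x, snd p + 1) else p)" for p :: "'a \<times> nat"
  define m where "m = multiplicity_at \<omega>"
  have P: "point_indices \<omega> - {i} = {p. snd p < m (fst p) \<and> p \<noteq> (x, j)}"
    by (auto simp: point_indices_eq[OF loc_counting_subset[OF \<omega>]] ij m_def)
  have P': "point_indices (remove_point \<omega> x) = {p. snd p < (if fst p = x then m x - 1 else m (fst p))}"
    by (auto simp: point_indices_eq[OF loc_counting_subset[OF remove_point_loc[OF B \<omega>]]]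
        multiplicity_remove_point[OF \<omega>] m_def)
  have j: "j < m x" using i by (simp add: point_indices_eq[OF loc_counting_subset[OF \<omega>]] ij m_def)
  have "bij_betw b (point_indices \<omega> - {i}) (point_indices (remove_point \<omega> x))"
    unfolding P P'
  proof (rule bij_betw_byWitness[where f' = c])
    show "\<forall>p\<in>{p. snd p < m (fst p) \<and> p \<noteq> (x, j)}. c (b p) = p"
      by (auto simp: b_def c_def)
    show "\<forall>p\<in>{p. snd p < (if fst p = x then m x - 1 else m (fst p))}. b (c p) = p"
      by (auto simp: b_def c_def)
    show "b ` {p. snd p < m (fst p) \<and> p \<noteq> (x, j)}
        \<subseteq> {p. snd p < (if fst p = x then m x - 1 else m (fst p))}"
      using j by (auto simp: b_def)
    show "c ` {p. snd p < (if fst p = x then m x - 1 else m (fst p))}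
        \<subseteq> {p. snd p < m (fst p) \<and> p \<noteq> (x, j)}"
      using j by (auto simp: c_def)
  qed
  then have "tuple_sum k (point_indices (remove_point \<omega> x)) F = tuple_sum k (point_indices \<omega> - {i}) F"
    by (rule tuple_sum_reindex) (auto simp: b_def)
  then show ?thesis by (simp add: ij)
qed

text \<open>The recursion that carries all inductions on \<open>k\<close>: the last point is integrated against \<open>\<omega>\<close>, the
  other points come from \<open>\<omega>\<close> with that point removed.\<close>

lemma fact_sum_Suc:
  assumes \<omega>: "\<omega> \<in> loc_counting B"
    and meas: "(\<lambda>x. fact_sum k (\<lambda>z. F (z(k := x))) (remove_point \<omega> x)) \<in> borel_measurable borel"
  shows "fact_sum (Suc k) F \<omega> = (\<integral>\<^sup>+x. fact_sum k (\<lambda>z. F (z(k := x))) (remove_point \<omega> x) \<partial>\<omega>)"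
proof -
  have "fact_sum (Suc k) F \<omega> = (\<integral>\<^sup>+i. fact_sum k (\<lambda>z. F (z(k := fst i))) (remove_point \<omega> (fst i))
      \<partial>count_space (point_indices \<omega>))"
    unfolding fact_sum_def tuple_sum_Suc
  proof (rule nn_integral_cong)
    fix i assume "i \<in> space (count_space (point_indices \<omega>))"
    then have i: "i \<in> point_indices \<omega>" by simp
    show "tuple_sum k (point_indices \<omega> - {i}) (\<lambda>z. F (z(k := fst i)))
        = tuple_sum k (point_indices (remove_point \<omega> (fst i))) (\<lambda>z. F (z(k := fst i)))"
      by (rule tuple_sum_remove_point[OF \<omega> i])
  qed
  also have "\<dots> = (\<integral>\<^sup>+x. fact_sum k (\<lambda>z. F (z(k := x))) (remove_point \<omega> x) \<partial>\<omega>)"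
    by (rule nn_integral_point_indices[OF loc_counting_subset[OF \<omega>] meas, symmetric])
  finally show ?thesis .
qed

text \<open>The induction on \<open>k\<close> turns one point of the tuple into a further parameter. So that the parameter
  space does not grow, it carries an infinite sequence, onto which that point is pushed.\<close>

lemma measurable_fact_sum_aux:
  fixes W :: "'w measure"
  assumes "\<kappa> \<in> Pi\<^sub>M UNIV (\<lambda>_. borel) \<Otimes>\<^sub>M W \<rightarrow>\<^sub>M N_loc B"
    and "F \<in> borel_measurable (Pi\<^sub>M {..<k} (\<lambda>_. borel) \<Otimes>\<^sub>M (Pi\<^sub>M UNIV (\<lambda>_. borel) \<Otimes>\<^sub>M W))"
  shows "(\<lambda>w. fact_sum k (\<lambda>z. F (z, w)) (\<kappa> w)) \<in> borel_measurable (Pi\<^sub>M UNIV (\<lambda>_::nat. borel :: 'a measure) \<Otimes>\<^sub>M W)"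
  using assms
proof (induction k arbitrary: \<kappa> F)
  case 0
  have "(\<lambda>w. (\<lambda>_. undefined, w)) \<in> Pi\<^sub>M UNIV (\<lambda>_::nat. borel :: 'a measure) \<Otimes>\<^sub>M W
      \<rightarrow>\<^sub>M Pi\<^sub>M {..<0} (\<lambda>_::nat. borel :: 'a measure) \<Otimes>\<^sub>M (Pi\<^sub>M UNIV (\<lambda>_. borel) \<Otimes>\<^sub>M W)"
    by (rule measurable_Pair1') (simp add: space_PiM)
  from measurable_compose[OF this 0(2)] show ?case by (simp only: fact_sum_0)
next
  case (Suc k)
  let ?\<Omega> = "Pi\<^sub>M UNIV (\<lambda>_::nat. borel :: 'a measure) \<Otimes>\<^sub>M W"
  have fst_n: "(\<lambda>w. fst w n) \<in> ?\<Omega> \<rightarrow>\<^sub>M borel" for n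
    by (rule measurable_compose[OF measurable_fst measurable_component_singleton]) simp
  define sh where "sh w = ((\<lambda>n. fst w (Suc n)), snd w)" for w :: "(nat \<Rightarrow> 'a) \<times> 'w"
  have "(\<lambda>w n. fst w (Suc n)) \<in> ?\<Omega> \<rightarrow>\<^sub>M Pi\<^sub>M UNIV (\<lambda>_. borel)" using fst_n by (rule measurable_abs_UNIV)
  then have sh: "sh \<in> ?\<Omega> \<rightarrow>\<^sub>M ?\<Omega>" unfolding sh_def[abs_def] by (rule measurable_Pair[OF _ measurable_snd])
  define \<kappa>' where "\<kappa>' w = remove_point (\<kappa> (sh w)) (fst w 0)" for w
  define F' where "F' p = F ((fst p)(k := fst (snd p) 0), sh (snd p))" for p
  from measurable_compose[OF measurable_Pair[OF fst_n[of 0] measurable_compose[OF sh Suc.prems(1)]]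
      measurable_remove_point[OF B]]
  have \<kappa>': "\<kappa>' \<in> ?\<Omega> \<rightarrow>\<^sub>M N_loc B" by (simp only: \<kappa>'_def[abs_def] prod.case)
  have add: "(\<lambda>p. (fst p)(k := snd p)) \<in> Pi\<^sub>M {..<k} (\<lambda>_. borel :: 'a measure) \<Otimes>\<^sub>M borel \<rightarrow>\<^sub>M Pi\<^sub>M {..<Suc k} (\<lambda>_. borel)"
    using measurable_add_dim[of k "{..<k}" "\<lambda>_. borel :: 'a measure"] by (simp only: case_prod_beta' lessThan_Suc)
  from measurable_compose[OF measurable_Pair[OF measurable_fst measurable_compose[OF measurable_snd fst_n[of 0]]] add]
  have upd: "(\<lambda>p. (fst p)(k := fst (snd p) 0)) \<in> Pi\<^sub>M {..<k} (\<lambda>_. borel :: 'a measure) \<Otimes>\<^sub>M ?\<Omega> \<rightarrow>\<^sub>M Pi\<^sub>M {..<Suc k} (\<lambda>_. borel)"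
    by (simp only: fst_conv snd_conv)
  have F': "F' \<in> borel_measurable (Pi\<^sub>M {..<k} (\<lambda>_. borel) \<Otimes>\<^sub>M ?\<Omega>)"
    unfolding F'_def[abs_def]
    by (rule measurable_compose[OF measurable_Pair[OF upd measurable_compose[OF measurable_snd sh]] Suc.prems(2)])
  have enc: "(\<lambda>p. (case_nat (fst p) (fst (snd p)), snd (snd p))) \<in> borel \<Otimes>\<^sub>M ?\<Omega> \<rightarrow>\<^sub>M ?\<Omega>"
    by (intro measurable_Pair measurable_case_nat' measurable_fst measurable_compose[OF measurable_snd measurable_fst]
        measurable_compose[OF measurable_snd measurable_snd])
  from measurable_compose[OF this Suc.IH[OF \<kappa>' F']]
  have m: "(\<lambda>p. fact_sum k (\<lambda>z. F (z(k := fst p), snd p)) (remove_point (\<kappa> (snd p)) (fst p)))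
      \<in> borel_measurable (borel \<Otimes>\<^sub>M ?\<Omega>)"
    by (simp only: F'_def \<kappa>'_def sh_def fst_conv snd_conv nat.case prod.collapse)
  have "(\<lambda>w. \<integral>\<^sup>+x. fact_sum k (\<lambda>z. F (z(k := x), w)) (remove_point (\<kappa> w) x) \<partial>\<kappa> w) \<in> borel_measurable ?\<Omega>"
    using kernel_nn_integral_measurable[OF B Suc.prems(1) m] by (simp only: fst_conv snd_conv)
  then show ?case
  proof (rule measurable_cong[THEN iffD2, rotated])
    fix w assume w: "w \<in> space ?\<Omega>"
    show "fact_sum (Suc k) (\<lambda>z. F (z, w)) (\<kappa> w)
      = (\<integral>\<^sup>+x. fact_sum k (\<lambda>z. F (z(k := x), w)) (remove_point (\<kappa> w) x) \<partial>\<kappa> w)"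
    proof (rule fact_sum_Suc)
      show "\<kappa> w \<in> loc_counting B"
        using measurable_space[OF Suc.prems(1) w] by (simp only: space_evaluation_algebra)
      show "(\<lambda>x. fact_sum k (\<lambda>z. F (z(k := x), w)) (remove_point (\<kappa> w) x)) \<in> borel_measurable borel"
        using measurable_compose[OF measurable_Pair2'[OF w] m] by (simp only: fst_conv snd_conv)
    qed
  qed
qed

lemma measurable_fact_sum:
  assumes \<kappa>: "\<kappa> \<in> \<Omega> \<rightarrow>\<^sub>M N_loc B"
    and F: "F \<in> borel_measurable (Pi\<^sub>M {..<k} (\<lambda>_. borel) \<Otimes>\<^sub>M \<Omega>)"
  shows "(\<lambda>w. fact_sum k (\<lambda>z. F (z, w)) (\<kappa> w)) \<in> borel_measurable \<Omega>"
proof -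
  let ?\<Omega> = "Pi\<^sub>M UNIV (\<lambda>_::nat. borel :: 'a measure) \<Otimes>\<^sub>M \<Omega>"
  have "(\<lambda>p. (fst p, snd (snd p))) \<in> Pi\<^sub>M {..<k} (\<lambda>_. borel :: 'a measure) \<Otimes>\<^sub>M ?\<Omega>
      \<rightarrow>\<^sub>M Pi\<^sub>M {..<k} (\<lambda>_. borel) \<Otimes>\<^sub>M \<Omega>"
    by (intro measurable_Pair measurable_fst measurable_compose[OF measurable_snd measurable_snd])
  from measurable_fact_sum_aux[OF measurable_compose[OF measurable_snd \<kappa>] measurable_compose[OF this F]]
  have 1: "(\<lambda>w. fact_sum k (\<lambda>z. F (z, snd w)) (\<kappa> (snd w))) \<in> borel_measurable ?\<Omega>"
    by (simp only: fst_conv snd_conv)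
  have "(\<lambda>w. (\<lambda>_. undefined, w)) \<in> \<Omega> \<rightarrow>\<^sub>M ?\<Omega>"
    by (rule measurable_Pair1') (simp add: space_PiM)
  from measurable_compose[OF this 1] show ?thesis by (simp only: snd_conv)
qed

lemma fact_sum_Suc':
  assumes \<omega>: "\<omega> \<in> loc_counting B"
    and F: "F \<in> borel_measurable (Pi\<^sub>M {..<Suc k} (\<lambda>_. borel))"
  shows "fact_sum (Suc k) F \<omega> = (\<integral>\<^sup>+x. fact_sum k (\<lambda>z. F (z(k := x))) (remove_point \<omega> x) \<partial>\<omega>)"
proof (rule fact_sum_Suc[OF \<omega>])
  have "(\<lambda>x. (x, \<omega>)) \<in> borel \<rightarrow>\<^sub>M borel \<Otimes>\<^sub>M N_loc B"
    by (rule measurable_Pair2') (simp add: \<omega>)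
  from measurable_compose[OF this measurable_remove_point[OF B]]
  have r: "(\<lambda>x. remove_point \<omega> x) \<in> borel \<rightarrow>\<^sub>M N_loc B" by (simp only: prod.case)
  have "(\<lambda>p. (fst p)(k := snd p)) \<in> Pi\<^sub>M {..<k} (\<lambda>_. borel :: 'a measure) \<Otimes>\<^sub>M borel \<rightarrow>\<^sub>M Pi\<^sub>M {..<Suc k} (\<lambda>_. borel)"
    using measurable_add_dim[of k "{..<k}" "\<lambda>_. borel :: 'a measure"] by (simp only: case_prod_beta' lessThan_Suc)
  from measurable_compose[OF this F]
  have "(\<lambda>p. F ((fst p)(k := snd p))) \<in> borel_measurable (Pi\<^sub>M {..<k} (\<lambda>_. borel) \<Otimes>\<^sub>M borel)" .
  from measurable_fact_sum[OF r this]
  show "(\<lambda>x. fact_sum k (\<lambda>z. F (z(k := x))) (remove_point \<omega> x)) \<in> borel_measurable borel"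
    by (simp only: fst_conv snd_conv)
qed

end

section \<open>The Mecke formula\<close>

lemma poisson_weights_sum:
  assumes "0 \<le> (l::real)"
  shows "(\<lambda>n. l ^ n / fact n * exp (- l)) sums 1"
proof -
  have "(\<lambda>n. (l ^ n /\<^sub>R fact n) * exp (- l)) sums (exp l * exp (- l))"
    by (intro sums_mult2 exp_converges)
  then show ?thesis by (simp add: exp_minus divide_inverse mult.commute)
qed

context
  fixes P :: "'p measure" and K :: "'a::{second_countable_topology, t2_space} measure" and \<eta> :: "'p \<Rightarrow> 'a measure"
  assumes pp: "poisson_process P K \<eta>" and sets_K: "sets K = sets borel"
begin

interpretation prob_space P using pp by (simp add: poisson_process_def)

lemma poisson_measurable: "\<eta> \<in> P \<rightarrow>\<^sub>M N_space"
  using pp by (simp add: poisson_process_def)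

lemma poisson_counting: "w \<in> space P \<Longrightarrow> \<eta> w \<in> counting_measures"
  using measurable_space[OF poisson_measurable] by simp

lemma poisson_eval: "A \<in> sets borel \<Longrightarrow> (\<lambda>w. emeasure (\<eta> w) A) \<in> borel_measurable P"
  by (rule measurable_eval_compose[OF poisson_measurable])

lemma poisson_count_event:
  assumes A: "A \<in> sets borel"
  shows "{w \<in> space P. emeasure (\<eta> w) A = of_nat n} \<in> sets P"
  using measurable_sets[OF poisson_eval[OF A], of "{of_nat n}"] by (simp add: vimage_def Int_def conj_commute)

lemma poisson_count_prob:
  assumes A: "A \<in> sets borel" "emeasure K A < \<infinity>"
  shows "emeasure P {w \<in> space P. emeasure (\<eta> w) A = of_nat n}
    = ennreal (measure K A ^ n / fact n * exp (- measure K A))"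
  using pp A by (simp add: poisson_process_def emeasure_eq_measure)

lemma poisson_count_nat:
  assumes A: "A \<in> sets borel" "emeasure K A < \<infinity>"
  shows "AE w in P. \<exists>n. emeasure (\<eta> w) A = of_nat n"
proof -
  define E where "E n = {w \<in> space P. emeasure (\<eta> w) A = of_nat n}" for n :: nat
  have E: "E n \<in> events" for n unfolding E_def by (rule poisson_count_event[OF A(1)])
  have d: "disjoint_family E" by (auto simp: E_def disjoint_family_on_def)
  have "(\<lambda>n. measure P (E n)) sums measure P (\<Union>n. E n)"
    using E d by (intro finite_measure_UNION) auto
  moreover have "(\<lambda>n. measure P (E n)) sums 1"
    unfolding E_def using pp A poisson_weights_sum[of "measure K A"]
    by (simp add: poisson_process_def)
  ultimately have "measure P (\<Union>n. E n) = 1" by (rule sums_unique2)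
  then have "AE w in P. w \<in> (\<Union>n. E n)" using E by (subst AE_in_set_eq_1) auto
  then show ?thesis by (rule AE_mp) (auto simp: E_def)
qed

lemma nn_integral_poisson_count:
  assumes A: "A \<in> sets borel" "emeasure K A < \<infinity>" and \<psi>: "\<psi> \<in> borel_measurable borel"
  shows "(\<integral>\<^sup>+w. \<psi> (emeasure (\<eta> w) A) \<partial>P)
    = (\<Sum>n. \<psi> (of_nat n) * ennreal (measure K A ^ n / fact n * exp (- measure K A)))"
proof -
  define E where "E n = {w \<in> space P. emeasure (\<eta> w) A = of_nat n}" for n :: nat
  have E: "E n \<in> sets P" for n unfolding E_def by (rule poisson_count_event[OF A(1)])
  have "(\<integral>\<^sup>+w. \<psi> (emeasure (\<eta> w) A) \<partial>P) = (\<integral>\<^sup>+w. (\<Sum>n. \<psi> (of_nat n) * indicator (E n) w) \<partial>P)"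
  proof (rule nn_integral_cong_AE, rule AE_mp[OF poisson_count_nat[OF A]], rule AE_I2, rule impI)
    fix w assume w: "w \<in> space P" and "\<exists>n. emeasure (\<eta> w) A = of_nat n"
    then obtain n where n: "emeasure (\<eta> w) A = of_nat n" by auto
    have "(\<Sum>n. \<psi> (of_nat n) * indicator (E n) w) = \<psi> (of_nat n)"
      by (rule suminf_cmult_indicator) (use n w in \<open>auto simp: E_def disjoint_family_on_def\<close>)
    then show "\<psi> (emeasure (\<eta> w) A) = (\<Sum>n. \<psi> (of_nat n) * indicator (E n) w)" using n by simp
  qed
  also have "\<dots> = (\<Sum>n. \<integral>\<^sup>+w. \<psi> (of_nat n) * indicator (E n) w \<partial>P)"
    using E by (intro nn_integral_suminf) auto
  also have "\<dots> = (\<Sum>n. \<psi> (of_nat n) * emeasure P (E n))"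
    using E by (intro suminf_cong nn_integral_cmult_indicator)
  finally show ?thesis unfolding E_def poisson_count_prob[OF A] .
qed

text \<open>The Poisson law is characterised by \<open>\<E>[N \<psi>(N)] = \<lambda> \<E>[\<psi>(N + 1)]\<close>, an index shift in the series.\<close>

lemma poisson_count_shift:
  assumes A: "A \<in> sets borel" "emeasure K A < \<infinity>" and \<psi>: "\<psi> \<in> borel_measurable borel"
  shows "(\<integral>\<^sup>+w. emeasure (\<eta> w) A * \<psi> (emeasure (\<eta> w) A) \<partial>P)
    = emeasure K A * (\<integral>\<^sup>+w. \<psi> (emeasure (\<eta> w) A + 1) \<partial>P)"
proof -
  define l where "l = measure K A"
  have l: "0 \<le> l" "emeasure K A = ennreal l"
    using A by (auto simp: l_def emeasure_eq_ennreal_measure)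
  have \<psi>1: "(\<lambda>x. \<psi> (x + 1)) \<in> borel_measurable borel"
    by (rule measurable_compose[OF _ \<psi>]) measurable
  have \<psi>2: "(\<lambda>x. x * \<psi> x) \<in> borel_measurable borel"
    using \<psi> by (intro borel_measurable_times_ennreal) auto
  have "(\<integral>\<^sup>+w. emeasure (\<eta> w) A * \<psi> (emeasure (\<eta> w) A) \<partial>P)
      = (\<Sum>n. (of_nat n * \<psi> (of_nat n)) * ennreal (l ^ n / fact n * exp (- l)))"
    unfolding l_def by (rule nn_integral_poisson_count[OF A \<psi>2])
  also have "\<dots> = (\<Sum>n. (of_nat (Suc n) * \<psi> (of_nat (Suc n))) * ennreal (l ^ Suc n / fact (Suc n) * exp (- l)))"
    by (subst suminf_offset[of _ 1]) (simp_all only: summableI, simp)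
  also have "\<dots> = (\<Sum>n. ennreal l * (\<psi> (of_nat n + 1) * ennreal (l ^ n / fact n * exp (- l))))"
  proof (intro suminf_cong)
    fix n :: nat
    have r: "real (Suc n) * (l ^ Suc n / fact (Suc n) * exp (- l)) = l * (l ^ n / fact n * exp (- l))"
      by (simp add: fact_Suc divide_simps del: of_nat_Suc)
    have "(of_nat (Suc n) * \<psi> (of_nat (Suc n))) * ennreal (l ^ Suc n / fact (Suc n) * exp (- l))
        = \<psi> (of_nat (Suc n)) * (ennreal (real (Suc n)) * ennreal (l ^ Suc n / fact (Suc n) * exp (- l)))"
      by (simp only: ennreal_of_nat_eq_real_of_nat mult_ac)
    also have "\<dots> = \<psi> (of_nat (Suc n)) * ennreal (l * (l ^ n / fact n * exp (- l)))"
      unfolding r[symmetric] using l by (subst ennreal_mult) auto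
    also have "\<dots> = ennreal l * (\<psi> (of_nat n + 1) * ennreal (l ^ n / fact n * exp (- l)))"
      using l by (subst ennreal_mult) (auto simp: mult_ac add.commute)
    finally show "(of_nat (Suc n) * \<psi> (of_nat (Suc n))) * ennreal (l ^ Suc n / fact (Suc n) * exp (- l))
        = ennreal l * (\<psi> (of_nat n + 1) * ennreal (l ^ n / fact n * exp (- l)))" .
  qed
  also have "\<dots> = ennreal l * (\<Sum>n. \<psi> (of_nat n + 1) * ennreal (l ^ n / fact n * exp (- l)))"
    by (rule ennreal_suminf_cmult)
  also have "(\<Sum>n. \<psi> (of_nat n + 1) * ennreal (l ^ n / fact n * exp (- l)))
      = (\<integral>\<^sup>+w. \<psi> (emeasure (\<eta> w) A + 1) \<partial>P)"
    unfolding l_def by (rule nn_integral_poisson_count[OF A \<psi>1, symmetric])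
  finally show ?thesis by (simp add: l)
qed

text \<open>Independence of the counts over disjoint sets makes their joint law a product, in which the
  one-dimensional index shift applies to a single coordinate.\<close>

lemma poisson_counts_shift:
  assumes F: "finite F" "F \<subseteq> sets borel" "disjoint F" "\<And>A. A \<in> F \<Longrightarrow> emeasure K A < \<infinity>"
    and E: "E \<in> F" and \<Phi>: "\<Phi> \<in> borel_measurable (Pi\<^sub>M F (\<lambda>_. borel))"
  shows "(\<integral>\<^sup>+w. emeasure (\<eta> w) E * \<Phi> (\<lambda>A\<in>F. emeasure (\<eta> w) A) \<partial>P)
    = emeasure K E * (\<integral>\<^sup>+w. \<Phi> ((\<lambda>A\<in>F. emeasure (\<eta> w) A)(E := emeasure (\<eta> w) E + 1)) \<partial>P)"
proof -
  define X where "X A w = emeasure (\<eta> w) A" for A w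
  have X: "X A \<in> borel_measurable P" if "A \<in> F" for A
    unfolding X_def using F that by (intro poisson_eval) auto
  have ind: "indep_vars (\<lambda>_. borel) X F"
    using pp F unfolding poisson_process_def X_def[abs_def] by blast
  define \<mu> where "\<mu> A = distr P borel (if A \<in> F then X A else (\<lambda>_. 0))" for A
  have \<mu>: "prob_space (\<mu> A)" for A
    unfolding \<mu>_def using X by (intro prob_space_distr) auto
  interpret product_sigma_finite \<mu>
    by (intro product_sigma_finite.intro prob_space_imp_sigma_finite \<mu>)
  have sets_\<mu>: "sets (\<mu> A) = sets borel" for A by (simp add: \<mu>_def)
  have Xv: "(\<lambda>w. \<lambda>A\<in>F. X A w) \<in> P \<rightarrow>\<^sub>M Pi\<^sub>M F (\<lambda>_. borel)"
    using X by (intro measurable_restrict) auto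
  have law: "distr P (Pi\<^sub>M F (\<lambda>_. borel)) (\<lambda>w. \<lambda>A\<in>F. X A w) = Pi\<^sub>M F \<mu>"
  proof -
    have "distr P (Pi\<^sub>M F (\<lambda>_. borel)) (\<lambda>w. \<lambda>A\<in>F. X A w) = Pi\<^sub>M F (\<lambda>A. distr P borel (X A))"
      using ind X E by (subst indep_vars_iff_distr_eq_PiM'[symmetric]) auto
    also have "\<dots> = Pi\<^sub>M F \<mu>" by (intro PiM_cong) (auto simp: \<mu>_def)
    finally show ?thesis .
  qed
  have mP: "measurable (Pi\<^sub>M F (\<lambda>_. borel)) borel = measurable (Pi\<^sub>M F \<mu>) borel"
    by (intro measurable_cong_sets sets_PiM_cong) (auto simp: sets_\<mu>)
  have I: "finite (F - {E})" "E \<notin> F - {E}" "insert E (F - {E}) = F" using F E by auto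
  have upd: "(\<lambda>u. u(E := u E + 1)) \<in> Pi\<^sub>M F (\<lambda>_. borel) \<rightarrow>\<^sub>M Pi\<^sub>M F (\<lambda>_. borel :: ennreal measure)"
  proof (rule measurable_PiM_single')
    fix i assume i: "i \<in> F"
    then have c: "(\<lambda>u. u i) \<in> Pi\<^sub>M F (\<lambda>_. borel) \<rightarrow>\<^sub>M (borel :: ennreal measure)"
      "(\<lambda>u. u E) \<in> Pi\<^sub>M F (\<lambda>_. borel) \<rightarrow>\<^sub>M (borel :: ennreal measure)"
      using E by (auto intro: measurable_component_singleton)
    show "(\<lambda>u. (u(E := u E + 1)) i) \<in> Pi\<^sub>M F (\<lambda>_. borel) \<rightarrow>\<^sub>M (borel :: ennreal measure)"
      using c by (cases "i = E") auto
  qed (use E in \<open>auto simp: space_PiM PiE_def extensional_def\<close>)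
  have \<Phi>1: "(\<lambda>u. u E * \<Phi> u) \<in> borel_measurable (Pi\<^sub>M F (\<lambda>_. borel))"
    using E \<Phi> by (intro borel_measurable_times_ennreal measurable_component_singleton)
  have \<Phi>2: "(\<lambda>u. \<Phi> (u(E := u E + 1))) \<in> borel_measurable (Pi\<^sub>M F (\<lambda>_. borel))"
    by (rule measurable_compose[OF upd \<Phi>])
  have shift: "(\<integral>\<^sup>+x. x * \<psi> x \<partial>\<mu> E) = emeasure K E * (\<integral>\<^sup>+x. \<psi> (x + 1) \<partial>\<mu> E)"
    if \<psi>: "\<psi> \<in> borel_measurable borel" for \<psi>
  proof -
    have m: "(\<lambda>x. x * \<psi> x) \<in> borel_measurable borel" using \<psi> by (intro borel_measurable_times_ennreal) auto
    have m': "(\<lambda>x. \<psi> (x + 1)) \<in> borel_measurable borel" by (rule measurable_compose[OF _ \<psi>]) measurable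
    show ?thesis
      using poisson_count_shift[of E \<psi>] F E X \<psi> m m'
      by (auto simp: \<mu>_def nn_integral_distr X_def)
  qed
  have "(\<integral>\<^sup>+w. X E w * \<Phi> (\<lambda>A\<in>F. X A w) \<partial>P) = (\<integral>\<^sup>+u. u E * \<Phi> u \<partial>Pi\<^sub>M F \<mu>)"
    unfolding law[symmetric] using Xv \<Phi>1 E by (subst nn_integral_distr) auto
  also have "\<dots> = (\<integral>\<^sup>+u. (\<integral>\<^sup>+x. x * \<Phi> (u(E := x)) \<partial>\<mu> E) \<partial>Pi\<^sub>M (F - {E}) \<mu>)"
    using product_nn_integral_insert[OF I(1,2), of "\<lambda>u. u E * \<Phi> u"] \<Phi>1 unfolding I(3) mP by simp
  also have "\<dots> = (\<integral>\<^sup>+u. emeasure K E * (\<integral>\<^sup>+x. \<Phi> (u(E := x + 1)) \<partial>\<mu> E) \<partial>Pi\<^sub>M (F - {E}) \<mu>)"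
  proof (intro nn_integral_cong shift)
    fix u assume u: "u \<in> space (Pi\<^sub>M (F - {E}) \<mu>)"
    have "(\<lambda>x. u(E := x)) \<in> borel \<rightarrow>\<^sub>M Pi\<^sub>M F (\<lambda>_. borel)"
    proof (rule measurable_PiM_single')
      fix i assume "i \<in> F"
      show "(\<lambda>x. (u(E := x)) i) \<in> borel \<rightarrow>\<^sub>M borel" by (cases "i = E") simp_all
    qed (use u E in \<open>auto simp: space_PiM PiE_iff extensional_def\<close>)
    then show "(\<lambda>x. \<Phi> (u(E := x))) \<in> borel_measurable borel" by (rule measurable_compose[OF _ \<Phi>])
  qed
  also have "\<dots> = emeasure K E * (\<integral>\<^sup>+u. (\<integral>\<^sup>+x. \<Phi> (u(E := x + 1)) \<partial>\<mu> E) \<partial>Pi\<^sub>M (F - {E}) \<mu>)"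
  proof (rule nn_integral_cmult)
    have add: "(\<lambda>(f, y). f(E := y)) \<in> Pi\<^sub>M (F - {E}) \<mu> \<Otimes>\<^sub>M \<mu> E \<rightarrow>\<^sub>M Pi\<^sub>M F \<mu>"
      using measurable_add_dim[of E "F - {E}" \<mu>] unfolding I(3) .
    have m: "(\<lambda>u. \<Phi> (u(E := u E + 1))) \<in> borel_measurable (Pi\<^sub>M F \<mu>)" using \<Phi>2 unfolding mP .
    from measurable_compose[OF add m]
    have "(\<lambda>(u, x). \<Phi> (u(E := x + 1))) \<in> borel_measurable (Pi\<^sub>M (F - {E}) \<mu> \<Otimes>\<^sub>M \<mu> E)"
      by (simp add: case_prod_beta')
    then show "(\<lambda>u. \<integral>\<^sup>+x. \<Phi> (u(E := x + 1)) \<partial>\<mu> E) \<in> borel_measurable (Pi\<^sub>M (F - {E}) \<mu>)"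
      using sigma_finite_measure.borel_measurable_nn_integral[OF sigma_finite_measures] by simp
  qed
  finally have 1: "(\<integral>\<^sup>+w. X E w * \<Phi> (\<lambda>A\<in>F. X A w) \<partial>P)
      = emeasure K E * (\<integral>\<^sup>+u. (\<integral>\<^sup>+x. \<Phi> (u(E := x + 1)) \<partial>\<mu> E) \<partial>Pi\<^sub>M (F - {E}) \<mu>)" .
  have 2: "(\<integral>\<^sup>+u. (\<integral>\<^sup>+x. \<Phi> (u(E := x + 1)) \<partial>\<mu> E) \<partial>Pi\<^sub>M (F - {E}) \<mu>) = (\<integral>\<^sup>+u. \<Phi> (u(E := u E + 1)) \<partial>Pi\<^sub>M F \<mu>)"
    using product_nn_integral_insert[OF I(1,2), of "\<lambda>u. \<Phi> (u(E := u E + 1))"] \<Phi>2 unfolding I(3) mP by simp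
  have 3: "(\<integral>\<^sup>+u. \<Phi> (u(E := u E + 1)) \<partial>Pi\<^sub>M F \<mu>) = (\<integral>\<^sup>+w. \<Phi> ((\<lambda>A\<in>F. X A w)(E := X E w + 1)) \<partial>P)"
  proof -
    have "(\<integral>\<^sup>+u. \<Phi> (u(E := u E + 1)) \<partial>Pi\<^sub>M F \<mu>)
        = (\<integral>\<^sup>+w. \<Phi> ((\<lambda>A\<in>F. X A w)(E := (\<lambda>A\<in>F. X A w) E + 1)) \<partial>P)"
      unfolding law[symmetric] by (rule nn_integral_distr[OF Xv]) (simp only: measurable_distr_eq1 \<Phi>2)
    then show ?thesis using E by (simp only: restrict_apply' if_True)
  qed
  show ?thesis using 1 unfolding 2 3 unfolding X_def .
qed

end

text \<open>The members of \<open>F\<close> are the nonempty cells of the partition generated by \<open>\<A>\<close>, apart from the cell outside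
  \<open>\<Union>\<A>\<close>.\<close>

lemma finite_refinement:
  assumes "finite (\<A> :: 'a::topological_space set set)" "\<A> \<subseteq> sets borel"
  shows "\<exists>F. finite F \<and> F \<subseteq> sets borel \<and> disjoint F \<and> (\<forall>E\<in>F. \<exists>A\<in>\<A>. E \<subseteq> A)
    \<and> (\<forall>A\<in>\<A>. A = \<Union>{E\<in>F. E \<subseteq> A})"
proof -
  define s where "s x = {A\<in>\<A>. x \<in> A}" for x
  define cell where "cell T = {y. s y = T}" for T
  define F where "F = cell ` (s ` \<Union>\<A>)"
  have in_cell: "x \<in> cell T \<longleftrightarrow> s x = T" for x T by (simp add: cell_def)
  have sub: "cell (s x) \<subseteq> A" if "A \<in> \<A>" "x \<in> A" for x A
  proof
    fix y assume "y \<in> cell (s x)"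
    then have "A \<in> s y" using that unfolding in_cell by (simp add: s_def)
    then show "y \<in> A" by (simp add: s_def)
  qed
  have "s ` \<Union>\<A> \<subseteq> Pow \<A>" by (auto simp: s_def)
  then have "finite (s ` \<Union>\<A>)" using assms(1) finite_subset by blast
  then have 1: "finite F" unfolding F_def by (rule finite_imageI)
  have cell_sets: "cell T \<in> sets borel" if T: "T \<subseteq> \<A>" "T \<noteq> {}" for T
  proof -
    have "x \<in> cell T \<longleftrightarrow> x \<in> (\<Inter>T) - \<Union>(\<A> - T)" for x
      using T(1) unfolding in_cell s_def by blast
    then have "cell T = (\<Inter>T) - \<Union>(\<A> - T)" by blast
    moreover have "(\<Inter>A\<in>T. A) \<in> sets borel"
      using T(2) finite_subset[OF T(1) assms(1)] subset_trans[OF T(1) assms(2)]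
      by (intro sets.finite_INT) auto
    then have "\<Inter>T \<in> sets borel" by simp
    moreover have "\<Union>(\<A> - T) \<in> sets borel" using assms by (intro sets.finite_Union) auto
    ultimately show ?thesis using \<open>\<Inter>T \<in> sets borel\<close> by simp
  qed
  have 2: "F \<subseteq> sets borel"
  proof
    fix E assume "E \<in> F"
    then obtain x A where x: "E = cell (s x)" "x \<in> A" "A \<in> \<A>" unfolding F_def by blast
    then have "A \<in> s x" "s x \<subseteq> \<A>" by (auto simp: s_def)
    then show "E \<in> sets borel" unfolding x(1) by (intro cell_sets) auto
  qed
  have 3: "disjoint F"
  proof (rule disjointI)
    fix E E' assume "E \<in> F" "E' \<in> F" "E \<noteq> E'"
    moreover from this obtain T where T: "E = cell T" unfolding F_def by blast
    moreover from calculation obtain T' where T': "E' = cell T'" unfolding F_def by blast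
    ultimately have "T \<noteq> T'" by auto
    then show "E \<inter> E' = {}" unfolding T T' by (auto simp: cell_def)
  qed
  have 5: "\<exists>A\<in>\<A>. E \<subseteq> A" if E: "E \<in> F" for E
  proof -
    obtain x A where "E = cell (s x)" "x \<in> A" "A \<in> \<A>" using E unfolding F_def by blast
    then show ?thesis using sub[of A x] by auto
  qed
  have 6: "A = \<Union>{E\<in>F. E \<subseteq> A}" if A: "A \<in> \<A>" for A
  proof
    show "A \<subseteq> \<Union>{E\<in>F. E \<subseteq> A}"
    proof
      fix x assume x: "x \<in> A"
      have "cell (s x) \<in> F" unfolding F_def using x A by (intro imageI) blast
      moreover have "cell (s x) \<subseteq> A" by (rule sub[OF A x])
      moreover have "x \<in> cell (s x)" by (simp add: in_cell)
      ultimately show "x \<in> \<Union>{E\<in>F. E \<subseteq> A}" by blast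
    qed
    show "\<Union>{E\<in>F. E \<subseteq> A} \<subseteq> A" by blast
  qed
  show ?thesis by (intro exI[of _ F] conjI ballI 1 2 3) (fact 5, fact 6)
qed

definition counts_are :: "('a set \<times> nat) set \<Rightarrow> 'a measure \<Rightarrow> ennreal" where
  "counts_are J \<omega> = (\<Prod>p\<in>J. indicator {of_nat (snd p)} (emeasure \<omega> (fst p)))"

lemma counts_are_eq:
  "finite J \<Longrightarrow> counts_are J \<omega> = (if \<forall>p\<in>J. emeasure \<omega> (fst p) = of_nat (snd p) then 1 else 0)"
  unfolding counts_are_def by (induction rule: finite_induct) auto

text \<open>The Mecke formula for events that prescribe finitely many counts. On the cells of the refinement
  generated by \<open>C\<close> and the sets in \<open>J\<close> all counts are sums of independent ones, and adding a point of a
  cell \<open>E\<close> raises exactly the count of \<open>E\<close>.\<close>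

lemma poisson_mecke_counts:
  fixes K :: "'a::{second_countable_topology, t2_space} measure"
  assumes pp: "poisson_process P K \<eta>" and sets_K: "sets K = sets borel"
    and J: "finite J" "\<And>p. p \<in> J \<Longrightarrow> fst p \<in> sets borel" "\<And>p. p \<in> J \<Longrightarrow> emeasure K (fst p) < \<infinity>"
    and C: "C \<in> sets borel" "emeasure K C < \<infinity>"
  shows "(\<integral>\<^sup>+w. emeasure (\<eta> w) C * counts_are J (\<eta> w) \<partial>P)
    = (\<integral>\<^sup>+x. indicator C x * (\<integral>\<^sup>+w. counts_are J (add_point (\<eta> w) x) \<partial>P) \<partial>K)"
proof -
  have "finite (insert C (fst ` J))" "insert C (fst ` J) \<subseteq> sets borel" using J C by auto
  from finite_refinement[OF this] obtain F where F: "finite F" "F \<subseteq> sets borel" "disjoint F"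
    and sub0: "\<forall>E\<in>F. \<exists>A\<in>insert C (fst ` J). E \<subseteq> A"
    and union0: "\<forall>A\<in>insert C (fst ` J). A = \<Union>{E\<in>F. E \<subseteq> A}"
    by (elim exE conjE)
  note sub = bspec[OF sub0] and union = bspec[OF union0]
  have Kfin: "emeasure K E < \<infinity>" if EF: "E \<in> F" for E
  proof -
    obtain A where A: "A \<in> insert C (fst ` J)" "E \<subseteq> A" using sub[OF EF] by blast
    then have "emeasure K E \<le> emeasure K A" using J(2) C by (intro emeasure_mono) (auto simp: sets_K)
    also have "\<dots> < \<infinity>" using A J(3) C by auto
    finally show ?thesis .
  qed
  have split: "emeasure \<mu> A = (\<Sum>E\<in>{E\<in>F. E \<subseteq> A}. emeasure \<mu> E)"
    if s: "sets \<mu> = sets borel" and A: "A \<in> insert C (fst ` J)" for A and \<mu> :: "'a measure"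
  proof -
    have "(\<Sum>E\<in>{E\<in>F. E \<subseteq> A}. emeasure \<mu> E) = emeasure \<mu> (\<Union>E\<in>{E\<in>F. E \<subseteq> A}. E)"
      using F s by (intro sum_emeasure) (auto simp: disjoint_family_on_def disjoint_def)
    also have "(\<Union>E\<in>{E\<in>F. E \<subseteq> A}. E) = \<Union>{E\<in>F. E \<subseteq> A}" by simp
    also have "\<dots> = A" by (rule union[OF A, symmetric])
    finally show ?thesis by simp
  qed
  define \<Phi> :: "('a set \<Rightarrow> ennreal) \<Rightarrow> ennreal" where
    "\<Phi> u = (\<Prod>p\<in>J. indicator {of_nat (snd p)} (\<Sum>E\<in>{E\<in>F. E \<subseteq> fst p}. u E))" for u
  have \<Phi>: "\<Phi> \<in> borel_measurable (Pi\<^sub>M F (\<lambda>_. borel))"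
    unfolding \<Phi>_def
  proof (rule borel_measurable_prod_ennreal)
    fix p assume "p \<in> J"
    have "(\<lambda>u. \<Sum>E\<in>{E\<in>F. E \<subseteq> fst p}. u E) \<in> Pi\<^sub>M F (\<lambda>_. borel) \<rightarrow>\<^sub>M (borel :: ennreal measure)"
      by (intro borel_measurable_sum measurable_component_singleton) auto
    moreover have "(indicator {of_nat (snd p)} :: ennreal \<Rightarrow> ennreal) \<in> borel_measurable borel"
      by (intro borel_measurable_indicator) simp
    ultimately show "(\<lambda>u. indicator {of_nat (snd p)} (\<Sum>E\<in>{E\<in>F. E \<subseteq> fst p}. u E :: ennreal) :: ennreal)
        \<in> borel_measurable (Pi\<^sub>M F (\<lambda>_. borel))"
      by (rule measurable_compose)
  qed
  define v where "v w = (\<lambda>A\<in>F. emeasure (\<eta> w) A)" for w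
  have s\<eta>: "sets (\<eta> w) = sets borel" if "w \<in> space P" for w
    using counting_measuresD(1)[OF poisson_counting[OF pp sets_K that]] .
  have ca: "counts_are J (\<eta> w) = \<Phi> (v w)" if w: "w \<in> space P" for w
    unfolding counts_are_def \<Phi>_def
  proof (rule prod.cong[OF refl])
    fix p assume "p \<in> J"
    then have "emeasure (\<eta> w) (fst p) = (\<Sum>E\<in>{E\<in>F. E \<subseteq> fst p}. v w E)"
      using split[OF s\<eta>[OF w], of "fst p"] by (simp add: v_def)
    then show "indicator {of_nat (snd p)} (emeasure (\<eta> w) (fst p))
        = (indicator {of_nat (snd p)} (\<Sum>E\<in>{E\<in>F. E \<subseteq> fst p}. v w E) :: ennreal)" by simp
  qed
  have ca1: "counts_are J (add_point (\<eta> w) x) = \<Phi> ((v w)(E := emeasure (\<eta> w) E + 1))"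
    if w: "w \<in> space P" and E: "E \<in> F" and x: "x \<in> E" for w x E
    unfolding counts_are_def \<Phi>_def
  proof (rule prod.cong[OF refl])
    fix p assume p: "p \<in> J"
    have "emeasure (add_point (\<eta> w) x) (fst p) = (\<Sum>E'\<in>{E'\<in>F. E' \<subseteq> fst p}. emeasure (add_point (\<eta> w) x) E')"
      using split[OF sets_add_point[OF s\<eta>[OF w]], of "fst p"] p by simp
    also have "\<dots> = (\<Sum>E'\<in>{E'\<in>F. E' \<subseteq> fst p}. ((v w)(E := emeasure (\<eta> w) E + 1)) E')"
    proof (rule sum.cong[OF refl])
      fix E' assume E': "E' \<in> {E'\<in>F. E' \<subseteq> fst p}"
      have "indicator E' x = (if E' = E then 1 else 0 :: ennreal)"
        using F(3) E E' x by (auto simp: disjoint_def indicator_def)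
      then show "emeasure (add_point (\<eta> w) x) E' = ((v w)(E := emeasure (\<eta> w) E + 1)) E'"
        using E' F(2) emeasure_add_point[OF s\<eta>[OF w], of E' x] by (cases "E' = E") (auto simp: v_def)
    qed
    finally show "indicator {of_nat (snd p)} (emeasure (add_point (\<eta> w) x) (fst p))
        = (indicator {of_nat (snd p)} (\<Sum>E'\<in>{E'\<in>F. E' \<subseteq> fst p}. ((v w)(E := emeasure (\<eta> w) E + 1)) E') :: ennreal)"
      by simp
  qed
  define FC where "FC = {E\<in>F. E \<subseteq> C}"
  have FC: "finite FC" "FC \<subseteq> F" using F by (auto simp: FC_def)
  have v: "v \<in> P \<rightarrow>\<^sub>M Pi\<^sub>M F (\<lambda>_. borel)"
    unfolding v_def using F(2) poisson_eval[OF pp sets_K] by (intro measurable_restrict) auto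
  have "(\<integral>\<^sup>+w. emeasure (\<eta> w) C * counts_are J (\<eta> w) \<partial>P)
      = (\<integral>\<^sup>+w. (\<Sum>E\<in>FC. emeasure (\<eta> w) E * \<Phi> (v w)) \<partial>P)"
    by (intro nn_integral_cong) (simp add: ca split[OF s\<eta>, of _ C] FC_def sum_distrib_right)
  also have "\<dots> = (\<Sum>E\<in>FC. \<integral>\<^sup>+w. emeasure (\<eta> w) E * \<Phi> (v w) \<partial>P)"
    using FC F(2) poisson_eval[OF pp sets_K] measurable_compose[OF v \<Phi>]
    by (intro nn_integral_sum borel_measurable_times_ennreal) auto
  also have "\<dots> = (\<Sum>E\<in>FC. emeasure K E * (\<integral>\<^sup>+w. \<Phi> ((v w)(E := emeasure (\<eta> w) E + 1)) \<partial>P))"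
    unfolding v_def using FC by (intro sum.cong refl poisson_counts_shift[OF pp sets_K F Kfin _ \<Phi>]) auto
  also have "\<dots> = (\<Sum>E\<in>FC. \<integral>\<^sup>+x. (\<integral>\<^sup>+w. \<Phi> ((v w)(E := emeasure (\<eta> w) E + 1)) \<partial>P) * indicator E x \<partial>K)"
    using FC F(2) by (intro sum.cong refl) (subst nn_integral_cmult_indicator, auto simp: sets_K mult.commute)
  also have "\<dots> = (\<integral>\<^sup>+x. (\<Sum>E\<in>FC. (\<integral>\<^sup>+w. \<Phi> ((v w)(E := emeasure (\<eta> w) E + 1)) \<partial>P) * indicator E x) \<partial>K)"
    using FC F(2) by (intro nn_integral_sum[symmetric] borel_measurable_times_ennreal borel_measurable_indicator) (auto simp: sets_K)
  also have "\<dots> = (\<integral>\<^sup>+x. indicator C x * (\<integral>\<^sup>+w. counts_are J (add_point (\<eta> w) x) \<partial>P) \<partial>K)"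
  proof (rule nn_integral_cong)
    fix x
    have uC: "C = \<Union>FC" unfolding FC_def by (rule union) simp
    show "(\<Sum>E\<in>FC. (\<integral>\<^sup>+w. \<Phi> ((v w)(E := emeasure (\<eta> w) E + 1)) \<partial>P) * indicator E x)
        = indicator C x * (\<integral>\<^sup>+w. counts_are J (add_point (\<eta> w) x) \<partial>P)"
    proof (cases "x \<in> C")
      case False
      then have "x \<notin> E" if "E \<in> FC" for E using that by (auto simp: FC_def)
      then show ?thesis using False by simp
    next
      case True
      then obtain E where E: "E \<in> FC" "x \<in> E" using uC by blast
      have "(\<Sum>E'\<in>FC. (\<integral>\<^sup>+w. \<Phi> ((v w)(E' := emeasure (\<eta> w) E' + 1)) \<partial>P) * indicator E' x)
          = (\<Sum>E'\<in>FC. if E' = E then (\<integral>\<^sup>+w. \<Phi> ((v w)(E := emeasure (\<eta> w) E + 1)) \<partial>P) else 0)"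
      proof (rule sum.cong[OF refl])
        fix E' assume "E' \<in> FC"
        then have "indicator E' x = (if E' = E then 1 else 0 :: ennreal)"
          using F(3) E FC by (auto simp: disjoint_def indicator_def)
        then show "(\<integral>\<^sup>+w. \<Phi> ((v w)(E' := emeasure (\<eta> w) E' + 1)) \<partial>P) * indicator E' x
            = (if E' = E then (\<integral>\<^sup>+w. \<Phi> ((v w)(E := emeasure (\<eta> w) E + 1)) \<partial>P) else 0)" by simp
      qed
      also have "\<dots> = (\<integral>\<^sup>+w. \<Phi> ((v w)(E := emeasure (\<eta> w) E + 1)) \<partial>P)"
        using FC(1) E(1) by simp
      also have "\<dots> = (\<integral>\<^sup>+w. counts_are J (add_point (\<eta> w) x) \<partial>P)"
        using E FC by (intro nn_integral_cong ca1[symmetric]) auto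
      finally show ?thesis using True by simp
    qed
  qed
  finally show ?thesis .
qed

text \<open>An iterated integral over a kernel is the integral of a measure; two of them can therefore be
  compared on a generator of the \<open>\<sigma>\<close>-algebra.\<close>

lemma nested_integral_measure:
  fixes N :: "'x measure" and \<mu> :: "'u measure" and \<kappa> :: "'u \<Rightarrow> 'v measure"
  assumes T: "\<And>u v. u \<in> space \<mu> \<Longrightarrow> v \<in> space (\<kappa> u) \<Longrightarrow> T u v \<in> space N"
    and inner: "\<And>(F :: 'x \<Rightarrow> ennreal) u. F \<in> borel_measurable N \<Longrightarrow> u \<in> space \<mu> \<Longrightarrow> (\<lambda>v. F (T u v)) \<in> borel_measurable (\<kappa> u)"
    and outer: "\<And>F :: 'x \<Rightarrow> ennreal. F \<in> borel_measurable N \<Longrightarrow> (\<lambda>u. \<integral>\<^sup>+v. F (T u v) \<partial>\<kappa> u) \<in> borel_measurable \<mu>"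
  shows "\<exists>\<rho>. sets \<rho> = sets N \<and>
    (\<forall>F\<in>borel_measurable N. (\<integral>\<^sup>+x. F x \<partial>\<rho>) = (\<integral>\<^sup>+u. \<integral>\<^sup>+v. F (T u v) \<partial>\<kappa> u \<partial>\<mu>))"
proof -
  define \<Lambda> :: "('x \<Rightarrow> ennreal) \<Rightarrow> ennreal" where "\<Lambda> F = (\<integral>\<^sup>+u. \<integral>\<^sup>+v. F (T u v) \<partial>\<kappa> u \<partial>\<mu>)" for F
  define \<rho> where "\<rho> = measure_of (space N) (sets N) (\<lambda>A. \<Lambda> (indicator A))"
  have sets_\<rho>: "sets \<rho> = sets N" by (simp add: \<rho>_def)
  have \<Lambda>_suminf: "\<Lambda> (\<lambda>x. \<Sum>i. F i x) = (\<Sum>i. \<Lambda> (F i))" if F: "\<And>i. F i \<in> borel_measurable N" for F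
  proof -
    have "\<Lambda> (\<lambda>x. \<Sum>i. F i x) = (\<integral>\<^sup>+u. (\<Sum>i. \<integral>\<^sup>+v. F i (T u v) \<partial>\<kappa> u) \<partial>\<mu>)"
      unfolding \<Lambda>_def by (rule nn_integral_cong, rule nn_integral_suminf, rule inner[OF F])
    also have "\<dots> = (\<Sum>i. \<Lambda> (F i))"
      unfolding \<Lambda>_def by (rule nn_integral_suminf, rule outer[OF F])
    finally show ?thesis .
  qed
  have em: "emeasure \<rho> A = \<Lambda> (indicator A)" if A: "A \<in> sets N" for A
    unfolding \<rho>_def
  proof (rule emeasure_measure_of_sigma)
    show "sigma_algebra (space N) (sets N)" ..
    show "positive (sets N) (\<lambda>A. \<Lambda> (indicator A))" by (simp add: positive_def \<Lambda>_def)
    show "countably_additive (sets N) (\<lambda>A. \<Lambda> (indicator A))"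
    proof (rule countably_additiveI)
      fix A :: "nat \<Rightarrow> 'x set"
      assume A: "range A \<subseteq> sets N" "disjoint_family A"
      have "(\<Sum>i. \<Lambda> (indicator (A i))) = \<Lambda> (\<lambda>x. \<Sum>i. indicator (A i) x)"
        using A by (intro \<Lambda>_suminf[symmetric] borel_measurable_indicator) auto
      also have "(\<lambda>x. \<Sum>i. indicator (A i) x :: ennreal) = indicator (\<Union>i. A i)"
        using suminf_indicator[OF A(2)] by (intro ext) simp
      finally show "(\<Sum>i. \<Lambda> (indicator (A i))) = \<Lambda> (indicator (\<Union>i. A i))" .
    qed
  qed (rule A)
  have m: "borel_measurable \<rho> = borel_measurable N" by (rule measurable_cong_sets[OF sets_\<rho> refl])
  have "(\<integral>\<^sup>+x. F x \<partial>\<rho>) = \<Lambda> F" if "F \<in> borel_measurable N" for F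
    using that
  proof (induction rule: borel_measurable_induct)
    case (cong f g)
    have 1: "(\<integral>\<^sup>+x. f x \<partial>\<rho>) = (\<integral>\<^sup>+x. g x \<partial>\<rho>)"
      using cong(3) by (intro nn_integral_cong) (simp add: sets_eq_imp_space_eq[OF sets_\<rho>])
    have 2: "\<Lambda> f = \<Lambda> g"
      unfolding \<Lambda>_def using cong(3) T by (intro nn_integral_cong) simp
    show ?case using cong(4) unfolding 1 2 .
  next
    case (set A)
    then show ?case using em[OF set] by (simp add: sets_\<rho>)
  next
    case (mult u c)
    have "\<Lambda> (\<lambda>x. c * u x) = (\<integral>\<^sup>+w. c * (\<integral>\<^sup>+v. u (T w v) \<partial>\<kappa> w) \<partial>\<mu>)"
      unfolding \<Lambda>_def by (rule nn_integral_cong, rule nn_integral_cmult, rule inner[OF mult(2)])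
    also have "\<dots> = c * \<Lambda> u"
      unfolding \<Lambda>_def by (rule nn_integral_cmult, rule outer[OF mult(2)])
    finally have "\<Lambda> (\<lambda>x. c * u x) = c * \<Lambda> u" .
    moreover have "(\<integral>\<^sup>+x. c * u x \<partial>\<rho>) = c * (\<integral>\<^sup>+x. u x \<partial>\<rho>)"
      by (rule nn_integral_cmult) (simp only: m mult(2))
    ultimately show ?case by (simp only: mult(4))
  next
    case (add u v)
    have mu: "u \<in> borel_measurable N" "v \<in> borel_measurable N" by fact+
    have "\<Lambda> (\<lambda>x. v x + u x) = (\<integral>\<^sup>+w. (\<integral>\<^sup>+y. v (T w y) \<partial>\<kappa> w) + (\<integral>\<^sup>+y. u (T w y) \<partial>\<kappa> w) \<partial>\<mu>)"
      unfolding \<Lambda>_def by (rule nn_integral_cong, rule nn_integral_add; rule inner[OF mu(1)] inner[OF mu(2)])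
    also have "\<dots> = \<Lambda> v + \<Lambda> u"
      unfolding \<Lambda>_def by (rule nn_integral_add) (rule outer[OF mu(2)], rule outer[OF mu(1)])
    finally have "\<Lambda> (\<lambda>x. v x + u x) = \<Lambda> v + \<Lambda> u" .
    moreover have "(\<integral>\<^sup>+x. v x + u x \<partial>\<rho>) = (\<integral>\<^sup>+x. v x \<partial>\<rho>) + (\<integral>\<^sup>+x. u x \<partial>\<rho>)"
      by (rule nn_integral_add) (simp_all only: m mu)
    ultimately show ?case by (simp only: add.IH)
  next
    case (seq U)
    have mU: "U i \<in> borel_measurable N" for i by fact
    have inc: "U m x \<le> U n x" if "m \<le> n" for m n x
      using \<open>incseq U\<close> that by (simp add: incseq_def le_fun_def)
    have "\<Lambda> (SUP i. U i) = (\<integral>\<^sup>+w. (SUP i. \<integral>\<^sup>+v. U i (T w v) \<partial>\<kappa> w) \<partial>\<mu>)"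
      unfolding \<Lambda>_def
    proof (rule nn_integral_cong)
      fix w assume w: "w \<in> space \<mu>"
      have "(\<integral>\<^sup>+v. (SUP i. U i) (T w v) \<partial>\<kappa> w) = (\<integral>\<^sup>+v. (SUP i. U i (T w v)) \<partial>\<kappa> w)"
        by (intro nn_integral_cong) (simp add: image_comp)
      also have "\<dots> = (SUP i. \<integral>\<^sup>+v. U i (T w v) \<partial>\<kappa> w)"
        by (rule nn_integral_monotone_convergence_SUP) (auto simp: incseq_def le_fun_def inc inner[OF mU w])
      finally show "(\<integral>\<^sup>+v. (SUP i. U i) (T w v) \<partial>\<kappa> w) = (SUP i. \<integral>\<^sup>+v. U i (T w v) \<partial>\<kappa> w)" .
    qed
    also have "\<dots> = (SUP i. \<Lambda> (U i))"
      unfolding \<Lambda>_def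
      by (rule nn_integral_monotone_convergence_SUP)
         (auto simp: incseq_def le_fun_def inc outer[OF mU] intro!: nn_integral_mono)
    finally have "\<Lambda> (SUP i. U i) = (SUP i. \<Lambda> (U i))" .
    moreover have "(\<integral>\<^sup>+x. (SUP i. U i) x \<partial>\<rho>) = (SUP i. \<integral>\<^sup>+x. U i x \<partial>\<rho>)"
    proof -
      have "(\<integral>\<^sup>+x. (SUP i. U i) x \<partial>\<rho>) = (\<integral>\<^sup>+x. (SUP i. U i x) \<partial>\<rho>)"
        by (intro nn_integral_cong) (simp add: image_comp)
      also have "\<dots> = (SUP i. \<integral>\<^sup>+x. U i x \<partial>\<rho>)"
        using mU unfolding m[symmetric]
        by (intro nn_integral_monotone_convergence_SUP) (auto simp: incseq_def le_fun_def inc)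
      finally show ?thesis .
    qed
    ultimately show ?case by (simp only: seq.IH)
  qed
  then show ?thesis using sets_\<rho> unfolding \<Lambda>_def by blast
qed

text \<open>A version of the Poisson process that takes its values in the measures on which integration is
  measurable.\<close>

lemma poisson_loc_version:
  fixes K :: "'a::{second_countable_topology, t2_space} measure"
  assumes pp: "poisson_process P K \<eta>" and sets_K: "sets K = sets borel"
    and B: "partition B" and KB: "\<And>n. emeasure K (B n) < \<infinity>"
  shows "\<exists>\<eta>0 \<in> P \<rightarrow>\<^sub>M N_loc B. AE w in P. \<eta> w = \<eta>0 w"
proof -
  define Q where "Q w \<longleftrightarrow> (\<forall>n. emeasure (\<eta> w) (B n) \<noteq> \<infinity>)" for w
  define \<eta>0 where "\<eta>0 w = (if Q w then \<eta> w else null_measure borel)" for w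
  have Bm: "B n \<in> sets borel" for n by (rule partition_sets[OF B])
  have "AE w in P. emeasure (\<eta> w) (B n) \<noteq> \<infinity>" for n
  proof (rule AE_mp[OF poisson_count_nat[OF pp sets_K Bm[of n] KB[of n]]], rule AE_I2, rule impI)
    fix w assume "\<exists>j. emeasure (\<eta> w) (B n) = of_nat j"
    then show "emeasure (\<eta> w) (B n) \<noteq> \<infinity>" by auto
  qed
  then have "AE w in P. Q w" unfolding Q_def by (simp add: AE_all_countable)
  then have ae: "AE w in P. \<eta> w = \<eta>0 w" by (rule AE_mp) (auto intro!: AE_I2 simp: \<eta>0_def)
  have ev: "(\<lambda>w. emeasure (\<eta> w) A) \<in> borel_measurable P" if "A \<in> sets borel" for A
    by (rule poisson_eval[OF pp sets_K that])
  have Q: "{w \<in> space P. Q w} \<in> sets P"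
    unfolding Q_def
  proof (rule sets.sets_Collect_countable_All)
    fix n
    show "{w \<in> space P. emeasure (\<eta> w) (B n) \<noteq> \<infinity>} \<in> sets P"
      using measurable_sets[OF ev[OF Bm], of "- {\<infinity>}"] by (simp add: vimage_def Int_def conj_commute)
  qed
  have "null_measure borel \<in> loc_counting B"
    by (rule loc_countingI[OF B]) auto
  then have "\<eta>0 \<in> P \<rightarrow>\<^sub>M N_loc B"
  proof (intro measurable_evaluation_algebra)
    fix w assume "w \<in> space P"
    then show "\<eta>0 w \<in> loc_counting B"
      using poisson_counting[OF pp sets_K] \<open>null_measure borel \<in> loc_counting B\<close>
      by (auto simp: \<eta>0_def Q_def loc_counting_def)
  next
    fix A :: "'a set" assume A: "A \<in> sets borel"
    have "(\<lambda>w. if Q w then emeasure (\<eta> w) A else 0) \<in> borel_measurable P"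
      using Q ev[OF A] by (intro measurable_If) auto
    moreover have "emeasure (\<eta>0 w) A = (if Q w then emeasure (\<eta> w) A else 0)" for w
      by (simp add: \<eta>0_def)
    ultimately show "(\<lambda>w. emeasure (\<eta>0 w) A) \<in> borel_measurable P" by simp
  qed
  then show ?thesis using ae by (intro bexI[of _ \<eta>0])
qed

context
  fixes P :: "'p measure" and K :: "'a::{second_countable_topology, t2_space} measure" and \<eta> \<eta>0 :: "'p \<Rightarrow> 'a measure"
    and B :: "nat \<Rightarrow> 'a set"
  assumes pp: "poisson_process P K \<eta>" and sets_K: "sets K = sets borel" and K: "sigma_finite_measure K"
    and B: "partition B" and KB: "\<And>n. emeasure K (B n) < \<infinity>"
    and \<eta>0: "\<eta>0 \<in> P \<rightarrow>\<^sub>M N_loc B" and ae: "AE w in P. \<eta> w = \<eta>0 w"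
begin

text \<open>A generator of the \<open>\<sigma>\<close>-algebra that is closed under intersections and consists of events about counts of
  sets with finite intensity, for which the Poisson law is given.\<close>

definition loc_count_events :: "'a measure set set" where
  "loc_count_events = {{\<omega>\<in>loc_counting B. \<forall>p\<in>J. emeasure \<omega> (fst p) = of_nat (snd p)} | J.
     finite J \<and> (\<forall>p\<in>J. fst p \<in> sets borel \<and> emeasure K (fst p) < \<infinity>)}"

lemma Int_stable_loc_count_events: "Int_stable loc_count_events"
proof (rule Int_stableI)
  fix a b assume "a \<in> loc_count_events" "b \<in> loc_count_events"
  then obtain J J' where J: "a = {\<omega>\<in>loc_counting B. \<forall>p\<in>J. emeasure \<omega> (fst p) = of_nat (snd p)}"
      "finite J" "\<forall>p\<in>J. fst p \<in> sets borel \<and> emeasure K (fst p) < \<infinity>"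
    and J': "b = {\<omega>\<in>loc_counting B. \<forall>p\<in>J'. emeasure \<omega> (fst p) = of_nat (snd p)}"
      "finite J'" "\<forall>p\<in>J'. fst p \<in> sets borel \<and> emeasure K (fst p) < \<infinity>"
    unfolding loc_count_events_def by blast
  have "a \<inter> b = {\<omega>\<in>loc_counting B. \<forall>p\<in>J \<union> J'. emeasure \<omega> (fst p) = of_nat (snd p)}"
    unfolding J(1) J'(1) by blast
  then show "a \<inter> b \<in> loc_count_events"
    unfolding loc_count_events_def using J J' by (intro CollectI exI[of _ "J \<union> J'"]) auto
qed

lemma loc_count_event_single:
  assumes "A \<in> sets borel" "emeasure K A < \<infinity>"
  shows "{\<omega>\<in>loc_counting B. emeasure \<omega> A = of_nat n} \<in> loc_count_events"
  unfolding loc_count_events_def using assms by (intro CollectI exI[of _ "{(A, n)}"]) auto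

text \<open>The count of an arbitrary Borel set is the sum of its counts in the pieces of the partition; these
  are natural numbers and have finite mean.\<close>

lemma sets_N_loc_eq: "sets (N_loc B) = sigma_sets (loc_counting B) loc_count_events"
proof
  have sub: "loc_count_events \<subseteq> Pow (loc_counting B)" by (auto simp: loc_count_events_def)
  define M where "M = sigma (loc_counting B) loc_count_events"
  have space_M: "space M = loc_counting B" and sets_M: "sets M = sigma_sets (loc_counting B) loc_count_events"
    using sub by (simp_all add: M_def)
  have piece: "(\<lambda>\<omega>. emeasure \<omega> (A \<inter> B n)) \<in> borel_measurable M" if A: "A \<in> sets borel" for A n
  proof (rule measurableI)
    have AB: "A \<inter> B n \<in> sets borel" using A partition_sets[OF B] by auto
    have "emeasure K (A \<inter> B n) \<le> emeasure K (B n)"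
      using partition_sets[OF B] by (intro emeasure_mono) (auto simp: sets_K)
    then have fin: "emeasure K (A \<inter> B n) < \<infinity>" using KB[of n] by (rule le_less_trans)
    fix C :: "ennreal set" assume "C \<in> sets borel"
    have "\<exists>j. emeasure \<omega> (A \<inter> B n) = of_nat j" if "\<omega> \<in> loc_counting B" for \<omega>
    proof -
      note \<omega> = loc_counting_subset[OF that]
      have "emeasure \<omega> (A \<inter> B n) \<le> emeasure \<omega> (B n)"
        using partition_sets[OF B] by (intro emeasure_mono) (auto simp: counting_measuresD(1)[OF \<omega>])
      then have "emeasure \<omega> (A \<inter> B n) \<noteq> \<infinity>" using that by (auto simp: loc_counting_def top_unique)
      then show ?thesis using counting_measuresD(4)[OF \<omega> AB] by blast
    qed
    then have "(\<lambda>\<omega>. emeasure \<omega> (A \<inter> B n)) -` C \<inter> space M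
        = (\<Union>j\<in>{j. of_nat j \<in> C}. {\<omega>\<in>loc_counting B. emeasure \<omega> (A \<inter> B n) = of_nat j})"
      unfolding space_M by fastforce
    also have "\<dots> \<in> sets M"
      unfolding sets_M using loc_count_event_single[OF AB fin]
      by (intro sigma_sets_UNION) (auto intro: sigma_sets.Basic)
    finally show "(\<lambda>\<omega>. emeasure \<omega> (A \<inter> B n)) -` C \<inter> space M \<in> sets M" .
  qed simp
  have "(\<lambda>\<omega>. \<omega>) \<in> M \<rightarrow>\<^sub>M N_loc B"
  proof (rule measurable_evaluation_algebra)
    fix A :: "'a set" assume A: "A \<in> sets borel"
    have "emeasure \<omega> A = (\<Sum>n. emeasure \<omega> (A \<inter> B n))" if "\<omega> \<in> space M" for \<omega>
    proof -
      have s: "sets \<omega> = sets borel"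
        using that counting_measuresD(1) loc_counting_subset unfolding space_M by blast
      have "(\<Sum>n. emeasure \<omega> (A \<inter> B n)) = emeasure \<omega> (\<Union>n. A \<inter> B n)"
        using A B by (intro suminf_emeasure) (auto simp: s partition_def disjoint_family_on_def)
      also have "(\<Union>n. A \<inter> B n) = A" using B by (auto simp: partition_def)
      finally show ?thesis by simp
    qed
    moreover have "(\<lambda>\<omega>. \<Sum>n. emeasure \<omega> (A \<inter> B n)) \<in> borel_measurable M"
      by (rule borel_measurable_suminf_order) (rule piece[OF A])
    ultimately show "(\<lambda>\<omega>. emeasure \<omega> A) \<in> borel_measurable M" by (subst measurable_cong)
  qed (simp add: space_M)
  show "sets (N_loc B) \<subseteq> sigma_sets (loc_counting B) loc_count_events"
  proof
    fix S assume S: "S \<in> sets (N_loc B)"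
    then have "S \<subseteq> loc_counting B" using sets.sets_into_space by fastforce
    then have "(\<lambda>\<omega>. \<omega>) -` S \<inter> space M = S" unfolding space_M by auto
    then show "S \<in> sigma_sets (loc_counting B) loc_count_events"
      using measurable_sets[OF \<open>(\<lambda>\<omega>. \<omega>) \<in> M \<rightarrow>\<^sub>M N_loc B\<close> S] unfolding sets_M by simp
  qed
  show "sigma_sets (loc_counting B) loc_count_events \<subseteq> sets (N_loc B)"
  proof -
    have "loc_count_events \<subseteq> sets (N_loc B)"
    proof
      fix S assume "S \<in> loc_count_events"
      then obtain J where J: "S = {\<omega>\<in>loc_counting B. \<forall>p\<in>J. emeasure \<omega> (fst p) = of_nat (snd p)}"
        "finite J" "\<forall>p\<in>J. fst p \<in> sets borel \<and> emeasure K (fst p) < \<infinity>"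
        unfolding loc_count_events_def by blast
      have "{\<omega>\<in>space (N_loc B). \<forall>p\<in>J. emeasure \<omega> (fst p) = of_nat (snd p)} \<in> sets (N_loc B)"
      proof (rule sets.sets_Collect_finite_All[OF _ J(2)])
        fix p assume "p \<in> J"
        then have "(\<lambda>\<omega>. emeasure \<omega> (fst p)) \<in> borel_measurable (N_loc B)"
          using J(3) by (intro measurable_emeasure_evaluation) auto
        from measurable_sets[OF this, of "{of_nat (snd p)}"]
        show "{\<omega>\<in>space (N_loc B). emeasure \<omega> (fst p) = of_nat (snd p)} \<in> sets (N_loc B)"
          by (simp add: vimage_def Int_def conj_commute)
      qed
      then show "S \<in> sets (N_loc B)" by (simp add: J(1))
    qed
    then have "sigma_sets (space (N_loc B)) loc_count_events \<subseteq> sets (N_loc B)"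
      by (rule sets.sigma_sets_subset)
    then show ?thesis by simp
  qed
qed

lemma \<eta>0_loc: "w \<in> space P \<Longrightarrow> \<eta>0 w \<in> loc_counting B"
  using measurable_space[OF \<eta>0] by simp

text \<open>The two sides of the Mecke formula as measures on pairs (point, configuration).\<close>

lemma poisson_kernel_measure:
  "\<exists>\<rho>. sets \<rho> = sets (borel \<Otimes>\<^sub>M N_loc B) \<and> (\<forall>F\<in>borel_measurable (borel \<Otimes>\<^sub>M N_loc B).
     (\<integral>\<^sup>+z. F z \<partial>\<rho>) = (\<integral>\<^sup>+w. \<integral>\<^sup>+x. F (x, \<eta>0 w) \<partial>\<eta>0 w \<partial>P))"
proof (rule nested_integral_measure)
  show "(x, \<eta>0 w) \<in> space (borel \<Otimes>\<^sub>M N_loc B)" if "w \<in> space P" for w x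
    using \<eta>0_loc[OF that] by (simp add: space_pair_measure)
  fix F :: "'a \<times> 'a measure \<Rightarrow> ennreal" assume F: "F \<in> borel_measurable (borel \<Otimes>\<^sub>M N_loc B)"
  show "(\<lambda>x. F (x, \<eta>0 w)) \<in> borel_measurable (\<eta>0 w)" if w: "w \<in> space P" for w
  proof -
    have s: "sets (\<eta>0 w) = sets borel"
      by (rule counting_measuresD(1)[OF loc_counting_subset[OF \<eta>0_loc[OF w]]])
    have "(\<lambda>x. F (x, \<eta>0 w)) \<in> borel_measurable borel"
      using \<eta>0_loc[OF w] by (intro measurable_compose[OF measurable_Pair2' F]) simp
    then show ?thesis by (simp only: measurable_cong_sets[OF s refl])
  qed
  show "(\<lambda>w. \<integral>\<^sup>+x. F (x, \<eta>0 w) \<partial>\<eta>0 w) \<in> borel_measurable P"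
  proof -
    have "(\<lambda>z. (fst z, \<eta>0 (snd z))) \<in> borel \<Otimes>\<^sub>M P \<rightarrow>\<^sub>M borel \<Otimes>\<^sub>M N_loc B"
      by (intro measurable_Pair measurable_fst measurable_compose[OF measurable_snd \<eta>0])
    from kernel_nn_integral_measurable[OF B \<eta>0 measurable_compose[OF this F]]
    show ?thesis by (simp only: fst_conv snd_conv)
  qed
qed

lemma measurable_\<eta>0_add_point:
  "(\<lambda>z. (fst z, add_point (\<eta>0 (snd z)) (fst z))) \<in> K \<Otimes>\<^sub>M P \<rightarrow>\<^sub>M borel \<Otimes>\<^sub>M N_loc B"
proof -
  have f: "fst \<in> K \<Otimes>\<^sub>M P \<rightarrow>\<^sub>M borel"
    using measurable_fst[of K P] by (simp only: measurable_cong_sets[OF refl sets_K])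
  from measurable_compose[OF measurable_Pair[OF f measurable_compose[OF measurable_snd \<eta>0]] measurable_add_point[OF B]]
  have "(\<lambda>z. add_point (\<eta>0 (snd z)) (fst z)) \<in> K \<Otimes>\<^sub>M P \<rightarrow>\<^sub>M N_loc B" by (simp only: prod.case)
  with f show ?thesis by (rule measurable_Pair)
qed

lemma poisson_shifted_measure:
  "\<exists>\<rho>. sets \<rho> = sets (borel \<Otimes>\<^sub>M N_loc B) \<and> (\<forall>F\<in>borel_measurable (borel \<Otimes>\<^sub>M N_loc B).
     (\<integral>\<^sup>+z. F z \<partial>\<rho>) = (\<integral>\<^sup>+x. \<integral>\<^sup>+w. F (x, add_point (\<eta>0 w) x) \<partial>P \<partial>K))"
proof (rule nested_integral_measure)
  show "(x, add_point (\<eta>0 w) x) \<in> space (borel \<Otimes>\<^sub>M N_loc B)" if "w \<in> space P" for w x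
    using add_point_loc[OF B \<eta>0_loc[OF that]] by (simp add: space_pair_measure)
  fix F :: "'a \<times> 'a measure \<Rightarrow> ennreal" assume F: "F \<in> borel_measurable (borel \<Otimes>\<^sub>M N_loc B)"
  note c = measurable_compose[OF measurable_\<eta>0_add_point F]
  show "(\<lambda>w. F (x, add_point (\<eta>0 w) x)) \<in> borel_measurable P" if x: "x \<in> space K" for x
    using measurable_compose[OF measurable_Pair1'[OF x] c] by (simp only: fst_conv snd_conv)
  interpret prob_space P using pp by (simp add: poisson_process_def)
  show "(\<lambda>x. \<integral>\<^sup>+w. F (x, add_point (\<eta>0 w) x) \<partial>P) \<in> borel_measurable K"
    using borel_measurable_nn_integral_fst[OF c] by (simp only: fst_conv snd_conv)
qed

end

context
  fixes B :: "nat \<Rightarrow> 'a::{second_countable_topology, t2_space} set"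
  assumes B: "partition B"
begin

lemma emeasure_plus_dirac_tuple:
  assumes "\<omega> \<in> loc_counting B" "A \<in> sets borel"
  shows "emeasure (plus_measure \<omega> (dirac_tuple k x)) A = emeasure \<omega> A + (\<Sum>i<k. indicator A (x i))"
proof -
  have s: "sets \<omega> = sets borel" by (rule counting_measuresD(1)[OF loc_counting_subset[OF assms(1)]])
  have "sets \<omega> = sets (dirac_tuple k x)" by (simp add: s dirac_tuple_def)
  from emeasure_plus_measure[OF this] show ?thesis
    using assms(2) by (simp add: s emeasure_dirac_tuple)
qed

lemma plus_dirac_tuple_loc:
  assumes \<omega>: "\<omega> \<in> loc_counting B"
  shows "plus_measure \<omega> (dirac_tuple k x) \<in> loc_counting B"
proof (rule loc_countingI[OF B])
  show "sets (plus_measure \<omega> (dirac_tuple k x)) = sets borel"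
    by (simp add: counting_measuresD(1)[OF loc_counting_subset[OF \<omega>]])
  have n: "(\<Sum>i<k. indicator A (x i) :: ennreal) \<in> \<nat>" for A
    by (induction k) (auto simp: indicator_def)
  {
    fix A :: "'a set" assume A: "A \<in> sets borel"
    have "emeasure \<omega> A \<in> \<nat> \<union> {\<infinity>}"
      using \<omega> A by (auto simp: loc_counting_def counting_measures_def)
    then show "emeasure (plus_measure \<omega> (dirac_tuple k x)) A \<in> \<nat> \<union> {\<infinity>}"
      unfolding emeasure_plus_dirac_tuple[OF \<omega> A] using n[of A] by (intro Nats_infty_add) auto
  }
  fix m
  obtain j where "(\<Sum>i<k. indicator (B m) (x i) :: ennreal) = of_nat j" using n[of "B m"] by (auto simp: Nats_def)
  then show "emeasure (plus_measure \<omega> (dirac_tuple k x)) (B m) \<noteq> \<infinity>"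
    unfolding emeasure_plus_dirac_tuple[OF \<omega> partition_sets[OF B]] using \<omega> by (auto simp: loc_counting_def)
qed

lemma measurable_plus_dirac_tuple:
  "(\<lambda>z. plus_measure (snd z) (dirac_tuple k (fst z))) \<in> Pi\<^sub>M {..<k} (\<lambda>_. borel) \<Otimes>\<^sub>M N_loc B \<rightarrow>\<^sub>M N_loc B"
proof (rule measurable_evaluation_algebra)
  fix A :: "'a set" assume A: "A \<in> sets borel"
  have c: "(\<lambda>z. fst z i) \<in> Pi\<^sub>M {..<k} (\<lambda>_. borel :: 'a measure) \<Otimes>\<^sub>M N_loc B \<rightarrow>\<^sub>M borel" if "i < k" for i
    by (rule measurable_compose[OF measurable_fst measurable_component_singleton]) (simp add: that)
  have i: "(indicator A :: 'a \<Rightarrow> ennreal) \<in> borel_measurable borel"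
    using A by (rule borel_measurable_indicator)
  have "(\<lambda>z. emeasure (snd z) A + (\<Sum>i<k. indicator A (fst z i)))
      \<in> borel_measurable (Pi\<^sub>M {..<k} (\<lambda>_. borel :: 'a measure) \<Otimes>\<^sub>M N_loc B)"
    by (intro borel_measurable_add borel_measurable_sum measurable_compose[OF c i]
        measurable_compose[OF measurable_snd measurable_emeasure_evaluation[OF A]]) auto
  then show "(\<lambda>z. emeasure (plus_measure (snd z) (dirac_tuple k (fst z))) A)
      \<in> borel_measurable (Pi\<^sub>M {..<k} (\<lambda>_. borel) \<Otimes>\<^sub>M N_loc B)"
    by (rule measurable_cong[THEN iffD1, rotated])
       (auto simp: space_pair_measure emeasure_plus_dirac_tuple[OF _ A])
qed (auto simp: space_pair_measure plus_dirac_tuple_loc)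

lemma plus_dirac_tuple_0:
  assumes \<omega>: "\<omega> \<in> loc_counting B"
  shows "plus_measure \<omega> (dirac_tuple 0 x) = \<omega>"
  by (rule measure_eqI)
     (simp_all add: emeasure_plus_dirac_tuple[OF \<omega>] counting_measuresD(1)[OF loc_counting_subset[OF \<omega>]])

lemma plus_dirac_tuple_Suc:
  assumes \<omega>: "\<omega> \<in> loc_counting B"
  shows "add_point (plus_measure \<omega> (dirac_tuple k z)) x = plus_measure \<omega> (dirac_tuple (Suc k) (z(k := x)))"
proof (rule measure_eqI)
  note s = counting_measuresD(1)[OF loc_counting_subset[OF \<omega>]]
  have s': "sets (plus_measure \<omega> (dirac_tuple k z)) = sets borel" by (simp add: s)
  show "sets (add_point (plus_measure \<omega> (dirac_tuple k z)) x)
      = sets (plus_measure \<omega> (dirac_tuple (Suc k) (z(k := x))))"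
    by (simp add: sets_add_point[OF s'] s)
  fix A assume "A \<in> sets (add_point (plus_measure \<omega> (dirac_tuple k z)) x)"
  then have A: "A \<in> sets borel" by (simp add: sets_add_point[OF s'])
  show "emeasure (add_point (plus_measure \<omega> (dirac_tuple k z)) x) A
      = emeasure (plus_measure \<omega> (dirac_tuple (Suc k) (z(k := x)))) A"
    by (simp add: emeasure_add_point[OF s' A] emeasure_plus_dirac_tuple[OF \<omega> A] add.assoc)
qed

end

context
  fixes P :: "'p measure" and K :: "'a::{second_countable_topology, t2_space} measure" and \<eta> \<eta>0 :: "'p \<Rightarrow> 'a measure"
    and B :: "nat \<Rightarrow> 'a set"
  assumes pp: "poisson_process P K \<eta>" and sets_K: "sets K = sets borel" and K: "sigma_finite_measure K"
    and B: "partition B" and KB: "\<And>n. emeasure K (B n) < \<infinity>"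
    and \<eta>0: "\<eta>0 \<in> P \<rightarrow>\<^sub>M N_loc B" and ae: "AE w in P. \<eta> w = \<eta>0 w"
begin

interpretation prob_space P using pp by (simp add: poisson_process_def)

lemma loc0: "w \<in> space P \<Longrightarrow> \<eta>0 w \<in> loc_counting B"
  using measurable_space[OF \<eta>0] by simp

text \<open>Both sides are measures in \<open>F\<close>. They agree on products of a set of finite intensity and an event
  about counts; two extensions by uniqueness of measures, first in the configuration and then in the
  pair, give all \<open>F\<close>.\<close>

lemma mecke:
  assumes F: "F \<in> borel_measurable (borel \<Otimes>\<^sub>M N_loc B)"
  shows "(\<integral>\<^sup>+w. \<integral>\<^sup>+x. F (x, \<eta>0 w) \<partial>\<eta>0 w \<partial>P) = (\<integral>\<^sup>+x. \<integral>\<^sup>+w. F (x, add_point (\<eta>0 w) x) \<partial>P \<partial>K)"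
proof -
  let ?N = "borel \<Otimes>\<^sub>M N_loc B"
  obtain \<rho>1 where \<rho>1: "sets \<rho>1 = sets ?N"
    "\<And>F. F \<in> borel_measurable ?N \<Longrightarrow> (\<integral>\<^sup>+z. F z \<partial>\<rho>1) = (\<integral>\<^sup>+w. \<integral>\<^sup>+x. F (x, \<eta>0 w) \<partial>\<eta>0 w \<partial>P)"
    using poisson_kernel_measure[OF pp sets_K K B KB \<eta>0 ae] by blast
  obtain \<rho>2 where \<rho>2: "sets \<rho>2 = sets ?N"
    "\<And>F. F \<in> borel_measurable ?N \<Longrightarrow> (\<integral>\<^sup>+z. F z \<partial>\<rho>2) = (\<integral>\<^sup>+x. \<integral>\<^sup>+w. F (x, add_point (\<eta>0 w) x) \<partial>P \<partial>K)"
    using poisson_shifted_measure[OF pp sets_K K B KB \<eta>0 ae] by blast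
  have r1: "emeasure \<rho>1 (C \<times> S) = (\<integral>\<^sup>+w. emeasure (\<eta>0 w) C * indicator S (\<eta>0 w) \<partial>P)"
    if C: "C \<in> sets borel" and S: "S \<in> sets (N_loc B)" for C S
  proof -
    have CS: "C \<times> S \<in> sets ?N" using C S by auto
    have "emeasure \<rho>1 (C \<times> S) = (\<integral>\<^sup>+z. indicator (C \<times> S) z \<partial>\<rho>1)"
      using CS by (intro nn_integral_indicator[symmetric]) (simp add: \<rho>1(1))
    also have "\<dots> = (\<integral>\<^sup>+w. \<integral>\<^sup>+x. indicator (C \<times> S) (x, \<eta>0 w) \<partial>\<eta>0 w \<partial>P)"
      by (rule \<rho>1(2)[OF borel_measurable_indicator[OF CS]])
    also have "\<dots> = (\<integral>\<^sup>+w. emeasure (\<eta>0 w) C * indicator S (\<eta>0 w) \<partial>P)"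
    proof (rule nn_integral_cong)
      fix w assume w: "w \<in> space P"
      have C': "C \<in> sets (\<eta>0 w)"
        using C by (simp add: counting_measuresD(1)[OF loc_counting_subset[OF loc0[OF w]]])
      have "(\<integral>\<^sup>+x. indicator (C \<times> S) (x, \<eta>0 w) \<partial>\<eta>0 w) = (\<integral>\<^sup>+x. indicator S (\<eta>0 w) * indicator C x \<partial>\<eta>0 w)"
        by (intro nn_integral_cong) (auto simp: indicator_def)
      also have "\<dots> = indicator S (\<eta>0 w) * emeasure (\<eta>0 w) C"
        by (rule nn_integral_cmult_indicator[OF C'])
      finally show "(\<integral>\<^sup>+x. indicator (C \<times> S) (x, \<eta>0 w) \<partial>\<eta>0 w) = emeasure (\<eta>0 w) C * indicator S (\<eta>0 w)"
        by (simp add: mult.commute)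
    qed
    finally show ?thesis .
  qed
  have r2: "emeasure \<rho>2 (C \<times> S) = (\<integral>\<^sup>+x. indicator C x * (\<integral>\<^sup>+w. indicator S (add_point (\<eta>0 w) x) \<partial>P) \<partial>K)"
    if C: "C \<in> sets borel" and S: "S \<in> sets (N_loc B)" for C S
  proof -
    have CS: "C \<times> S \<in> sets ?N" using C S by auto
    have "emeasure \<rho>2 (C \<times> S) = (\<integral>\<^sup>+z. indicator (C \<times> S) z \<partial>\<rho>2)"
      using CS by (intro nn_integral_indicator[symmetric]) (simp add: \<rho>2(1))
    also have "\<dots> = (\<integral>\<^sup>+x. \<integral>\<^sup>+w. indicator (C \<times> S) (x, add_point (\<eta>0 w) x) \<partial>P \<partial>K)"
      by (rule \<rho>2(2)[OF borel_measurable_indicator[OF CS]])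
    also have "\<dots> = (\<integral>\<^sup>+x. indicator C x * (\<integral>\<^sup>+w. indicator S (add_point (\<eta>0 w) x) \<partial>P) \<partial>K)"
      by (intro nn_integral_cong) (auto simp: indicator_def split: if_splits)
    finally show ?thesis .
  qed
  have counts: "emeasure \<rho>1 (C \<times> S) = emeasure \<rho>2 (C \<times> S)"
    if C: "C \<in> sets borel" "emeasure K C < \<infinity>" and S: "S \<in> loc_count_events K B" for C S
  proof -
    obtain J where J: "S = {\<omega>\<in>loc_counting B. \<forall>p\<in>J. emeasure \<omega> (fst p) = of_nat (snd p)}"
      "finite J" "\<forall>p\<in>J. fst p \<in> sets borel \<and> emeasure K (fst p) < \<infinity>"
      using S unfolding loc_count_events_def[OF pp sets_K K B KB \<eta>0 ae] by blast
    have S': "S \<in> sets (N_loc B)"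
      using S unfolding sets_N_loc_eq[OF pp sets_K K B KB \<eta>0 ae] by (rule sigma_sets.Basic)
    have ind: "indicator S \<omega> = counts_are J \<omega>" if "\<omega> \<in> loc_counting B" for \<omega>
      using that J(2) by (simp add: J(1) counts_are_eq indicator_def)
    have "emeasure \<rho>1 (C \<times> S) = (\<integral>\<^sup>+w. emeasure (\<eta> w) C * counts_are J (\<eta> w) \<partial>P)"
      unfolding r1[OF C(1) S']
    proof (rule nn_integral_cong_AE, rule AE_mp[OF ae], rule AE_I2, rule impI)
      fix w assume "w \<in> space P" "\<eta> w = \<eta>0 w"
      then show "emeasure (\<eta>0 w) C * indicator S (\<eta>0 w) = emeasure (\<eta> w) C * counts_are J (\<eta> w)"
        by (simp only: ind[OF loc0])
    qed
    also have "\<dots> = (\<integral>\<^sup>+x. indicator C x * (\<integral>\<^sup>+w. counts_are J (add_point (\<eta> w) x) \<partial>P) \<partial>K)"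
      using J by (intro poisson_mecke_counts[OF pp sets_K _ _ _ C]) auto
    also have "\<dots> = emeasure \<rho>2 (C \<times> S)"
      unfolding r2[OF C(1) S']
    proof (rule nn_integral_cong, rule arg_cong2[where f = "(*)", OF refl])
      fix x
      show "(\<integral>\<^sup>+w. counts_are J (add_point (\<eta> w) x) \<partial>P) = (\<integral>\<^sup>+w. indicator S (add_point (\<eta>0 w) x) \<partial>P)"
      proof (rule nn_integral_cong_AE, rule AE_mp[OF ae], rule AE_I2, rule impI)
        fix w assume "w \<in> space P" "\<eta> w = \<eta>0 w"
        then show "counts_are J (add_point (\<eta> w) x) = indicator S (add_point (\<eta>0 w) x)"
          by (simp only: ind[OF add_point_loc[OF B loc0]])
      qed
    qed
    finally show ?thesis .
  qed
  \<comment> \<open>Finiteness of the total masses, needed for uniqueness.\<close>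
  have full: "emeasure \<rho>1 (C \<times> loc_counting B) = emeasure K C"
    if C: "C \<in> sets borel" "emeasure K C < \<infinity>" for C
  proof -
    have "emeasure \<rho>1 (C \<times> loc_counting B) = (\<integral>\<^sup>+w. emeasure (\<eta> w) C * counts_are {} (\<eta> w) \<partial>P)"
      unfolding r1[OF C(1) sets.top[of "N_loc B", simplified]]
    proof (rule nn_integral_cong_AE, rule AE_mp[OF ae], rule AE_I2, rule impI)
      fix w assume "w \<in> space P" "\<eta> w = \<eta>0 w"
      then show "emeasure (\<eta>0 w) C * indicator (loc_counting B) (\<eta>0 w) = emeasure (\<eta> w) C * counts_are {} (\<eta> w)"
        using loc0[of w] by (simp add: counts_are_def)
    qed
    also have "\<dots> = (\<integral>\<^sup>+x. indicator C x * (\<integral>\<^sup>+w. counts_are {} (add_point (\<eta> w) x) \<partial>P) \<partial>K)"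
      by (rule poisson_mecke_counts[OF pp sets_K _ _ _ C]) auto
    also have "\<dots> = (\<integral>\<^sup>+x. indicator C x \<partial>K)" by (simp add: counts_are_def emeasure_space_1)
    also have "\<dots> = emeasure K C" using C by (intro nn_integral_indicator) (simp add: sets_K)
    finally show ?thesis .
  qed
  have rect_fin: "emeasure \<rho>1 (C \<times> S) = emeasure \<rho>2 (C \<times> S)"
    if C: "C \<in> sets borel" "emeasure K C < \<infinity>" and S: "S \<in> sets (N_loc B)" for C S
  proof -
    define M where "M \<rho> = distr (density \<rho> (indicator (C \<times> loc_counting B))) (N_loc B) snd"
      for \<rho> :: "('a \<times> 'a measure) measure"
    have CL: "C \<times> loc_counting B \<in> sets ?N"
      using C sets.top[of "N_loc B"] by (auto simp del: sets.top)
    have M: "emeasure (M \<rho>) S = emeasure \<rho> (C \<times> S)"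
      if \<rho>: "sets \<rho> = sets ?N" and S: "S \<in> sets (N_loc B)" for \<rho> S
    proof -
      have sub: "S \<subseteq> loc_counting B" using sets.sets_into_space[OF S] by simp
      have snd: "snd \<in> density \<rho> (indicator (C \<times> loc_counting B)) \<rightarrow>\<^sub>M N_loc B"
        using measurable_snd[of borel "N_loc B"] \<rho> by (simp cong: measurable_cong_sets)
      have sp: "space \<rho> = UNIV \<times> loc_counting B"
        using sets_eq_imp_space_eq[OF \<rho>] by (simp add: space_pair_measure)
      have "emeasure (M \<rho>) S = emeasure (density \<rho> (indicator (C \<times> loc_counting B))) (UNIV \<times> S)"
        unfolding M_def using S snd sub
        by (subst emeasure_distr) (auto intro!: arg_cong2[where f = emeasure] simp: sp)
      also have "\<dots> = (\<integral>\<^sup>+z. indicator (C \<times> loc_counting B) z * indicator (UNIV \<times> S) z \<partial>\<rho>)"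
        using CL S \<rho> by (intro emeasure_density borel_measurable_indicator) auto
      also have "\<dots> = (\<integral>\<^sup>+z. indicator (C \<times> S) z \<partial>\<rho>)"
        using sub by (intro nn_integral_cong) (auto simp: indicator_def)
      also have "\<dots> = emeasure \<rho> (C \<times> S)"
        using C S \<rho> by (intro nn_integral_indicator) auto
      finally show ?thesis .
    qed
    have "M \<rho>1 = M \<rho>2"
    proof (rule measure_eqI_generator_eq[where \<Omega> = "loc_counting B" and E = "loc_count_events K B"
          and A = "\<lambda>_. loc_counting B"])
      show "Int_stable (loc_count_events K B)"
        by (rule Int_stable_loc_count_events[OF pp sets_K K B KB \<eta>0 ae])
      show "loc_count_events K B \<subseteq> Pow (loc_counting B)"
        by (auto simp: loc_count_events_def[OF pp sets_K K B KB \<eta>0 ae])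
      show "sets (M \<rho>1) = sigma_sets (loc_counting B) (loc_count_events K B)"
        "sets (M \<rho>2) = sigma_sets (loc_counting B) (loc_count_events K B)"
        by (simp_all add: M_def sets_N_loc_eq[OF pp sets_K K B KB \<eta>0 ae])
      show "range (\<lambda>_. loc_counting B) \<subseteq> loc_count_events K B"
        unfolding loc_count_events_def[OF pp sets_K K B KB \<eta>0 ae] by (auto intro!: exI[of _ "{}"])
      show "emeasure (M \<rho>1) (loc_counting B) \<noteq> \<infinity>" for i :: nat
        using full[OF C] C(2) by (subst M[OF \<rho>1(1)]) (use sets.top[of "N_loc B"] in auto)
      fix X assume X: "X \<in> loc_count_events K B"
      then have X': "X \<in> sets (N_loc B)"
        unfolding sets_N_loc_eq[OF pp sets_K K B KB \<eta>0 ae] by (rule sigma_sets.Basic)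
      show "emeasure (M \<rho>1) X = emeasure (M \<rho>2) X"
        unfolding M[OF \<rho>1(1) X'] M[OF \<rho>2(1) X'] by (rule counts[OF C X])
    qed simp
    then show ?thesis using M[OF \<rho>1(1) S] M[OF \<rho>2(1) S] by simp
  qed
  have rect: "emeasure \<rho>1 (C \<times> S) = emeasure \<rho>2 (C \<times> S)"
    if C: "C \<in> sets borel" and S: "S \<in> sets (N_loc B)" for C S
  proof -
    have split: "emeasure \<rho> (C \<times> S) = (\<Sum>n. emeasure \<rho> ((C \<inter> B n) \<times> S))" if \<rho>: "sets \<rho> = sets ?N" for \<rho>
    proof -
      have "disjoint_family (\<lambda>n. (C \<inter> B n) \<times> S)"
        using B unfolding partition_def disjoint_family_on_def by blast
      then have "(\<Sum>n. emeasure \<rho> ((C \<inter> B n) \<times> S)) = emeasure \<rho> (\<Union>n. (C \<inter> B n) \<times> S)"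
        using C S partition_sets[OF B] \<rho> by (intro suminf_emeasure) auto
      also have "(\<Union>n. (C \<inter> B n) \<times> S) = C \<times> S" using B by (auto simp: partition_def)
      finally show ?thesis by simp
    qed
    have "emeasure K (C \<inter> B n) < \<infinity>" for n
    proof -
      have "emeasure K (C \<inter> B n) \<le> emeasure K (B n)"
        using partition_sets[OF B] by (intro emeasure_mono) (auto simp: sets_K)
      then show ?thesis using KB[of n] by (rule le_less_trans)
    qed
    then show ?thesis
      unfolding split[OF \<rho>1(1)] split[OF \<rho>2(1)] using C partition_sets[OF B] S
      by (intro suminf_cong rect_fin) auto
  qed
  have "\<rho>1 = \<rho>2"
  proof (rule measure_eqI_generator_eq[where \<Omega> = "space borel \<times> space (N_loc B)"
        and E = "{a \<times> b | a b. a \<in> sets borel \<and> b \<in> sets (N_loc B)}" and A = "\<lambda>n. B n \<times> loc_counting B"])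
    show "Int_stable {a \<times> b | a b. a \<in> sets borel \<and> b \<in> sets (N_loc B)}" by (rule Int_stable_pair_measure_generator)
    show "{a \<times> b | a b. a \<in> sets borel \<and> b \<in> sets (N_loc B)} \<subseteq> Pow (space borel \<times> space (N_loc B))"
      by (rule pair_measure_closed)
    show "sets \<rho>1 = sigma_sets (space borel \<times> space (N_loc B)) {a \<times> b | a b. a \<in> sets borel \<and> b \<in> sets (N_loc B)}"
      "sets \<rho>2 = sigma_sets (space borel \<times> space (N_loc B)) {a \<times> b | a b. a \<in> sets borel \<and> b \<in> sets (N_loc B)}"
      by (simp_all add: \<rho>1(1) \<rho>2(1) sets_pair_measure)
    have "loc_counting B \<in> sets (N_loc B)" using sets.top[of "N_loc B"] by simp
    then show "range (\<lambda>n. B n \<times> loc_counting B) \<subseteq> {a \<times> b | a b. a \<in> sets borel \<and> b \<in> sets (N_loc B)}"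
      using partition_sets[OF B] by blast
    show "(\<Union>n. B n \<times> loc_counting B) = space borel \<times> space (N_loc B)"
      using B by (auto simp: partition_def)
    show "emeasure \<rho>1 (B n \<times> loc_counting B) \<noteq> \<infinity>" for n
      using full[OF partition_sets[OF B, of n] KB[of n]] KB[of n] by simp
    fix X :: "('a \<times> 'a measure) set" assume "X \<in> {a \<times> b | a b. a \<in> sets borel \<and> b \<in> sets (N_loc B)}"
    then show "emeasure \<rho>1 X = emeasure \<rho>2 X" using rect by blast
  qed
  then show ?thesis using \<rho>1(2)[OF F] \<rho>2(2)[OF F] by simp
qed

text \<open>Peel off the last point with the recursion for \<open>fact_sum\<close> and apply the Mecke formula to it; the
  point added by the formula cancels the one removed by the recursion, and the remaining \<open>k\<close> points are
  left to the induction hypothesis.\<close>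

lemma mecke_tuples:
  assumes "F \<in> borel_measurable (Pi\<^sub>M {..<k} (\<lambda>_. borel) \<Otimes>\<^sub>M N_loc B)"
  shows "(\<integral>\<^sup>+w. fact_sum k (\<lambda>z. F (z, \<eta>0 w)) (\<eta>0 w) \<partial>P)
    = (\<integral>\<^sup>+x. \<integral>\<^sup>+w. F (x, plus_measure (\<eta>0 w) (dirac_tuple k x)) \<partial>P \<partial>Pi\<^sub>M {..<k} (\<lambda>_. K))"
  using assms
proof (induction k arbitrary: F)
  case 0
  interpret PK: product_sigma_finite "\<lambda>_::nat. K" by (rule product_sigma_finite.intro[OF K])
  have e: "{..<0::nat} = {}" by simp
  show ?case
    unfolding e fact_sum_0
    by (subst PK.nn_integral_empty, simp, intro nn_integral_cong, simp only: plus_dirac_tuple_0[OF B loc0])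
next
  case (Suc k)
  interpret PK: product_sigma_finite "\<lambda>_::nat. K" by (rule product_sigma_finite.intro[OF K])
  have ins: "insert k {..<k} = {..<Suc k}" by auto
  have upd: "(\<lambda>p. (fst p)(k := snd p)) \<in> Pi\<^sub>M {..<k} (\<lambda>_. borel :: 'a measure) \<Otimes>\<^sub>M borel \<rightarrow>\<^sub>M Pi\<^sub>M {..<Suc k} (\<lambda>_. borel)"
    using measurable_add_dim[of k "{..<k}" "\<lambda>_. borel :: 'a measure"] by (simp only: case_prod_beta' lessThan_Suc)
  define H where "H p = fact_sum k (\<lambda>z. F (z(k := fst p), snd p)) (remove_point (snd p) (fst p))" for p
  have H: "H \<in> borel_measurable (borel \<Otimes>\<^sub>M N_loc B)"
  proof -
    have r: "(\<lambda>p. remove_point (snd p) (fst p)) \<in> borel \<Otimes>\<^sub>M N_loc B \<rightarrow>\<^sub>M N_loc B"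
      using measurable_remove_point[OF B] by (simp only: case_prod_beta')
    have "(\<lambda>p. ((fst p)(k := fst (snd p)), snd (snd p)))
        \<in> Pi\<^sub>M {..<k} (\<lambda>_. borel :: 'a measure) \<Otimes>\<^sub>M (borel \<Otimes>\<^sub>M N_loc B) \<rightarrow>\<^sub>M Pi\<^sub>M {..<Suc k} (\<lambda>_. borel) \<Otimes>\<^sub>M N_loc B"
      using measurable_compose[OF measurable_Pair[OF measurable_fst measurable_compose[OF measurable_snd measurable_fst]] upd]
      by (intro measurable_Pair measurable_compose[OF measurable_snd measurable_snd]) (simp only: fst_conv snd_conv)
    from measurable_fact_sum[OF B r measurable_compose[OF this Suc.prems]]
    show ?thesis unfolding H_def[abs_def] by (simp only: fst_conv snd_conv)
  qed
  have "(\<integral>\<^sup>+w. fact_sum (Suc k) (\<lambda>z. F (z, \<eta>0 w)) (\<eta>0 w) \<partial>P) = (\<integral>\<^sup>+w. \<integral>\<^sup>+x. H (x, \<eta>0 w) \<partial>\<eta>0 w \<partial>P)"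
  proof (rule nn_integral_cong)
    fix w assume w: "w \<in> space P"
    have "\<eta>0 w \<in> space (N_loc B)" using loc0[OF w] by simp
    from fact_sum_Suc'[OF B loc0[OF w] measurable_compose[OF measurable_Pair2'[OF this] Suc.prems]]
    show "fact_sum (Suc k) (\<lambda>z. F (z, \<eta>0 w)) (\<eta>0 w) = (\<integral>\<^sup>+x. H (x, \<eta>0 w) \<partial>\<eta>0 w)"
      by (simp only: H_def fst_conv snd_conv)
  qed
  also have "\<dots> = (\<integral>\<^sup>+x. \<integral>\<^sup>+w. H (x, add_point (\<eta>0 w) x) \<partial>P \<partial>K)" by (rule mecke[OF H])
  also have "\<dots> = (\<integral>\<^sup>+x. \<integral>\<^sup>+z. \<integral>\<^sup>+w. F (z(k := x), plus_measure (\<eta>0 w) (dirac_tuple (Suc k) (z(k := x))))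
      \<partial>P \<partial>Pi\<^sub>M {..<k} (\<lambda>_. K) \<partial>K)"
  proof (rule nn_integral_cong)
    fix x :: 'a
    define Fx where "Fx p = F ((fst p)(k := x), add_point (snd p) x)" for p
    have Fx: "Fx \<in> borel_measurable (Pi\<^sub>M {..<k} (\<lambda>_. borel) \<Otimes>\<^sub>M N_loc B)"
    proof -
      have x: "(\<lambda>_. x) \<in> M \<rightarrow>\<^sub>M borel" for M :: "((nat \<Rightarrow> 'a) \<times> 'a measure) measure" by simp
      have u: "(\<lambda>p. (fst p)(k := x)) \<in> Pi\<^sub>M {..<k} (\<lambda>_. borel :: 'a measure) \<Otimes>\<^sub>M N_loc B \<rightarrow>\<^sub>M Pi\<^sub>M {..<Suc k} (\<lambda>_. borel)"
        using measurable_compose[OF measurable_Pair[OF measurable_fst x] upd] by (simp only: fst_conv snd_conv)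
      have a: "(\<lambda>p. add_point (snd p) x) \<in> Pi\<^sub>M {..<k} (\<lambda>_. borel :: 'a measure) \<Otimes>\<^sub>M N_loc B \<rightarrow>\<^sub>M N_loc B"
        using measurable_compose[OF measurable_Pair[OF x measurable_snd] measurable_add_point[OF B]] by (simp only: prod.case)
      show ?thesis unfolding Fx_def[abs_def] by (rule measurable_compose[OF measurable_Pair[OF u a] Suc.prems])
    qed
    have "(\<integral>\<^sup>+w. H (x, add_point (\<eta>0 w) x) \<partial>P) = (\<integral>\<^sup>+w. fact_sum k (\<lambda>z. Fx (z, \<eta>0 w)) (\<eta>0 w) \<partial>P)"
      by (intro nn_integral_cong) (simp only: H_def Fx_def fst_conv snd_conv remove_add_point[OF B loc0])
    also have "\<dots> = (\<integral>\<^sup>+z. \<integral>\<^sup>+w. Fx (z, plus_measure (\<eta>0 w) (dirac_tuple k z)) \<partial>P \<partial>Pi\<^sub>M {..<k} (\<lambda>_. K))"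
      by (rule Suc.IH[OF Fx])
    also have "\<dots> = (\<integral>\<^sup>+z. \<integral>\<^sup>+w. F (z(k := x), plus_measure (\<eta>0 w) (dirac_tuple (Suc k) (z(k := x)))) \<partial>P \<partial>Pi\<^sub>M {..<k} (\<lambda>_. K))"
      by (intro nn_integral_cong) (simp only: Fx_def fst_conv snd_conv plus_dirac_tuple_Suc[OF B loc0])
    finally show "(\<integral>\<^sup>+w. H (x, add_point (\<eta>0 w) x) \<partial>P) = \<dots>" .
  qed
  also have "\<dots> = (\<integral>\<^sup>+x. \<integral>\<^sup>+w. F (x, plus_measure (\<eta>0 w) (dirac_tuple (Suc k) x)) \<partial>P \<partial>Pi\<^sub>M {..<Suc k} (\<lambda>_. K))"
  proof -
    have sK: "sets (Pi\<^sub>M {..<Suc k} (\<lambda>_. K)) = sets (Pi\<^sub>M {..<Suc k} (\<lambda>_. borel))"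
      by (intro sets_PiM_cong refl sets_K)
    have "fst \<in> Pi\<^sub>M {..<Suc k} (\<lambda>_. K) \<Otimes>\<^sub>M P \<rightarrow>\<^sub>M Pi\<^sub>M {..<Suc k} (\<lambda>_. borel)"
      using measurable_fst[of "Pi\<^sub>M {..<Suc k} (\<lambda>_. K)" P] by (simp only: measurable_cong_sets[OF refl sK])
    note f = this measurable_compose[OF measurable_Pair[OF this measurable_compose[OF measurable_snd \<eta>0]] measurable_plus_dirac_tuple[OF B]]
    from borel_measurable_nn_integral_fst[OF measurable_compose[OF measurable_Pair[OF f] Suc.prems]]
    have m: "(\<lambda>x. \<integral>\<^sup>+w. F (x, plus_measure (\<eta>0 w) (dirac_tuple (Suc k) x)) \<partial>P)
        \<in> borel_measurable (Pi\<^sub>M {..<Suc k} (\<lambda>_. K))"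
      by (simp only: fst_conv snd_conv)
    show ?thesis
      using PK.product_nn_integral_insert_rev[of "{..<k}" k, unfolded ins, OF _ _ m] by simp
  qed
  finally show ?case .
qed

end

section \<open>Finite counting measures as multisets\<close>

definition mset_measure :: "'b::topological_space multiset \<Rightarrow> 'b measure" where
  "mset_measure m = distr (density (count_space UNIV) (\<lambda>x. of_nat (count m x))) borel (\<lambda>x. x)"

lemma sets_mset_measure [simp]: "sets (mset_measure m) = sets borel"
  and space_mset_measure [simp]: "space (mset_measure m) = UNIV"
  by (simp_all add: mset_measure_def)

lemma nn_integral_mset_measure:
  fixes u :: "'b::topological_space \<Rightarrow> ennreal"
  assumes u: "u \<in> borel_measurable borel"
  shows "(\<integral>\<^sup>+x. u x \<partial>mset_measure m) = (\<Sum>x\<in>#m. u x)"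
proof -
  have "(\<integral>\<^sup>+x. u x \<partial>mset_measure m) = (\<integral>\<^sup>+x. of_nat (count m x) * u x \<partial>count_space UNIV)"
    unfolding mset_measure_def using u
    by (subst nn_integral_distr) (auto simp: nn_integral_density measurable_count_space_eq1 cong: measurable_cong_sets)
  also have "\<dots> = (\<Sum>x\<in>#m. u x)"
  proof (induction m)
    case (add y m)
    have "(\<integral>\<^sup>+x. of_nat (count (add_mset y m) x) * u x \<partial>count_space UNIV)
        = (\<integral>\<^sup>+x. of_nat (count m x) * u x + u y * indicator {y} x \<partial>count_space UNIV)"
      by (intro nn_integral_cong) (auto simp: indicator_def distrib_right add.commute)
    also have "\<dots> = (\<integral>\<^sup>+x. of_nat (count m x) * u x \<partial>count_space UNIV) + u y"
      by (subst nn_integral_add) (auto simp: nn_integral_cmult_indicator)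
    finally show ?case using add by (simp add: add.commute)
  qed simp
  finally show ?thesis .
qed

lemma emeasure_mset_measure:
  assumes A: "A \<in> sets borel"
  shows "emeasure (mset_measure m) A = of_nat (size (filter_mset (\<lambda>x. x \<in> A) m))"
proof -
  have "emeasure (mset_measure m) A = (\<integral>\<^sup>+x. indicator A x \<partial>mset_measure m)"
    using A by (intro nn_integral_indicator[symmetric]) simp
  also have "\<dots> = (\<Sum>x\<in>#m. indicator A x)"
    by (rule nn_integral_mset_measure[OF borel_measurable_indicator[OF A]])
  also have "\<dots> = of_nat (size (filter_mset (\<lambda>x. x \<in> A) m))"
    by (induction m) (auto simp: indicator_def)
  finally show ?thesis .
qed

lemma emeasure_mset_measure_singleton:
  "emeasure (mset_measure m) {x :: 'b::t1_space} = of_nat (count m x)"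
proof -
  have "size (filter_mset (\<lambda>y. y \<in> {x}) m) = count m x" by (induction m) auto
  then show ?thesis by (simp only: emeasure_mset_measure borel_singleton sets.empty_sets)
qed

lemma mset_measure_finite_counting: "mset_measure m \<in> finite_counting_measures"
proof -
  have "finite_measure (mset_measure m)"
    by (rule finite_measureI) (simp add: emeasure_mset_measure)
  then show ?thesis
    by (auto simp: finite_counting_measures_def counting_measures_def emeasure_mset_measure
        intro: finite_measure.axioms(1))
qed

text \<open>Inverse to \<open>mset_measure\<close> on the finite counting measures.\<close>

definition measure_mset :: "'b::topological_space measure \<Rightarrow> 'b multiset" where
  "measure_mset \<omega> = Abs_multiset (multiplicity_at \<omega>)"

lemma finite_counting_measuresD:
  assumes "\<omega> \<in> finite_counting_measures"
  shows "\<omega> \<in> counting_measures" "finite_measure \<omega>" "emeasure \<omega> A \<noteq> \<infinity>"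
proof -
  show "\<omega> \<in> counting_measures" and fin: "finite_measure \<omega>"
    using assms by (simp_all add: finite_counting_measures_def)
  show "emeasure \<omega> A \<noteq> \<infinity>" using finite_measure.emeasure_finite[OF fin] by simp
qed

lemma count_measure_mset:
  fixes \<omega> :: "'b::{second_countable_topology, t2_space} measure"
  assumes \<omega>: "\<omega> \<in> finite_counting_measures"
  shows "count (measure_mset \<omega>) x = multiplicity_at \<omega> x"
proof -
  note c = finite_counting_measuresD(1)[OF \<omega>]
  have "(\<integral>\<^sup>+x. of_nat (multiplicity_at \<omega> x) * 1 \<partial>count_space UNIV) = emeasure \<omega> (space \<omega>)"
    using nn_integral_counting_measure[OF c, of "\<lambda>_. 1"] by simp
  then have fin: "(\<integral>\<^sup>+x. of_nat (multiplicity_at \<omega> x) \<partial>count_space UNIV) \<noteq> \<infinity>"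
    using finite_counting_measuresD(3)[OF \<omega>, of "space \<omega>"] by simp
  have "emeasure (count_space UNIV) {x. multiplicity_at \<omega> x > 0}
      = (\<integral>\<^sup>+x. indicator {x. multiplicity_at \<omega> x > 0} x \<partial>count_space UNIV)"
    by simp
  also have "\<dots> \<le> (\<integral>\<^sup>+x. of_nat (multiplicity_at \<omega> x) \<partial>count_space UNIV)"
  proof (rule nn_integral_mono)
    fix x
    show "indicator {x. multiplicity_at \<omega> x > 0} x \<le> (of_nat (multiplicity_at \<omega> x) :: ennreal)"
      by (cases "multiplicity_at \<omega> x") auto
  qed
  finally have "emeasure (count_space UNIV) {x. multiplicity_at \<omega> x > 0} \<noteq> \<infinity>"
    using fin by (auto simp: top_unique)
  then have "finite {x. multiplicity_at \<omega> x > 0}"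
    by (auto simp: emeasure_count_space split: if_splits)
  then show ?thesis by (simp add: measure_mset_def Abs_multiset_inverse)
qed

lemma mset_measure_measure_mset:
  fixes \<omega> :: "'b::{second_countable_topology, t2_space} measure"
  assumes \<omega>: "\<omega> \<in> finite_counting_measures"
  shows "mset_measure (measure_mset \<omega>) = \<omega>"
proof (rule measure_eqI)
  note c = finite_counting_measuresD(1)[OF \<omega>] and c' = finite_counting_measuresD(1)[OF mset_measure_finite_counting]
  show "sets (mset_measure (measure_mset \<omega>)) = sets \<omega>" by (simp add: counting_measuresD(1)[OF c])
  have m: "multiplicity_at (mset_measure (measure_mset \<omega>)) x = multiplicity_at \<omega> x" for x
    using emeasure_singleton_eq_multiplicity(1)[OF c', of "measure_mset \<omega>" x]
    by (simp add: emeasure_mset_measure_singleton count_measure_mset[OF \<omega>])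
  fix A assume "A \<in> sets (mset_measure (measure_mset \<omega>))"
  then have A: "A \<in> sets borel" by simp
  have "emeasure \<nu> A = (\<integral>\<^sup>+x. of_nat (multiplicity_at \<nu> x) * indicator A x \<partial>count_space UNIV)"
    if "\<nu> \<in> counting_measures" for \<nu> :: "'b measure"
    using nn_integral_counting_measure[OF that borel_measurable_indicator[OF A]] A counting_measuresD(1)[OF that]
    by simp
  from this[OF c] this[OF c'] show "emeasure (mset_measure (measure_mset \<omega>)) A = emeasure \<omega> A"
    by (simp add: m)
qed

lemma measure_mset_mset_measure:
  fixes m :: "'b::{second_countable_topology, t2_space} multiset"
  shows "measure_mset (mset_measure m) = m"
proof (rule multiset_eqI)
  fix x
  note c = mset_measure_finite_counting[of m]
  have "(of_nat (multiplicity_at (mset_measure m) x) :: ennreal) = of_nat (count m x)"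
    using emeasure_singleton_eq_multiplicity(1)[OF finite_counting_measuresD(1)[OF c], of x]
    by (simp add: emeasure_mset_measure_singleton)
  then have "multiplicity_at (mset_measure m) x = count m x" unfolding of_nat_eq_iff .
  then show "count (measure_mset (mset_measure m)) x = count m x" by (simp add: count_measure_mset[OF c])
qed

text \<open>The \<open>\<sigma>\<close>-algebra for which \<open>mset_measure\<close> identifies random multisets and finite point processes.\<close>

definition MS :: "'b::topological_space multiset measure" where
  "MS = vimage_algebra UNIV mset_measure Nfin_space"

lemma space_MS [simp]: "space MS = UNIV" by (simp add: MS_def)

lemma measurable_mset_measure: "mset_measure \<in> MS \<rightarrow>\<^sub>M Nfin_space"
  unfolding MS_def by (rule measurable_vimage_algebra1) (auto simp: mset_measure_finite_counting)

lemma measurable_MS_iff: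
  "f \<in> \<Omega> \<rightarrow>\<^sub>M MS \<longleftrightarrow> (\<forall>A\<in>sets borel. (\<lambda>w. emeasure (mset_measure (f w)) A) \<in> borel_measurable \<Omega>)"
proof
  assume "f \<in> \<Omega> \<rightarrow>\<^sub>M MS"
  from measurable_compose[OF this measurable_mset_measure]
  show "\<forall>A\<in>sets borel. (\<lambda>w. emeasure (mset_measure (f w)) A) \<in> borel_measurable \<Omega>"
    by (auto intro: measurable_eval_compose)
next
  assume a: "\<forall>A\<in>sets borel. (\<lambda>w. emeasure (mset_measure (f w)) A) \<in> borel_measurable \<Omega>"
  have "(\<lambda>w. mset_measure (f w)) \<in> \<Omega> \<rightarrow>\<^sub>M Nfin_space"
    using a by (intro measurable_evaluation_algebra) (auto simp: mset_measure_finite_counting)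
  then show "f \<in> \<Omega> \<rightarrow>\<^sub>M MS"
    unfolding MS_def by (intro measurable_vimage_algebra2) auto
qed

lemma measurable_MS_eval:
  "f \<in> \<Omega> \<rightarrow>\<^sub>M MS \<Longrightarrow> A \<in> sets borel \<Longrightarrow> (\<lambda>w. emeasure (mset_measure (f w)) A) \<in> borel_measurable \<Omega>"
  by (simp add: measurable_MS_iff)

lemma measurable_measure_mset:
  "measure_mset \<in> Nfin_space \<rightarrow>\<^sub>M (MS :: 'b::{second_countable_topology, t2_space} multiset measure)"
  unfolding measurable_MS_iff
proof
  fix A :: "'b set" assume A: "A \<in> sets borel"
  show "(\<lambda>\<omega>. emeasure (mset_measure (measure_mset \<omega>)) A) \<in> borel_measurable Nfin_space"
    by (rule measurable_cong[THEN iffD2, OF _ measurable_emeasure_evaluation[OF A]])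
       (simp add: mset_measure_measure_mset)
qed

lemma measurable_mset_size:
  assumes "f \<in> \<Omega> \<rightarrow>\<^sub>M MS" shows "(\<lambda>w. size (f w)) \<in> \<Omega> \<rightarrow>\<^sub>M count_space UNIV"
proof (rule measurable_count_space_eq2_countable[THEN iffD2])
  have "(\<lambda>w. emeasure (mset_measure (f w)) UNIV) \<in> borel_measurable \<Omega>"
    by (rule measurable_MS_eval[OF assms]) simp
  then have "(\<lambda>w. of_nat (size (f w)) :: ennreal) \<in> borel_measurable \<Omega>" by (simp add: emeasure_mset_measure)
  from measurable_sets[OF this]
  have "(\<lambda>w. of_nat (size (f w)) :: ennreal) -` {of_nat n} \<inter> space \<Omega> \<in> sets \<Omega>" for n :: nat by simp
  then have "(\<lambda>w. size (f w)) -` {n} \<inter> space \<Omega> \<in> sets \<Omega>" for n :: nat by (simp add: vimage_def)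
  then show "(\<lambda>w. size (f w)) \<in> space \<Omega> \<rightarrow> UNIV \<and> (\<forall>a\<in>UNIV. (\<lambda>w. size (f w)) -` {a} \<inter> space \<Omega> \<in> sets \<Omega>)"
    by auto
qed

text \<open>Finite counting measures are the case of a partition with one nonempty piece, so the results on
  local finiteness cover them.\<close>

definition trivial_partition :: "nat \<Rightarrow> 'b set" where
  "trivial_partition n = (if n = 0 then UNIV else {})"

lemma partition_trivial: "partition (trivial_partition :: nat \<Rightarrow> 'b::topological_space set)"
  by (auto simp: partition_def trivial_partition_def disjoint_family_on_def)

lemma measurable_mset_measure_loc:
  assumes "f \<in> \<Omega> \<rightarrow>\<^sub>M MS" shows "(\<lambda>w. mset_measure (f w)) \<in> \<Omega> \<rightarrow>\<^sub>M N_loc trivial_partition"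
proof (rule measurable_evaluation_algebra)
  fix w
  show "mset_measure (f w) \<in> loc_counting trivial_partition"
    by (simp only: loc_counting_def mem_Collect_eq finite_counting_measuresD[OF mset_measure_finite_counting] not_False_eq_True simp_thms)
qed (rule measurable_MS_eval[OF assms])

lemma measurable_sum_mset_ennreal:
  fixes F :: "'b::{second_countable_topology, t2_space} \<times> 'w \<Rightarrow> ennreal"
  assumes f: "f \<in> \<Omega> \<rightarrow>\<^sub>M MS" and F: "F \<in> borel_measurable (borel \<Otimes>\<^sub>M \<Omega>)"
  shows "(\<lambda>w. \<Sum>x\<in>#f w. F (x, w)) \<in> borel_measurable \<Omega>"
proof -
  have "(\<lambda>w. \<integral>\<^sup>+x. F (x, w) \<partial>mset_measure (f w)) \<in> borel_measurable \<Omega>"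
    by (rule kernel_nn_integral_measurable[OF partition_trivial measurable_mset_measure_loc[OF f] F])
  moreover have "(\<integral>\<^sup>+x. F (x, w) \<partial>mset_measure (f w)) = (\<Sum>x\<in>#f w. F (x, w))" if "w \<in> space \<Omega>" for w
    by (rule nn_integral_mset_measure[OF measurable_compose[OF measurable_Pair2'[OF that] F]])
  ultimately show ?thesis by (subst (asm) measurable_cong) auto
qed

lemma measurable_sum_mset:
  fixes F :: "'b::{second_countable_topology, t2_space} \<times> 'w \<Rightarrow> real"
  assumes f: "f \<in> \<Omega> \<rightarrow>\<^sub>M MS" and F: "F \<in> borel_measurable (borel \<Otimes>\<^sub>M \<Omega>)"
  shows "(\<lambda>w. \<Sum>x\<in>#f w. F (x, w)) \<in> borel_measurable \<Omega>"
proof -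
  have e: "enn2real (\<Sum>x\<in>#m. ennreal (u x)) = (\<Sum>x\<in>#m. u x)" if "\<And>x. 0 \<le> u x" for m and u :: "'b \<Rightarrow> real"
  proof -
    have "(\<Sum>x\<in>#m. ennreal (u x)) = ennreal (\<Sum>x\<in>#m. u x) \<and> 0 \<le> (\<Sum>x\<in>#m. u x)"
      using that by (induction m) (auto simp: ennreal_plus)
    then show ?thesis by simp
  qed
  have "(\<Sum>x\<in>#m. u x) = enn2real (\<Sum>x\<in>#m. ennreal (max 0 (u x))) - enn2real (\<Sum>x\<in>#m. ennreal (max 0 (- u x)))"
    for m and u :: "'b \<Rightarrow> real"
  proof -
    have "(\<Sum>x\<in>#m. u x) = (\<Sum>x\<in>#m. max 0 (u x)) - (\<Sum>x\<in>#m. max 0 (- u x))"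
      by (induction m) auto
    then show ?thesis by (simp add: e del: ennreal_max_0 ennreal_max_0')
  qed
  moreover have "(\<lambda>w. enn2real (\<Sum>x\<in>#f w. ennreal (max 0 (F (x, w)))) - enn2real (\<Sum>x\<in>#f w. ennreal (max 0 (- F (x, w)))))
      \<in> borel_measurable \<Omega>"
  proof -
    have "(\<lambda>p. ennreal (max 0 (F p))) \<in> borel_measurable (borel \<Otimes>\<^sub>M \<Omega>)"
      "(\<lambda>p. ennreal (max 0 (- F p))) \<in> borel_measurable (borel \<Otimes>\<^sub>M \<Omega>)"
      using F by (auto intro!: measurable_compose[OF _ measurable_ennreal] borel_measurable_max
          simp del: ennreal_max_0 ennreal_max_0')
    from this[THEN measurable_sum_mset_ennreal[OF f]] show ?thesis
      by (intro borel_measurable_diff borel_measurable_enn2real)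
  qed
  ultimately show ?thesis by simp
qed

lemma measurable_mset_add:
  fixes f g :: "'w \<Rightarrow> 'a::topological_space multiset"
  assumes f: "f \<in> \<Omega> \<rightarrow>\<^sub>M MS" and g: "g \<in> \<Omega> \<rightarrow>\<^sub>M MS"
  shows "(\<lambda>w. f w + g w) \<in> \<Omega> \<rightarrow>\<^sub>M MS"
  unfolding measurable_MS_iff
proof
  fix A :: "'a set" assume A: "A \<in> sets borel"
  have "emeasure (mset_measure (f w + g w)) A = emeasure (mset_measure (f w)) A + emeasure (mset_measure (g w)) A" for w
    using A by (simp add: emeasure_mset_measure)
  then show "(\<lambda>w. emeasure (mset_measure (f w + g w)) A) \<in> borel_measurable \<Omega>"
    using measurable_MS_eval[OF f A] measurable_MS_eval[OF g A] by simp
qed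

lemma measurable_mset_single:
  fixes f :: "'w \<Rightarrow> 'a::topological_space"
  assumes f: "f \<in> borel_measurable \<Omega>"
  shows "(\<lambda>w. {#f w#}) \<in> \<Omega> \<rightarrow>\<^sub>M MS"
  unfolding measurable_MS_iff
proof
  fix A :: "'a set" assume A: "A \<in> sets borel"
  have "emeasure (mset_measure {#f w#}) A = indicator A (f w)" for w
    using A by (simp add: emeasure_mset_measure indicator_def)
  then show "(\<lambda>w. emeasure (mset_measure {#f w#}) A) \<in> borel_measurable \<Omega>"
    using measurable_compose[OF f borel_measurable_indicator[OF A]] by simp
qed

lemma measurable_mset_add_mset:
  assumes f: "f \<in> borel_measurable \<Omega>" and g: "g \<in> \<Omega> \<rightarrow>\<^sub>M MS"
  shows "(\<lambda>w. add_mset (f w) (g w)) \<in> \<Omega> \<rightarrow>\<^sub>M MS"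
  using measurable_mset_add[OF measurable_mset_single[OF f] g] by simp

lemma measurable_mset_count:
  fixes f :: "'w \<Rightarrow> 'b::{second_countable_topology, t2_space}"
  assumes f: "f \<in> borel_measurable \<Omega>" and g: "g \<in> \<Omega> \<rightarrow>\<^sub>M MS"
  shows "(\<lambda>w. of_nat (count (g w) (f w)) :: ennreal) \<in> borel_measurable \<Omega>"
proof -
  have "(\<lambda>w. (f w, mset_measure (g w))) \<in> \<Omega> \<rightarrow>\<^sub>M borel \<Otimes>\<^sub>M N_loc trivial_partition"
    by (rule measurable_Pair[OF f measurable_mset_measure_loc[OF g]])
  from measurable_compose[OF this measurable_emeasure_singleton[OF partition_trivial]]
  show ?thesis by (simp add: emeasure_mset_measure_singleton)
qed

lemma measurable_mset_remove1:
  fixes f :: "'w \<Rightarrow> 'b::{second_countable_topology, t2_space}"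
  assumes f: "f \<in> borel_measurable \<Omega>" and g: "g \<in> \<Omega> \<rightarrow>\<^sub>M MS"
  shows "(\<lambda>w. g w - {#f w#}) \<in> \<Omega> \<rightarrow>\<^sub>M MS"
  unfolding measurable_MS_iff
proof
  fix A :: "'b set" assume A: "A \<in> sets borel"
  have eq: "emeasure (mset_measure (g w - {#f w#})) A
      = emeasure (mset_measure (g w)) A - (if (of_nat (count (g w) (f w)) :: ennreal) = 0 then 0 else indicator A (f w))" for w
  proof (cases "f w \<in># g w")
    case True
    then obtain m where m: "g w = add_mset (f w) m" by (metis multi_member_split)
    show ?thesis using A by (auto simp: m emeasure_mset_measure indicator_def)
  next
    case False
    then show ?thesis by (simp add: diff_single_trivial not_in_iff)
  qed
  have "{w \<in> space \<Omega>. (of_nat (count (g w) (f w)) :: ennreal) = 0} \<in> sets \<Omega>"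
    using measurable_sets[OF measurable_mset_count[OF f g], of "{0}"]
    by (simp add: vimage_def Int_def conj_commute del: of_nat_eq_0_iff)
  then show "(\<lambda>w. emeasure (mset_measure (g w - {#f w#})) A) \<in> borel_measurable \<Omega>"
    unfolding eq
    by (intro borel_measurable_minus_ennreal measurable_If measurable_MS_eval[OF g A]
        measurable_compose[OF f borel_measurable_indicator[OF A]]) (auto simp del: of_nat_eq_0_iff)
qed

section \<open>The Stein kernel\<close>

text \<open>The points of \<open>A\<close> are to be inserted, those of \<open>Z\<close> to be deleted, and the points of \<open>c\<close> are the ones
  inserted so far, so the current configuration is \<open>c + Z\<close>. One further operation is marked. All
  operations are carried out in uniformly random order, and \<open>path_avg D n A Z c\<close>, with
  \<open>n = \<bar>A\<bar> + \<bar>Z\<bar>\<close>, is the mean of \<open>D\<close> at the configuration met by the marked operation. The recursion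
  conditions on the first operation: it is the marked one, or inserts some \<open>x\<close>, or deletes some \<open>z\<close>.\<close>

primrec path_avg :: "('b multiset \<Rightarrow> real) \<Rightarrow> nat \<Rightarrow> 'b multiset \<Rightarrow> 'b multiset \<Rightarrow> 'b multiset \<Rightarrow> real" where
  "path_avg D 0 A Z c = D (c + Z)"
| "path_avg D (Suc n) A Z c =
     (D (c + Z) + (\<Sum>x\<in>#A. path_avg D n (A - {#x#}) Z (add_mset x c))
                + (\<Sum>z\<in>#Z. path_avg D n A (Z - {#z#}) c)) / (real n + 2)"

lemma sum_mset_bounds:
  fixes f :: "'b \<Rightarrow> real"
  assumes "\<And>x. x \<in># A \<Longrightarrow> l \<le> f x" "\<And>x. x \<in># A \<Longrightarrow> f x \<le> u"
  shows "real (size A) * l \<le> (\<Sum>x\<in>#A. f x)" "(\<Sum>x\<in>#A. f x) \<le> real (size A) * u"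
proof -
  have "real (size A) * l \<le> (\<Sum>x\<in>#A. f x) \<and> (\<Sum>x\<in>#A. f x) \<le> real (size A) * u"
    using assms
  proof (induction A)
    case (add x A)
    have "real (size A) * l \<le> (\<Sum>x\<in>#A. f x) \<and> (\<Sum>x\<in>#A. f x) \<le> real (size A) * u"
      by (rule add.IH) (simp_all add: add.prems)
    moreover have "l \<le> f x" "f x \<le> u" using add.prems by simp_all
    ultimately show ?case by (simp add: algebra_simps)
  qed simp
  then show "real (size A) * l \<le> (\<Sum>x\<in>#A. f x)" "(\<Sum>x\<in>#A. f x) \<le> real (size A) * u" by simp_all
qed

text \<open>There are \<open>n + 2\<close> equally weighted alternatives, hence a genuine average.\<close>

lemma path_avg_bounds:
  assumes D: "\<And>m. l \<le> D m" "\<And>m. D m \<le> u"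
  shows "size A + size Z = n \<Longrightarrow> l \<le> path_avg D n A Z c \<and> path_avg D n A Z c \<le> u"
proof (induction n arbitrary: A Z c)
  case (Suc n)
  have a: "l \<le> path_avg D n (A - {#x#}) Z (add_mset x c) \<and> path_avg D n (A - {#x#}) Z (add_mset x c) \<le> u"
    if "x \<in># A" for x
    by (rule Suc.IH) (use Suc.prems that in \<open>auto simp: size_Diff_singleton dest!: multi_member_split\<close>)
  have z: "l \<le> path_avg D n A (Z - {#z#}) c \<and> path_avg D n A (Z - {#z#}) c \<le> u"
    if "z \<in># Z" for z
    by (rule Suc.IH) (use Suc.prems that in \<open>auto simp: size_Diff_singleton dest!: multi_member_split\<close>)
  note b = sum_mset_bounds[of A l "\<lambda>x. path_avg D n (A - {#x#}) Z (add_mset x c)" u]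
    sum_mset_bounds[of Z l "\<lambda>z. path_avg D n A (Z - {#z#}) c" u]
  have s: "real n + 1 = real (size A) + real (size Z)" using Suc.prems by linarith
  have "(real n + 2) * l = l + real (size A) * l + real (size Z) * l"
    "(real n + 2) * u = u + real (size A) * u + real (size Z) * u"
    using arg_cong[OF s, of "\<lambda>t. t * l"] arg_cong[OF s, of "\<lambda>t. t * u"] by (simp_all add: algebra_simps)
  then show ?case
    using b a z D[of "c + Z"] by (simp add: field_simps)
qed (simp add: D)

lemma sum_mset_diff:
  fixes f g :: "'b \<Rightarrow> real"
  shows "(\<Sum>x\<in>#A. f x - g x) = (\<Sum>x\<in>#A. f x) - (\<Sum>x\<in>#A. g x)"
  by (induction A) auto

lemma path_avg_diff:
  "path_avg (\<lambda>m. D m - D' m) n A Z c = path_avg D n A Z c - path_avg D' n A Z c"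
proof (induction n arbitrary: A Z c)
  case (Suc n)
  show ?case by (simp add: Suc.IH sum_mset_diff diff_divide_distrib[symmetric] algebra_simps)
qed simp

text \<open>Ordered pairs of distinct elements, counted in either order.\<close>

lemma sum_mset_remove_swap:
  fixes f :: "'b \<Rightarrow> 'b \<Rightarrow> real"
  shows "(\<Sum>x\<in>#A. \<Sum>y\<in>#A - {#x#}. f x y) = (\<Sum>y\<in>#A. \<Sum>x\<in>#A - {#y#}. f x y)"
proof -
  have r: "(\<Sum>y\<in>#A - {#x#}. g y) = (\<Sum>y\<in>#A. g y) - g x" if "x \<in># A" for x and g :: "'b \<Rightarrow> real"
    using that by (auto dest!: multi_member_split)
  have "(\<Sum>x\<in>#A. \<Sum>y\<in>#A - {#x#}. f x y) = (\<Sum>x\<in>#A. (\<Sum>y\<in>#A. f x y) - f x x)"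
    by (intro arg_cong[where f = sum_mset] image_mset_cong) (simp add: r)
  also have "\<dots> = (\<Sum>x\<in>#A. \<Sum>y\<in>#A. f x y) - (\<Sum>x\<in>#A. f x x)" by (rule sum_mset_diff)
  also have "\<dots> = (\<Sum>y\<in>#A. \<Sum>x\<in>#A. f x y) - (\<Sum>x\<in>#A. f x x)"
    by (rule arg_cong[where f = "\<lambda>t. t - (\<Sum>x\<in>#A. f x x)"]) (rule sum_mset.swap)
  also have "\<dots> = (\<Sum>y\<in>#A. (\<Sum>x\<in>#A. f x y) - f y y)" by (rule sum_mset_diff[symmetric])
  also have "\<dots> = (\<Sum>y\<in>#A. \<Sum>x\<in>#A - {#y#}. f x y)"
    by (intro arg_cong[where f = sum_mset] image_mset_cong) (simp add: r)
  finally show ?thesis .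
qed

definition add_cost :: "('b multiset \<Rightarrow> real) \<Rightarrow> 'b \<Rightarrow> 'b multiset \<Rightarrow> real" where
  "add_cost h y m = h (add_mset y m) - h m"

lemma sum_mset_cong_real:
  fixes f g :: "'b \<Rightarrow> real"
  assumes "\<And>x. x \<in># A \<Longrightarrow> f x = g x"
  shows "(\<Sum>x\<in>#A. f x) = (\<Sum>x\<in>#A. g x)"
  using assms by (intro arg_cong[where f = sum_mset] image_mset_cong) auto

text \<open>Conditioning on the first operation turns the claim for \<open>(A, Z)\<close> into the claims for the
  configurations with one operation left out; what remains telescopes.\<close>

lemma path_avg_telescope:
  "size A + size Z = Suc n \<Longrightarrow>
    h (c + A) - h (c + Z) = (\<Sum>x\<in>#A. path_avg (add_cost h x) n (A - {#x#}) Z c)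
      - (\<Sum>z\<in>#Z. path_avg (add_cost h z) n A (Z - {#z#}) c)"
proof (induction n arbitrary: A Z c)
  case 0
  then consider x where "A = {#x#}" "Z = {#}" | z where "A = {#}" "Z = {#z#}"
    using size_1_singleton_mset[of A] size_1_singleton_mset[of Z]
    by (metis One_nat_def add_is_1 size_eq_0_iff_empty)
  then show ?case by cases (auto simp: add_cost_def)
next
  case (Suc n)
  define p where "p x A Z c = path_avg (add_cost h x) n A Z c" for x A Z c
  have step: "(real n + 2) * path_avg (add_cost h x) (Suc n) A Z c
      = add_cost h x (c + Z) + (\<Sum>x'\<in>#A. p x (A - {#x'#}) Z (add_mset x' c)) + (\<Sum>z\<in>#Z. p x A (Z - {#z#}) c)"
    for x A Z c by (simp add: p_def)
  have sz: "real (size A) + real (size Z) = real n + 2" using Suc.prems by linarith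
  have IHA: "h (c + A) - h (add_mset x' c + Z)
      = (\<Sum>x\<in>#A - {#x'#}. p x (A - {#x'#} - {#x#}) Z (add_mset x' c))
        - (\<Sum>z\<in>#Z. p z (A - {#x'#}) (Z - {#z#}) (add_mset x' c))" if xA: "x' \<in># A" for x'
  proof -
    obtain A' where A': "A = add_mset x' A'" using multi_member_split[OF xA] by blast
    then have "size (A - {#x'#}) + size Z = Suc n" "add_mset x' c + (A - {#x'#}) = c + A"
      using Suc.prems by simp_all
    with Suc.IH[of "A - {#x'#}" Z "add_mset x' c"] show ?thesis by (simp only: p_def)
  qed
  have IHZ: "h (c + A) - h (c + (Z - {#z#}))
      = (\<Sum>x\<in>#A. p x (A - {#x#}) (Z - {#z#}) c)
        - (\<Sum>z'\<in>#Z - {#z#}. p z' A (Z - {#z#} - {#z'#}) c)" if zZ: "z \<in># Z" for z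
  proof -
    obtain Z' where Z': "Z = add_mset z Z'" using multi_member_split[OF zZ] by blast
    then have "size A + size (Z - {#z#}) = Suc n" using Suc.prems by simp
    with Suc.IH[of A "Z - {#z#}" c] show ?thesis by (simp only: p_def)
  qed
  have LA: "(real n + 2) * (\<Sum>x\<in>#A. path_avg (add_cost h x) (Suc n) (A - {#x#}) Z c)
      = (\<Sum>x\<in>#A. add_cost h x (c + Z))
        + (\<Sum>x\<in>#A. \<Sum>x'\<in>#A - {#x#}. p x (A - {#x#} - {#x'#}) Z (add_mset x' c))
        + (\<Sum>x\<in>#A. \<Sum>z\<in>#Z. p x (A - {#x#}) (Z - {#z#}) c)"
    by (simp only: sum_mset_distrib_left step sum_mset.distrib)
  have LZ: "(real n + 2) * (\<Sum>z\<in>#Z. path_avg (add_cost h z) (Suc n) A (Z - {#z#}) c)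
      = (\<Sum>z\<in>#Z. add_cost h z (c + (Z - {#z#})))
        + (\<Sum>z\<in>#Z. \<Sum>x\<in>#A. p z (A - {#x#}) (Z - {#z#}) (add_mset x c))
        + (\<Sum>z\<in>#Z. \<Sum>z'\<in>#Z - {#z#}. p z A (Z - {#z#} - {#z'#}) c)"
    by (simp only: sum_mset_distrib_left step sum_mset.distrib)
  have swA: "(\<Sum>x\<in>#A. \<Sum>x'\<in>#A - {#x#}. p x (A - {#x#} - {#x'#}) Z (add_mset x' c))
      = (\<Sum>x'\<in>#A. \<Sum>x\<in>#A - {#x'#}. p x (A - {#x'#} - {#x#}) Z (add_mset x' c))"
    by (subst sum_mset_remove_swap) (simp only: diff_right_commute)
  have swZ: "(\<Sum>z\<in>#Z. \<Sum>z'\<in>#Z - {#z#}. p z A (Z - {#z#} - {#z'#}) c)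
      = (\<Sum>z'\<in>#Z. \<Sum>z\<in>#Z - {#z'#}. p z A (Z - {#z'#} - {#z#}) c)"
    by (subst sum_mset_remove_swap) (simp only: diff_right_commute)
  have sAZ: "(\<Sum>z\<in>#Z. \<Sum>x\<in>#A. p z (A - {#x#}) (Z - {#z#}) (add_mset x c))
      = (\<Sum>x\<in>#A. \<Sum>z\<in>#Z. p z (A - {#x#}) (Z - {#z#}) (add_mset x c))"
    by (rule sum_mset.swap)
  have sZA: "(\<Sum>x\<in>#A. \<Sum>z\<in>#Z. p x (A - {#x#}) (Z - {#z#}) c)
      = (\<Sum>z\<in>#Z. \<Sum>x\<in>#A. p x (A - {#x#}) (Z - {#z#}) c)"
    by (rule sum_mset.swap)
  have "(\<Sum>x\<in>#A. add_cost h x (c + Z)) + (\<Sum>x'\<in>#A. h (c + A) - h (add_mset x' c + Z))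
      = (\<Sum>x\<in>#A. h (c + A) - h (c + Z))"
    unfolding sum_mset.distrib[symmetric] by (intro sum_mset_cong_real) (simp add: add_cost_def)
  then have 1: "(\<Sum>x\<in>#A. add_cost h x (c + Z)) + (\<Sum>x'\<in>#A. h (c + A) - h (add_mset x' c + Z))
      = real (size A) * (h (c + A) - h (c + Z))" by simp
  have "(\<Sum>z\<in>#Z. h (c + A) - h (c + (Z - {#z#}))) - (\<Sum>z\<in>#Z. add_cost h z (c + (Z - {#z#})))
      = (\<Sum>z\<in>#Z. h (c + A) - h (c + Z))"
    unfolding sum_mset_diff[symmetric] by (intro sum_mset_cong_real) (auto simp: add_cost_def dest!: multi_member_split)
  then have 2: "(\<Sum>z\<in>#Z. h (c + A) - h (c + (Z - {#z#}))) - (\<Sum>z\<in>#Z. add_cost h z (c + (Z - {#z#})))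
      = real (size Z) * (h (c + A) - h (c + Z))" by simp
  have 3: "(\<Sum>x'\<in>#A. h (c + A) - h (add_mset x' c + Z))
      = (\<Sum>x'\<in>#A. \<Sum>x\<in>#A - {#x'#}. p x (A - {#x'#} - {#x#}) Z (add_mset x' c))
        - (\<Sum>x\<in>#A. \<Sum>z\<in>#Z. p z (A - {#x#}) (Z - {#z#}) (add_mset x c))"
    unfolding sum_mset_diff[symmetric] by (intro sum_mset_cong_real IHA)
  have 4: "(\<Sum>z\<in>#Z. h (c + A) - h (c + (Z - {#z#})))
      = (\<Sum>z\<in>#Z. \<Sum>x\<in>#A. p x (A - {#x#}) (Z - {#z#}) c)
        - (\<Sum>z'\<in>#Z. \<Sum>z\<in>#Z - {#z'#}. p z A (Z - {#z'#} - {#z#}) c)"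
    unfolding sum_mset_diff[symmetric] by (intro sum_mset_cong_real IHZ)
  have "(real n + 2) * ((\<Sum>x\<in>#A. path_avg (add_cost h x) (Suc n) (A - {#x#}) Z c)
      - (\<Sum>z\<in>#Z. path_avg (add_cost h z) (Suc n) A (Z - {#z#}) c))
      = (real (size A) + real (size Z)) * (h (c + A) - h (c + Z))"
    using 1 2 3 4 LA LZ unfolding swA swZ sAZ sZA right_diff_distrib distrib_right by linarith
  then show ?case unfolding sz by simp
qed

lemma measurable_path_avg:
  fixes h :: "'b::{second_countable_topology, t2_space} multiset \<Rightarrow> real"
  assumes h: "h \<in> borel_measurable MS"
  shows "(\<lambda>q. path_avg (add_cost h (fst q)) n (fst (snd q)) (fst (snd (snd q))) (snd (snd (snd q))))
    \<in> borel_measurable (borel \<Otimes>\<^sub>M (MS \<Otimes>\<^sub>M (MS \<Otimes>\<^sub>M MS)))"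
proof (induction n)
  let ?\<Omega> = "(borel :: 'b measure) \<Otimes>\<^sub>M ((MS :: 'b multiset measure) \<Otimes>\<^sub>M ((MS :: 'b multiset measure) \<Otimes>\<^sub>M (MS :: 'b multiset measure)))"
  have y: "(\<lambda>q. fst q) \<in> ?\<Omega> \<rightarrow>\<^sub>M borel" by (rule measurable_fst)
  have A: "(\<lambda>q. fst (snd q)) \<in> ?\<Omega> \<rightarrow>\<^sub>M MS" by (rule measurable_compose[OF measurable_snd measurable_fst])
  have Z: "(\<lambda>q. fst (snd (snd q))) \<in> ?\<Omega> \<rightarrow>\<^sub>M MS"
    by (rule measurable_compose[OF measurable_snd measurable_compose[OF measurable_snd measurable_fst]])
  have c: "(\<lambda>q. snd (snd (snd q))) \<in> ?\<Omega> \<rightarrow>\<^sub>M MS"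
    by (rule measurable_compose[OF measurable_snd measurable_compose[OF measurable_snd measurable_snd]])
  note cZ = measurable_mset_add[OF c Z]
  have D: "(\<lambda>q. add_cost h (fst q) (snd (snd (snd q)) + fst (snd (snd q)))) \<in> borel_measurable ?\<Omega>"
    unfolding add_cost_def
    by (rule borel_measurable_diff[OF measurable_compose[OF measurable_mset_add_mset[OF y cZ] h] measurable_compose[OF cZ h]])
  {
    case 0
    show ?case using D by (simp only: path_avg.simps)
  next
    case (Suc n)
    note s = measurable_snd[of "borel :: 'b measure" ?\<Omega>]
    note y' = measurable_compose[OF s y] and A' = measurable_compose[OF s A]
      and Z' = measurable_compose[OF s Z] and c' = measurable_compose[OF s c]
      and x' = measurable_fst[of "borel :: 'b measure" ?\<Omega>]
    have 1: "(\<lambda>q. \<Sum>x\<in>#fst (snd q). path_avg (add_cost h (fst q)) n (fst (snd q) - {#x#}) (fst (snd (snd q)))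
        (add_mset x (snd (snd (snd q))))) \<in> borel_measurable ?\<Omega>"
      using measurable_sum_mset[OF A measurable_compose[OF measurable_Pair[OF y' measurable_Pair[OF
          measurable_mset_remove1[OF x' A'] measurable_Pair[OF Z' measurable_mset_add_mset[OF x' c']]]] Suc.IH]]
      by (simp only: fst_conv snd_conv)
    have 2: "(\<lambda>q. \<Sum>z\<in>#fst (snd (snd q)). path_avg (add_cost h (fst q)) n (fst (snd q)) (fst (snd (snd q)) - {#z#})
        (snd (snd (snd q)))) \<in> borel_measurable ?\<Omega>"
      using measurable_sum_mset[OF Z measurable_compose[OF measurable_Pair[OF y' measurable_Pair[OF
          A' measurable_Pair[OF measurable_mset_remove1[OF x' Z'] c']]] Suc.IH]]
      by (simp only: fst_conv snd_conv)
    show ?case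
      unfolding path_avg.simps
      by (intro borel_measurable_divide borel_measurable_add D 1 2 borel_measurable_const)
  }
qed

definition stein_pair :: "('b multiset \<Rightarrow> real) \<Rightarrow> 'b \<Rightarrow> 'b multiset \<Rightarrow> 'b multiset \<Rightarrow> real" where
  "stein_pair h y A Z = path_avg (add_cost h y) (size A + size Z) A Z {#}"

lemma stein_pair_identity:
  "h A - h Z = (\<Sum>x\<in>#A. stein_pair h x (A - {#x#}) Z) - (\<Sum>z\<in>#Z. stein_pair h z A (Z - {#z#}))"
proof (cases "size A + size Z")
  case 0
  then show ?thesis by simp
next
  case (Suc n)
  have "stein_pair h x (A - {#x#}) Z = path_avg (add_cost h x) n (A - {#x#}) Z {#}" if "x \<in># A" for x
    using Suc multi_member_split[OF that] by (auto simp: stein_pair_def)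
  moreover have "stein_pair h z A (Z - {#z#}) = path_avg (add_cost h z) n A (Z - {#z#}) {#}" if "z \<in># Z" for z
    using Suc multi_member_split[OF that] by (auto simp: stein_pair_def)
  ultimately show ?thesis
    using path_avg_telescope[OF Suc, of h "{#}"] by (simp cong: sum_mset_cong_real image_mset_cong)
qed

text \<open>\<open>path_avg\<close> averages the cost of inserting \<open>y\<close>; for two points the costs are averaged along the same
  random path, hence differ by a mean of \<open>h (m + \<delta>\<^sub>y) - h (m + \<delta>\<^sub>z)\<close>.\<close>

lemma stein_pair_bounds:
  assumes "\<And>y m. \<bar>h (add_mset y m) - h m\<bar> \<le> 1" and "\<And>y z m. \<bar>h (add_mset y m) - h (add_mset z m)\<bar> \<le> 1"
  shows "\<bar>stein_pair h y A Z\<bar> \<le> 1" and "\<bar>stein_pair h y A Z - stein_pair h z A Z\<bar> \<le> 1"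
proof -
  have "-1 \<le> add_cost h y m" "add_cost h y m \<le> 1" for m
    using assms(1)[of y m] by (auto simp: add_cost_def)
  from path_avg_bounds[where D = "add_cost h y", OF this refl] show "\<bar>stein_pair h y A Z\<bar> \<le> 1"
    by (auto simp: stein_pair_def abs_le_iff minus_le_iff)
  have "-1 \<le> add_cost h y m - add_cost h z m" "add_cost h y m - add_cost h z m \<le> 1" for m
    using assms(2)[of y m z] by (auto simp: add_cost_def)
  from path_avg_bounds[where D = "\<lambda>m. add_cost h y m - add_cost h z m", OF this refl, of A Z "{#}"]
  have "-1 \<le> stein_pair h y A Z - stein_pair h z A Z \<and> stein_pair h y A Z - stein_pair h z A Z \<le> 1"
    by (simp only: stein_pair_def path_avg_diff)
  then show "\<bar>stein_pair h y A Z - stein_pair h z A Z\<bar> \<le> 1" by linarith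
qed

lemma measurable_stein_pair:
  fixes h :: "'b::{second_countable_topology, t2_space} multiset \<Rightarrow> real"
  assumes h: "h \<in> borel_measurable MS"
    and y: "y \<in> borel_measurable \<Omega>" and A: "A \<in> \<Omega> \<rightarrow>\<^sub>M MS" and Z: "Z \<in> \<Omega> \<rightarrow>\<^sub>M MS"
  shows "(\<lambda>w. stein_pair h (y w) (A w) (Z w)) \<in> borel_measurable \<Omega>"
proof -
  have "(\<lambda>w. size (A w) + size (Z w)) \<in> \<Omega> \<rightarrow>\<^sub>M count_space UNIV"
    using measurable_mset_size[OF measurable_mset_add[OF A Z]] by simp
  moreover have "(\<lambda>w. path_avg (add_cost h (y w)) n (A w) (Z w) {#}) \<in> borel_measurable \<Omega>" for n
  proof -
    have e: "(\<lambda>_. {#}) \<in> \<Omega> \<rightarrow>\<^sub>M (MS :: 'b multiset measure)" by (rule measurable_const) simp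
    from measurable_compose[OF measurable_Pair[OF y measurable_Pair[OF A measurable_Pair[OF Z e]]] measurable_path_avg[OF h]]
    show ?thesis by (simp only: fst_conv snd_conv)
  qed
  ultimately show ?thesis unfolding stein_pair_def by (rule measurable_compose_countable[rotated])
qed

section \<open>The Stein equation\<close>

lemma loc_counting_trivial:
  "loc_counting (trivial_partition :: nat \<Rightarrow> 'b::topological_space set) = finite_counting_measures"
proof (intro set_eqI iffI)
  fix \<omega> :: "'b measure" assume \<omega>: "\<omega> \<in> loc_counting trivial_partition"
  then have c: "\<omega> \<in> counting_measures" and fin: "emeasure \<omega> (trivial_partition 0) \<noteq> \<infinity>"
    by (simp_all add: loc_counting_def)
  have "finite_measure \<omega>"
    by (rule finite_measureI) (use fin in \<open>simp add: counting_measuresD(2)[OF c] trivial_partition_def\<close>)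
  with c show "\<omega> \<in> finite_counting_measures" by (simp add: finite_counting_measures_def)
next
  fix \<omega> :: "'b measure" assume \<omega>: "\<omega> \<in> finite_counting_measures"
  then show "\<omega> \<in> loc_counting trivial_partition"
    using finite_counting_measuresD[OF \<omega>] by (simp add: loc_counting_def)
qed

lemma mset_measure_add_point:
  "add_point (mset_measure m) x = mset_measure (add_mset x m)"
proof (rule measure_eqI)
  show "sets (add_point (mset_measure m) x) = sets (mset_measure (add_mset x m))"
    by (simp add: sets_add_point)
  fix A assume "A \<in> sets (add_point (mset_measure m) x)"
  then have "A \<in> sets borel" by (simp add: sets_add_point)
  then show "emeasure (add_point (mset_measure m) x) A = emeasure (mset_measure (add_mset x m)) A"
    by (simp add: emeasure_add_point emeasure_mset_measure indicator_def)
qed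

lemma finite_poisson_mset:
  fixes M :: "'b::{second_countable_topology, t2_space} measure"
  assumes pp: "poisson_process R M \<zeta>" and sets_M: "sets M = sets borel" and M: "finite_measure M"
  shows "\<exists>Z \<in> R \<rightarrow>\<^sub>M MS. (AE w in R. \<zeta> w = mset_measure (Z w)) \<and>
    (\<forall>F\<in>borel_measurable (borel \<Otimes>\<^sub>M MS).
      (\<integral>\<^sup>+w. (\<Sum>x\<in>#Z w. F (x, Z w)) \<partial>R) = (\<integral>\<^sup>+x. \<integral>\<^sup>+w. F (x, add_mset x (Z w)) \<partial>R \<partial>M))"
proof -
  have sM: "sigma_finite_measure M" by (rule finite_measure.sigma_finite_measure[OF M])
  have KB: "emeasure M (trivial_partition n) < \<infinity>" for n
    using finite_measure.emeasure_finite[OF M] by (simp add: less_top)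
  note T = partition_trivial[where 'b='b]
  obtain \<eta>0 where \<eta>0: "\<eta>0 \<in> R \<rightarrow>\<^sub>M N_loc trivial_partition" and ae: "AE w in R. \<zeta> w = \<eta>0 w"
    using poisson_loc_version[OF pp sets_M T KB] by blast
  have mm: "measure_mset \<in> N_loc trivial_partition \<rightarrow>\<^sub>M (MS :: 'b multiset measure)"
    using measurable_measure_mset[where 'b='b] by (simp only: loc_counting_trivial)
  define Z where "Z w = measure_mset (\<eta>0 w)" for w
  have Z: "Z \<in> R \<rightarrow>\<^sub>M MS" unfolding Z_def[abs_def] by (rule measurable_compose[OF \<eta>0 mm])
  have eq: "mset_measure (Z w) = \<eta>0 w" if "w \<in> space R" for w
    unfolding Z_def using measurable_space[OF \<eta>0 that]
    by (intro mset_measure_measure_mset) (simp add: loc_counting_trivial)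
  have ae': "AE w in R. \<zeta> w = mset_measure (Z w)"
    by (rule AE_mp[OF ae]) (rule AE_I2, simp add: eq)
  have "(\<integral>\<^sup>+w. (\<Sum>x\<in>#Z w. F (x, Z w)) \<partial>R) = (\<integral>\<^sup>+x. \<integral>\<^sup>+w. F (x, add_mset x (Z w)) \<partial>R \<partial>M)"
    if F: "F \<in> borel_measurable (borel \<Otimes>\<^sub>M MS)" for F :: "'b \<times> 'b multiset \<Rightarrow> ennreal"
  proof -
    define F' where "F' p = F (fst p, measure_mset (snd p))" for p
    have F': "F' \<in> borel_measurable (borel \<Otimes>\<^sub>M N_loc trivial_partition)"
      unfolding F'_def[abs_def]
      by (rule measurable_compose[OF measurable_Pair[OF measurable_fst measurable_compose[OF measurable_snd mm]] F])
    have "(\<integral>\<^sup>+w. (\<Sum>x\<in>#Z w. F (x, Z w)) \<partial>R) = (\<integral>\<^sup>+w. \<integral>\<^sup>+x. F' (x, \<eta>0 w) \<partial>\<eta>0 w \<partial>R)"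
    proof (rule nn_integral_cong)
      fix w assume w: "w \<in> space R"
      have "Z w \<in> space MS" by simp
      from nn_integral_mset_measure[OF measurable_compose[OF measurable_Pair2'[OF this] F]]
      have "(\<Sum>x\<in>#Z w. F (x, Z w)) = (\<integral>\<^sup>+x. F (x, Z w) \<partial>mset_measure (Z w))" by simp
      then show "(\<Sum>x\<in>#Z w. F (x, Z w)) = (\<integral>\<^sup>+x. F' (x, \<eta>0 w) \<partial>\<eta>0 w)"
        unfolding eq[OF w] by (simp only: F'_def fst_conv snd_conv Z_def)
    qed
    also have "\<dots> = (\<integral>\<^sup>+x. \<integral>\<^sup>+w. F' (x, add_point (\<eta>0 w) x) \<partial>R \<partial>M)"
      by (rule mecke[OF pp sets_M sM T KB \<eta>0 ae F'])
    also have "\<dots> = (\<integral>\<^sup>+x. \<integral>\<^sup>+w. F (x, add_mset x (Z w)) \<partial>R \<partial>M)"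
      by (intro nn_integral_cong)
         (simp only: F'_def fst_conv snd_conv eq[symmetric] mset_measure_add_point measure_mset_mset_measure)
    finally show ?thesis .
  qed
  then show ?thesis using Z ae' by blast
qed

lemma sum_mset_ennreal:
  assumes "\<And>x. 0 \<le> u x"
  shows "(\<Sum>x\<in>#m. ennreal (u x)) = ennreal (\<Sum>x\<in>#m. u x)" "0 \<le> (\<Sum>x\<in>#m. u x)"
proof -
  have "(\<Sum>x\<in>#m. ennreal (u x)) = ennreal (\<Sum>x\<in>#m. u x) \<and> 0 \<le> (\<Sum>x\<in>#m. u x)"
    using assms by (induction m) auto
  then show "(\<Sum>x\<in>#m. ennreal (u x)) = ennreal (\<Sum>x\<in>#m. u x)" "0 \<le> (\<Sum>x\<in>#m. u x)" by simp_all
qed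

lemma integral_sum_mset:
  fixes f :: "'b \<Rightarrow> 'w \<Rightarrow> real"
  assumes "\<And>x. integrable R (f x)"
  shows "integrable R (\<lambda>w. \<Sum>x\<in>#A. f x w)" "(LINT w|R. (\<Sum>x\<in>#A. f x w)) = (\<Sum>x\<in>#A. LINT w|R. f x w)"
proof -
  have "integrable R (\<lambda>w. \<Sum>x\<in>#A. f x w) \<and> (LINT w|R. (\<Sum>x\<in>#A. f x w)) = (\<Sum>x\<in>#A. LINT w|R. f x w)"
    using assms by (induction A) auto
  then show "integrable R (\<lambda>w. \<Sum>x\<in>#A. f x w)" "(LINT w|R. (\<Sum>x\<in>#A. f x w)) = (\<Sum>x\<in>#A. LINT w|R. f x w)"
    by simp_all
qed

lemma prob_integral_abs_le_1:
  fixes f :: "'w \<Rightarrow> real"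
  assumes R: "prob_space R" and f: "f \<in> borel_measurable R" and b: "\<And>w. \<bar>f w\<bar> \<le> 1"
  shows "integrable R f" "\<bar>LINT w|R. f w\<bar> \<le> 1"
proof -
  interpret prob_space R by fact
  show i: "integrable R f" using f b by (intro integrable_const_bound[of _ 1]) auto
  have "\<bar>LINT w|R. f w\<bar> \<le> (LINT w|R. \<bar>f w\<bar>)" by (rule integral_abs_bound)
  also have "\<dots> \<le> (LINT w|R. 1)" using i b by (intro integral_mono) auto
  finally show "\<bar>LINT w|R. f w\<bar> \<le> 1" by (simp add: prob_space)
qed

context
  fixes R :: "'r measure" and M :: "'b::{second_countable_topology, t2_space} measure" and Z :: "'r \<Rightarrow> 'b multiset"
  assumes R: "prob_space R" and sets_M: "sets M = sets borel" and M: "finite_measure M"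
    and Z: "Z \<in> R \<rightarrow>\<^sub>M MS"
    and mecke_Z: "\<forall>F\<in>borel_measurable (borel \<Otimes>\<^sub>M MS).
      (\<integral>\<^sup>+w. (\<Sum>x\<in>#Z w. F (x, Z w)) \<partial>R) = (\<integral>\<^sup>+x. \<integral>\<^sup>+w. F (x, add_mset x (Z w)) \<partial>R \<partial>M)"
begin

interpretation R: prob_space R by (rule R)
interpretation M: finite_measure M by (rule M)

lemma measurable_Z_pair:
  fixes u :: "'b \<times> 'b multiset \<Rightarrow> real"
  assumes u: "u \<in> borel_measurable (borel \<Otimes>\<^sub>M MS)"
  shows "(\<lambda>w. u (x, Z w)) \<in> borel_measurable R" "(\<lambda>x. LINT w|R. u (x, Z w)) \<in> borel_measurable M"
proof -
  have "(\<lambda>p. u (fst p, Z (snd p))) \<in> borel_measurable (M \<Otimes>\<^sub>M R)"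
  proof -
    have "fst \<in> M \<Otimes>\<^sub>M R \<rightarrow>\<^sub>M borel"
      using measurable_fst[of M R] by (simp only: measurable_cong_sets[OF refl sets_M])
    from measurable_compose[OF measurable_Pair[OF this measurable_compose[OF measurable_snd Z]] u] show ?thesis .
  qed
  then show "(\<lambda>x. LINT w|R. u (x, Z w)) \<in> borel_measurable M"
    by (intro R.borel_measurable_lebesgue_integral) (simp only: case_prod_beta')
  show "(\<lambda>w. u (x, Z w)) \<in> borel_measurable R"
    by (rule measurable_compose[OF measurable_Pair[OF measurable_const Z] u]) simp
qed

text \<open>The Mecke formula for the function \<open>(x, Z) \<mapsto> v (x, Z - {#x#})\<close>: once \<open>x\<close> has been added, the removal gives
  back \<open>Z\<close>.\<close>

lemma mecke_mset_nonneg: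
  fixes v :: "'b \<times> 'b multiset \<Rightarrow> real"
  assumes v: "v \<in> borel_measurable (borel \<Otimes>\<^sub>M MS)" and b: "\<And>p. 0 \<le> v p" "\<And>p. v p \<le> 2"
  shows "integrable R (\<lambda>w. \<Sum>x\<in>#Z w. v (x, Z w - {#x#}))"
    and "(LINT w|R. (\<Sum>x\<in>#Z w. v (x, Z w - {#x#}))) = (LINT x|M. LINT w|R. v (x, Z w))"
proof -
  define F where "F p = ennreal (v (fst p, snd p - {#fst p#}))" for p
  have vr: "(\<lambda>p. v (fst p, snd p - {#fst p#})) \<in> borel_measurable (borel \<Otimes>\<^sub>M MS)"
    by (rule measurable_compose[OF measurable_Pair[OF measurable_fst measurable_mset_remove1[OF measurable_fst measurable_snd]] v])
  have F: "F \<in> borel_measurable (borel \<Otimes>\<^sub>M MS)"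
    unfolding F_def[abs_def] by (rule measurable_compose[OF vr measurable_ennreal])
  have int_v: "integrable R (\<lambda>w. v (x, Z w))" for x
    using b measurable_Z_pair(1)[OF v] by (intro R.integrable_const_bound[of _ 2]) auto
  have nn: "0 \<le> (LINT w|R. v (x, Z w))" for x using b by (intro integral_nonneg_AE) auto
  have le2: "(LINT w|R. v (x, Z w)) \<le> 2" for x
  proof -
    have "(LINT w|R. v (x, Z w)) \<le> (LINT w|R. 2)" using int_v b by (intro integral_mono) auto
    then show ?thesis by (simp add: R.prob_space)
  qed
  have m: "(\<lambda>w. \<Sum>x\<in>#Z w. v (x, Z w - {#x#})) \<in> borel_measurable R"
  proof -
    have "(\<lambda>p. (fst p, Z (snd p))) \<in> borel \<Otimes>\<^sub>M R \<rightarrow>\<^sub>M borel \<Otimes>\<^sub>M MS"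
      by (rule measurable_Pair[OF measurable_fst measurable_compose[OF measurable_snd Z]])
    from measurable_sum_mset[OF Z measurable_compose[OF this vr]] show ?thesis by (simp only: fst_conv snd_conv)
  qed
  have int_M: "integrable M (\<lambda>x. LINT w|R. v (x, Z w))"
    using nn le2 measurable_Z_pair(2)[OF v] by (intro M.integrable_const_bound[of _ 2]) auto
  have "(\<integral>\<^sup>+w. ennreal (\<Sum>x\<in>#Z w. v (x, Z w - {#x#})) \<partial>R) = (\<integral>\<^sup>+w. (\<Sum>x\<in>#Z w. F (x, Z w)) \<partial>R)"
    by (intro nn_integral_cong) (simp only: F_def fst_conv snd_conv sum_mset_ennreal(1)[OF b(1)])
  also have "\<dots> = (\<integral>\<^sup>+x. \<integral>\<^sup>+w. F (x, add_mset x (Z w)) \<partial>R \<partial>M)"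
    using mecke_Z F by blast
  also have "\<dots> = (\<integral>\<^sup>+x. ennreal (LINT w|R. v (x, Z w)) \<partial>M)"
    using nn_integral_eq_integral[OF int_v] b(1) by (intro nn_integral_cong) (simp add: F_def)
  also have "\<dots> = ennreal (LINT x|M. LINT w|R. v (x, Z w))"
    using nn by (intro nn_integral_eq_integral[OF int_M]) auto
  finally have eq: "(\<integral>\<^sup>+w. ennreal (\<Sum>x\<in>#Z w. v (x, Z w - {#x#})) \<partial>R) = ennreal (LINT x|M. LINT w|R. v (x, Z w))" .
  have nnS: "0 \<le> (\<Sum>x\<in>#Z w. v (x, Z w - {#x#}))" for w by (rule sum_mset_ennreal(2)) (rule b(1))
  show "integrable R (\<lambda>w. \<Sum>x\<in>#Z w. v (x, Z w - {#x#}))"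
    using m nnS eq by (intro integrableI_nonneg) auto
  have "(LINT w|R. (\<Sum>x\<in>#Z w. v (x, Z w - {#x#}))) = enn2real (\<integral>\<^sup>+w. ennreal (\<Sum>x\<in>#Z w. v (x, Z w - {#x#})) \<partial>R)"
    using m nnS by (intro integral_eq_nn_integral) auto
  also have "\<dots> = (LINT x|M. LINT w|R. v (x, Z w))"
    unfolding eq using nn by (intro enn2real_ennreal integral_nonneg_AE) auto
  finally show "(LINT w|R. (\<Sum>x\<in>#Z w. v (x, Z w - {#x#}))) = (LINT x|M. LINT w|R. v (x, Z w))" .
qed

text \<open>Adding the constant \<open>1\<close> makes the integrand nonnegative; the constant contributes the mean number of
  points on both sides.\<close>

lemma mecke_mset_real:
  fixes u :: "'b \<times> 'b multiset \<Rightarrow> real"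
  assumes u: "u \<in> borel_measurable (borel \<Otimes>\<^sub>M MS)" and b: "\<And>p. \<bar>u p\<bar> \<le> 1"
  shows "integrable R (\<lambda>w. \<Sum>x\<in>#Z w. u (x, Z w - {#x#}))"
    and "(LINT w|R. (\<Sum>x\<in>#Z w. u (x, Z w - {#x#}))) = (LINT x|M. LINT w|R. u (x, Z w))"
proof -
  have b': "0 \<le> u p + 1" "u p + 1 \<le> 2" for p using b[of p] by linarith+
  have u1: "(\<lambda>p. u p + 1) \<in> borel_measurable (borel \<Otimes>\<^sub>M MS)"
    by (intro borel_measurable_add u borel_measurable_const)
  note V = mecke_mset_nonneg[OF u1 b']
  note I = mecke_mset_nonneg[of "\<lambda>_. 1", simplified]
  have split: "(\<Sum>x\<in>#Z w. u (x, Z w - {#x#})) = (\<Sum>x\<in>#Z w. u (x, Z w - {#x#}) + 1) - real (size (Z w))" for w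
    by (simp add: sum_mset.distrib)
  have iu: "integrable R (\<lambda>w. u (x, Z w))" for x
    by (rule prob_integral_abs_le_1(1)[OF R measurable_Z_pair(1)[OF u] b])
  have iu': "integrable M (\<lambda>x. LINT w|R. u (x, Z w))"
    using prob_integral_abs_le_1(2)[OF R measurable_Z_pair(1)[OF u] b] measurable_Z_pair(2)[OF u]
    by (intro M.integrable_const_bound[of _ 1]) auto
  show "integrable R (\<lambda>w. \<Sum>x\<in>#Z w. u (x, Z w - {#x#}))"
    unfolding split by (rule Bochner_Integration.integrable_diff[OF V(1) I(1)])
  have "(LINT w|R. (\<Sum>x\<in>#Z w. u (x, Z w - {#x#})))
      = (LINT w|R. (\<Sum>x\<in>#Z w. u (x, Z w - {#x#}) + 1)) - (LINT w|R. real (size (Z w)))"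
    unfolding split by (rule Bochner_Integration.integral_diff[OF V(1) I(1)])
  also have "\<dots> = (LINT x|M. (LINT w|R. u (x, Z w)) + 1) - (LINT x|M. 1)"
    unfolding V(2) I(2) using iu by (simp add: R.prob_space)
  also have "\<dots> = (LINT x|M. LINT w|R. u (x, Z w))"
    using iu' by (subst Bochner_Integration.integral_add) auto
  finally show "(LINT w|R. (\<Sum>x\<in>#Z w. u (x, Z w - {#x#}))) = (LINT x|M. LINT w|R. u (x, Z w))" .
qed

definition stein_sol :: "('b multiset \<Rightarrow> real) \<Rightarrow> 'b \<Rightarrow> 'b multiset \<Rightarrow> real" where
  "stein_sol h y A = (LINT w|R. stein_pair h y A (Z w))"

text \<open>Averaging the path identity over \<open>Z\<close>: the sum over the points of \<open>A\<close> is linear in the average, the sum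
  over the points of \<open>Z\<close> is evaluated by the Mecke formula.\<close>

lemma stein_sol:
  fixes h :: "'b multiset \<Rightarrow> real"
  assumes h: "h \<in> borel_measurable MS"
    and h1: "\<And>y m. \<bar>h (add_mset y m) - h m\<bar> \<le> 1"
    and h2: "\<And>y z m. \<bar>h (add_mset y m) - h (add_mset z m)\<bar> \<le> 1"
  shows "(\<lambda>p. stein_sol h (fst p) (snd p)) \<in> borel_measurable (borel \<Otimes>\<^sub>M MS)"
    and "\<bar>stein_sol h y A\<bar> \<le> 1"
    and "\<bar>stein_sol h y A - stein_sol h z A\<bar> \<le> 1"
    and "h A - (LINT w|R. h (Z w)) = (\<Sum>x\<in>#A. stein_sol h x (A - {#x#})) - (LINT y|M. stein_sol h y A)"
proof -
  note b = stein_pair_bounds[OF h1 h2]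
  have m: "(\<lambda>w. stein_pair h y A (Z w)) \<in> borel_measurable R" for y A
    by (rule measurable_stein_pair[OF h measurable_const measurable_const Z]) simp_all
  have i: "integrable R (\<lambda>w. stein_pair h y A (Z w))" for y A
    by (rule prob_integral_abs_le_1(1)[OF R m b(1)])
  show "(\<lambda>p. stein_sol h (fst p) (snd p)) \<in> borel_measurable (borel \<Otimes>\<^sub>M MS)"
    unfolding stein_sol_def
  proof (rule R.borel_measurable_lebesgue_integral)
    have "(\<lambda>p. stein_pair h (fst (fst p)) (snd (fst p)) (Z (snd p))) \<in> borel_measurable ((borel \<Otimes>\<^sub>M MS) \<Otimes>\<^sub>M R)"
      by (rule measurable_stein_pair[OF h measurable_compose[OF measurable_fst measurable_fst]
            measurable_compose[OF measurable_fst measurable_snd] measurable_compose[OF measurable_snd Z]])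
    then show "(\<lambda>(p, w). stein_pair h (fst p) (snd p) (Z w)) \<in> borel_measurable ((borel \<Otimes>\<^sub>M MS) \<Otimes>\<^sub>M R)"
      by (simp only: case_prod_beta')
  qed
  show "\<bar>stein_sol h y A\<bar> \<le> 1"
    unfolding stein_sol_def by (rule prob_integral_abs_le_1(2)[OF R m b(1)])
  have "\<bar>LINT w|R. stein_pair h y A (Z w) - stein_pair h z A (Z w)\<bar> \<le> 1"
    by (rule prob_integral_abs_le_1(2)[OF R borel_measurable_diff[OF m m] b(2)])
  then show "\<bar>stein_sol h y A - stein_sol h z A\<bar> \<le> 1"
    unfolding stein_sol_def by (simp add: i)
  define S where "S w = (\<Sum>z\<in>#Z w. stein_pair h z A (Z w - {#z#}))" for w
  have uA: "(\<lambda>p. stein_pair h (fst p) A (snd p)) \<in> borel_measurable (borel \<Otimes>\<^sub>M MS)"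
    by (rule measurable_stein_pair[OF h measurable_fst measurable_const measurable_snd]) simp
  have S: "integrable R S" "(LINT w|R. S w) = (LINT y|M. stein_sol h y A)"
    using mecke_mset_real[OF uA b(1)] by (simp_all only: S_def[abs_def] stein_sol_def fst_conv snd_conv)
  define T where "T w = (\<Sum>x\<in>#A. stein_pair h x (A - {#x#}) (Z w))" for w
  have T: "integrable R T" "(LINT w|R. T w) = (\<Sum>x\<in>#A. stein_sol h x (A - {#x#}))"
    unfolding T_def stein_sol_def by (intro integral_sum_mset i)+
  have "h (Z w) = h A - (T w - S w)" for w
    using stein_pair_identity[of h A "Z w"] by (simp add: T_def S_def)
  then have "(LINT w|R. h (Z w)) = (LINT w|R. h A - (T w - S w))" by simp
  also have "\<dots> = h A - ((LINT w|R. T w) - (LINT w|R. S w))"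
    using S(1) T(1) by (simp add: R.prob_space)
  finally show "h A - (LINT w|R. h (Z w)) = (\<Sum>x\<in>#A. stein_sol h x (A - {#x#})) - (LINT y|M. stein_sol h y A)"
    unfolding S(2) T(2) by simp
qed

end

section \<open>Total variation and integrals\<close>

lemma integral_dominated_on:
  fixes f :: "'b \<Rightarrow> real"
  assumes N: "finite_measure N1" "finite_measure N2" and s: "sets N1 = sets N2" and X: "X \<in> sets N2"
    and le: "\<And>A. A \<in> sets N2 \<Longrightarrow> A \<subseteq> X \<Longrightarrow> emeasure N1 A \<le> emeasure N2 A"
    and f: "f \<in> borel_measurable N2" and fb: "\<And>y. 0 \<le> f y" "\<And>y. f y \<le> 1"
  shows "(LINT y|N1. f y * indicator X y) \<le> (LINT y|N2. f y * indicator X y)"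
proof -
  have bm: "borel_measurable N1 = borel_measurable N2" by (rule measurable_cong_sets[OF s refl])
  have X1: "X \<in> sets N1" using X s by simp
  have dens: "emeasure (density N (indicator X)) A = emeasure N (X \<inter> A)" if "sets N = sets N2" "A \<in> sets N2" for N A
  proof -
    have "emeasure (density N (indicator X)) A = (\<integral>\<^sup>+y. indicator X y * indicator A y \<partial>N)"
      using that X by (intro emeasure_density borel_measurable_indicator) simp_all
    also have "\<dots> = (\<integral>\<^sup>+y. indicator (X \<inter> A) y \<partial>N)"
      by (intro nn_integral_cong) (simp add: indicator_inter_arith)
    also have "\<dots> = emeasure N (X \<inter> A)"
      using that X by (intro nn_integral_indicator) simp
    finally show ?thesis .
  qed
  have "density N1 (indicator X) \<le> density N2 (indicator X)"
    using s dens X by (subst le_measure) (auto intro!: le)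
  then have nn: "(\<integral>\<^sup>+y. u y * indicator X y \<partial>N1) \<le> (\<integral>\<^sup>+y. u y * indicator X y \<partial>N2)"
    if u: "u \<in> borel_measurable N2" for u :: "'b \<Rightarrow> ennreal"
  proof -
    have "(\<integral>\<^sup>+y. u y * indicator X y \<partial>N) = (\<integral>\<^sup>+y. u y \<partial>density N (indicator X))"
      if "X \<in> sets N" "u \<in> borel_measurable N" for N
      using that by (subst nn_integral_density) (auto simp: mult.commute)
    from this[of N1] this[of N2] show ?thesis
      using X X1 u \<open>density N1 (indicator X) \<le> density N2 (indicator X)\<close> s
      by (simp add: bm nn_integral_mono_measure)
  qed
  have I: "integrable N (\<lambda>y. f y * indicator X y)" if "finite_measure N" "sets N = sets N2" for N
  proof (rule finite_measure.integrable_const_bound[OF that(1), of _ 1])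
    have "f \<in> borel_measurable N" using f by (simp only: measurable_cong_sets[OF that(2) refl])
    moreover have "X \<in> sets N" using X that(2) by simp
    ultimately show "(\<lambda>y. f y * indicator X y) \<in> borel_measurable N"
      by (intro borel_measurable_times borel_measurable_indicator)
  qed (use fb in \<open>auto simp: indicator_def\<close>)
  have nnf: "0 \<le> f y * indicator X y" for y using fb(1)[of y] by (simp add: indicator_def)
  have "ennreal (LINT y|N. f y * indicator X y) = (\<integral>\<^sup>+y. ennreal (f y) * indicator X y \<partial>N)"
    if "finite_measure N" "sets N = sets N2" for N
  proof -
    have "ennreal (LINT y|N. f y * indicator X y) = (\<integral>\<^sup>+y. ennreal (f y * indicator X y) \<partial>N)"
      using nnf by (intro nn_integral_eq_integral[OF I[OF that], symmetric]) auto
    also have "\<dots> = (\<integral>\<^sup>+y. ennreal (f y) * indicator X y \<partial>N)"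
      by (intro nn_integral_cong) (auto simp: indicator_def)
    finally show ?thesis .
  qed
  note e = this[OF N(1) s] this[OF N(2) refl]
  have "ennreal (LINT y|N1. f y * indicator X y) \<le> ennreal (LINT y|N2. f y * indicator X y)"
    unfolding e by (rule nn) (rule measurable_compose[OF f measurable_ennreal])
  then show ?thesis using nnf by (simp add: ennreal_le_iff integral_nonneg_AE)
qed

text \<open>The values of \<open>F\<close> lie in an interval \<open>[a, a + 1]\<close> with \<open>-1 \<le> a \<le> 0\<close>. Compare \<open>F\<close> with \<open>a + 1\<close> on a
  Hahn set, where \<open>L\<close> dominates \<open>M\<close>, and with \<open>a\<close> on its complement: the difference of the integrals is
  at most \<open>(a + 1) \<delta> + (-a) \<delta> = \<delta>\<close> for the total variation distance \<open>\<delta>\<close>. The bound \<open>\<bar>F\<bar> \<le> 1\<close> alone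
  would only give \<open>2 \<delta>\<close>.\<close>

lemma integral_diff_le_d_TV:
  fixes F :: "'b \<Rightarrow> real"
  assumes L: "finite_measure L" and M: "finite_measure M" and s: "sets L = sets M"
    and F: "F \<in> borel_measurable M" and b: "\<And>y. \<bar>F y\<bar> \<le> 1" and osc: "\<And>y z. \<bar>F y - F z\<bar> \<le> 1"
  shows "ennreal \<bar>(LINT y|L. F y) - (LINT y|M. F y)\<bar> \<le> d_TV L M"
proof -
  interpret L: finite_measure L by fact
  interpret M: finite_measure M by fact
  have sp: "space L = space M" using s by (rule sets_eq_imp_space_eq)
  have F': "F \<in> borel_measurable L" using F by (simp only: measurable_cong_sets[OF s refl])
  have d: "ennreal \<bar>measure L A - measure M A\<bar> \<le> d_TV L M" if "A \<in> sets M" for A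
    unfolding d_TV_def
    by (rule SUP_upper) (use that in \<open>simp add: s L.emeasure_finite M.emeasure_finite less_top[symmetric]\<close>)
  have d_fin: "d_TV L M \<noteq> \<infinity>"
  proof -
    have "d_TV L M \<le> ennreal (measure L (space L) + measure M (space M))"
      unfolding d_TV_def
    proof (rule SUP_least, rule ennreal_leI)
      fix A
      show "\<bar>measure L A - measure M A\<bar> \<le> measure L (space L) + measure M (space M)"
        using L.bounded_measure[of A] M.bounded_measure[of A] measure_nonneg[of L A] measure_nonneg[of M A]
        by linarith
    qed
    then show ?thesis by (auto simp: top_unique)
  qed
  define \<delta> where "\<delta> = enn2real (d_TV L M)"
  have \<delta>: "d_TV L M = ennreal \<delta>" "0 \<le> \<delta>" using d_fin by (simp_all add: \<delta>_def less_top)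
  have d': "\<bar>measure L A - measure M A\<bar> \<le> \<delta>" if "A \<in> sets M" for A
    using d[OF that] \<delta> by (simp add: ennreal_le_iff)
  define c where "c = (INF y. F y)"
  have bdd: "bdd_below (range F)" using b by (intro bdd_belowI2[of _ "-1"]) (auto simp: abs_le_iff minus_le_iff)
  have c_le: "c \<le> F y" for y unfolding c_def by (rule cINF_lower[OF bdd]) simp
  have le_c: "F y \<le> c + 1" for y
  proof -
    have "F y - 1 \<le> c" unfolding c_def
    proof (rule cINF_greatest)
      fix z show "F y - 1 \<le> F z" using osc[of y z] by linarith
    qed simp
    then show ?thesis by simp
  qed
  have c: "-1 \<le> c"
    unfolding c_def by (rule cINF_greatest) (use b in \<open>auto simp: abs_le_iff minus_le_iff\<close>)
  \<comment> \<open>The truncation makes both weights \<open>-a\<close> and \<open>a + 1\<close> nonnegative; \<open>F \<le> a + 1\<close> survives it because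
    \<open>F \<le> 1\<close>.\<close>
  define a where "a = min c 0"
  have a: "-1 \<le> a" "a \<le> 0" using c by (auto simp: a_def)
  have aF: "a \<le> F y" "F y \<le> a + 1" for y
    using c_le[of y] le_c[of y] b[of y] by (auto simp: a_def min_def)
  have one: "(LINT y|L1. F y) - (LINT y|M1. F y) \<le> \<delta>"
    if L1: "finite_measure L1" and M1: "finite_measure M1" and sL: "sets L1 = sets M" and sM: "sets M1 = sets M"
      and d1: "\<And>A. A \<in> sets M \<Longrightarrow> measure L1 A - measure M1 A \<le> \<delta> \<and> measure M1 A - measure L1 A \<le> \<delta>"
    for L1 M1 :: "'b measure"
  proof -
    interpret L1: finite_measure L1 by fact
    interpret M1: finite_measure M1 by fact
    have FN: "F \<in> borel_measurable N" if "sets N = sets M" for N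
      using F by (simp only: measurable_cong_sets[OF that refl])
    have sLM: "sets L1 = sets M1" using sL sM by simp
    obtain Y where Y: "Y \<in> sets M" and Y1: "\<forall>X\<in>sets M. X \<subseteq> Y \<longrightarrow> emeasure M1 X \<le> emeasure L1 X"
      and Y2: "\<forall>X\<in>sets M. X \<inter> Y = {} \<longrightarrow> emeasure L1 X \<le> emeasure M1 X"
      using finite_unsigned_Hahn_decomposition[OF L1 M1 sLM[symmetric]] unfolding sL by (elim bexE conjE)
    define Y' where "Y' = space M - Y"
    have Y': "Y' \<in> sets M" using Y by (simp add: Y'_def)
    have i: "integrable N (\<lambda>y. F y * indicator X y)" "(LINT y|N. indicator X y) = measure N X"
      "integrable N (\<lambda>y. indicator X y :: real)"
      if "finite_measure N" "sets N = sets M" "X \<in> sets M" for N X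
    proof -
      interpret N: finite_measure N by fact
      have X: "X \<in> sets N" using that by simp
      show "integrable N (\<lambda>y. F y * indicator X y)"
      proof (rule N.integrable_const_bound[of _ 1])
        show "(\<lambda>y. F y * indicator X y) \<in> borel_measurable N"
          by (intro borel_measurable_times borel_measurable_indicator FN that X)
      qed (use b in \<open>auto simp: indicator_def\<close>)
      show "(LINT y|N. indicator X y) = measure N X" using X by simp
      show "integrable N (\<lambda>y. indicator X y :: real)"
        using X by (intro integrable_real_indicator) (simp_all add: N.emeasure_eq_measure)
    qed
    have up: "(LINT y|N. (a + 1 - F y) * indicator X y) = (a + 1) * measure N X - (LINT y|N. F y * indicator X y)"
      and lo: "(LINT y|N. (F y - a) * indicator X y) = (LINT y|N. F y * indicator X y) - a * measure N X"
      if "finite_measure N" "sets N = sets M" "X \<in> sets M" for N X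
      using i[OF that] by (simp_all add: left_diff_distrib)
    have split: "(LINT y|N. F y) = (LINT y|N. F y * indicator Y y) + (LINT y|N. F y * indicator Y' y)"
      if "finite_measure N" "sets N = sets M" for N
    proof -
      have "space N = space M" using that(2) by (rule sets_eq_imp_space_eq)
      then have "(LINT y|N. F y) = (LINT y|N. F y * indicator Y y + F y * indicator Y' y)"
        by (intro Bochner_Integration.integral_cong) (auto simp: Y'_def indicator_def)
      then show ?thesis using i(1)[OF that Y] i(1)[OF that Y'] by simp
    qed
    have "(LINT y|M1. (a + 1 - F y) * indicator Y y) \<le> (LINT y|L1. (a + 1 - F y) * indicator Y y)"
    proof (rule integral_dominated_on[OF M1 L1 sLM[symmetric]])
      fix A assume "A \<in> sets L1" "A \<subseteq> Y"
      then show "emeasure M1 A \<le> emeasure L1 A" using sL by (intro Y1[rule_format]) simp_all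
    next
      fix y show "0 \<le> a + 1 - F y" "a + 1 - F y \<le> 1" using aF[of y] by linarith+
    qed (use Y sL in \<open>auto intro!: borel_measurable_diff FN\<close>)
    then have 1: "(LINT y|L1. F y * indicator Y y) - (LINT y|M1. F y * indicator Y y) \<le> (a + 1) * (measure L1 Y - measure M1 Y)"
      unfolding up[OF L1 sL Y] up[OF M1 sM Y] by (simp add: algebra_simps)
    have "(LINT y|L1. (F y - a) * indicator Y' y) \<le> (LINT y|M1. (F y - a) * indicator Y' y)"
    proof (rule integral_dominated_on[OF L1 M1 sLM])
      fix A assume "A \<in> sets M1" "A \<subseteq> Y'"
      then show "emeasure L1 A \<le> emeasure M1 A" using sM by (intro Y2[rule_format]) (auto simp: Y'_def)
    next
      fix y show "0 \<le> F y - a" "F y - a \<le> 1" using aF[of y] by linarith+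
    qed (use Y' sM in \<open>auto intro!: borel_measurable_diff FN\<close>)
    then have 2: "(LINT y|L1. F y * indicator Y' y) - (LINT y|M1. F y * indicator Y' y) \<le> (- a) * (measure M1 Y' - measure L1 Y')"
      unfolding lo[OF L1 sL Y'] lo[OF M1 sM Y'] by (simp add: algebra_simps)
    have "(a + 1) * (measure L1 Y - measure M1 Y) \<le> (a + 1) * \<delta>"
      using a d1[OF Y] by (intro mult_left_mono) auto
    moreover have "(- a) * (measure M1 Y' - measure L1 Y') \<le> (- a) * \<delta>"
      using a d1[OF Y'] by (intro mult_left_mono) auto
    ultimately have "(LINT y|L1. F y) - (LINT y|M1. F y) \<le> (a + 1) * \<delta> + (- a) * \<delta>"
      unfolding split[OF L1 sL] split[OF M1 sM] using 1 2 by linarith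
    then show ?thesis by (simp add: algebra_simps)
  qed
  have "(LINT y|L. F y) - (LINT y|M. F y) \<le> \<delta>"
  proof (rule one[OF L M s refl])
    fix A assume "A \<in> sets M"
    from d'[OF this] show "measure L A - measure M A \<le> \<delta> \<and> measure M A - measure L A \<le> \<delta>" by linarith
  qed
  moreover have "(LINT y|M. F y) - (LINT y|L. F y) \<le> \<delta>"
  proof (rule one[OF M L refl s])
    fix A assume "A \<in> sets M"
    from d'[OF this] show "measure M A - measure L A \<le> \<delta> \<and> measure L A - measure M A \<le> \<delta>" by linarith
  qed
  ultimately show ?thesis unfolding \<delta>(1) by (intro ennreal_leI) linarith
qed

section \<open>The counting measure \<open>\<xi>[\<omega>]\<close>\<close>

lemma emeasure_xi_of_fact_sum:
  assumes "A \<in> sets borel"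
  shows "emeasure (xi_of k f g \<omega>) A
    = 1 / fact k * fact_sum k (\<lambda>z. of_nat (g z \<omega>) * indicator A (f z)) \<omega>"
  unfolding emeasure_xi_of[OF assms] fact_sum_def tuple_sum_def distinct_index_tuples_eq ..

lemma sets_xi_of [simp]: "sets (xi_of k f g \<omega>) = sets borel"
  and space_xi_of [simp]: "space (xi_of k f g \<omega>) = UNIV"
  by (simp_all add: xi_of_def space_scale_measure)

lemma one_div_fact_ennreal: "(1 / fact k :: ennreal) = ennreal (1 / fact k)"
proof -
  have "(fact k :: ennreal) = of_nat (fact k)" by simp
  also have "\<dots> = ennreal (fact k)" unfolding ennreal_of_nat_eq_real_of_nat by simp
  finally have "(1 / fact k :: ennreal) = ennreal 1 / ennreal (fact k)" by simp
  also have "\<dots> = ennreal (1 / fact k)" by (rule divide_ennreal) auto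
  finally show ?thesis .
qed

lemma one_div_fact_ennreal_pos: "(1 / fact k :: ennreal) \<noteq> 0"
  unfolding one_div_fact_ennreal by simp

lemma tuple_points_permute:
  assumes "\<pi> permutes {..<k}"
  shows "tuple_points k (t \<circ> \<pi>) = tuple_points k t \<circ> \<pi>"
  using permutes_in_image[OF assms] by (auto simp: tuple_points_def fun_eq_iff)

text \<open>The symmetric group acts freely on injective tuples, so each orbit has \<open>k!\<close> elements; the orbits are
  the sets of tuples with a given range.\<close>

lemma fact_dvd_card_inj_tuples:
  assumes S: "finite S" "S \<subseteq> inj_tuples k I"
    and closed: "\<And>t \<pi>. t \<in> S \<Longrightarrow> \<pi> permutes {..<k} \<Longrightarrow> t \<circ> \<pi> \<in> S"
  shows "fact k dvd card S"
proof -
  define cls where "cls J = {t\<in>S. t ` {..<k} = J}" for J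
  define C where "C = cls ` (\<lambda>t. t ` {..<k}) ` S"
  have U: "\<Union>C = S" by (auto simp: C_def cls_def)
  have "fact k dvd card c" if c: "c \<in> C" for c
  proof -
    obtain t0 where t0: "t0 \<in> S" "c = cls (t0 ` {..<k})" using c unfolding C_def by blast
    have inj0: "inj_on t0 {..<k}" and ext0: "t0 \<in> extensional {..<k}"
      using t0 S by (auto simp: inj_tuples_def PiE_def)
    have "bij_betw (\<lambda>\<pi>. t0 \<circ> \<pi>) {\<pi>. \<pi> permutes {..<k}} c"
    proof (rule bij_betwI')
      fix \<pi> \<pi>' assume p: "\<pi> \<in> {\<pi>. \<pi> permutes {..<k}}" "\<pi>' \<in> {\<pi>. \<pi> permutes {..<k}}"
      show "(t0 \<circ> \<pi> = t0 \<circ> \<pi>') = (\<pi> = \<pi>')"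
      proof
        assume e: "t0 \<circ> \<pi> = t0 \<circ> \<pi>'"
        show "\<pi> = \<pi>'"
        proof
          fix i
          show "\<pi> i = \<pi>' i"
          proof (cases "i < k")
            case True
            then have "\<pi> i \<in> {..<k}" "\<pi>' i \<in> {..<k}"
              using p permutes_in_image[of \<pi> "{..<k}" i] permutes_in_image[of \<pi>' "{..<k}" i] by auto
            moreover have "t0 (\<pi> i) = t0 (\<pi>' i)" using fun_cong[OF e, of i] by simp
            ultimately show ?thesis using inj0 by (auto dest: inj_onD)
          next
            case False
            then show ?thesis using p by (simp add: permutes_not_in)
          qed
        qed
      qed simp
    next
      fix \<pi> assume "\<pi> \<in> {\<pi>. \<pi> permutes {..<k}}"
      then have p: "\<pi> permutes {..<k}" by simp
      have "(t0 \<circ> \<pi>) ` {..<k} = t0 ` {..<k}" using permutes_image[OF p] by (simp only: image_comp[symmetric])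
      then show "t0 \<circ> \<pi> \<in> c" unfolding t0(2) cls_def using closed[OF t0(1) p] by simp
    next
      fix t assume "t \<in> c"
      then have t: "t \<in> S" "t ` {..<k} = t0 ` {..<k}" by (auto simp: t0(2) cls_def)
      have injt: "inj_on t {..<k}" and extt: "t \<in> extensional {..<k}"
        using t S by (auto simp: inj_tuples_def PiE_def)
      define \<pi> where "\<pi> i = (if i < k then inv_into {..<k} t0 (t i) else i)" for i
      have in0: "t i \<in> t0 ` {..<k}" if "i < k" for i using t(2) that by auto
      have t0\<pi>: "t0 (\<pi> i) = t i" if "i < k" for i
        unfolding \<pi>_def using that f_inv_into_f[OF in0[OF that]] by simp
      have "bij_betw \<pi> {..<k} {..<k}"
      proof (rule bij_betw_imageI)
        show "inj_on \<pi> {..<k}"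
        proof (rule inj_onI)
          fix i j assume "i \<in> {..<k}" "j \<in> {..<k}" "\<pi> i = \<pi> j"
          then have "t i = t j" using t0\<pi>[of i] t0\<pi>[of j] by simp
          then show "i = j" using injt \<open>i \<in> {..<k}\<close> \<open>j \<in> {..<k}\<close> by (auto dest: inj_onD)
        qed
        moreover have "\<pi> ` {..<k} \<subseteq> {..<k}"
          using inv_into_into[OF in0] by (auto simp: \<pi>_def)
        ultimately show "\<pi> ` {..<k} = {..<k}" by (intro endo_inj_surj) auto
      qed
      then have "\<pi> permutes {..<k}" by (rule bij_imp_permutes) (simp add: \<pi>_def)
      moreover have "t = t0 \<circ> \<pi>"
      proof
        fix i
        show "t i = (t0 \<circ> \<pi>) i"
          using t0\<pi>[of i] ext0 extt by (cases "i < k") (auto simp: extensional_def \<pi>_def)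
      qed
      ultimately show "\<exists>\<pi>\<in>{\<pi>. \<pi> permutes {..<k}}. t = t0 \<circ> \<pi>" by blast
    qed
    then have "card {\<pi>. \<pi> permutes {..<k}} = card c" by (rule bij_betw_same_card)
    then show ?thesis by (simp add: card_permutations[of "{..<k}" k])
  qed
  moreover have "c1 \<inter> c2 = {}" if c12: "c1 \<in> C" "c2 \<in> C" "c1 \<noteq> c2" for c1 c2
  proof -
    obtain J1 J2 where J: "c1 = cls J1" "c2 = cls J2" using c12(1,2) unfolding C_def by blast
    then have "J1 \<noteq> J2" using c12(3) by auto
    then show ?thesis unfolding J by (auto simp: cls_def)
  qed
  ultimately have "fact k dvd card (\<Union>C)"
    using S(1) by (intro dvd_partition) (auto simp: U)
  then show ?thesis by (simp add: U)
qed

text \<open>\<open>k! \<xi>[\<omega>](A)\<close> is the number of index tuples that are selected by \<open>g\<close> and mapped into \<open>A\<close>, a set that is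
  invariant under permutations.\<close>

lemma xi_of_Nats:
  fixes f :: "(nat \<Rightarrow> 'a) \<Rightarrow> 'b::topological_space" and g :: "(nat \<Rightarrow> 'a) \<Rightarrow> 'a measure \<Rightarrow> nat"
  assumes f_sym: "\<And>\<pi> x. \<pi> permutes {..<k} \<Longrightarrow> x \<in> {..<k} \<rightarrow>\<^sub>E UNIV \<Longrightarrow> f (x \<circ> \<pi>) = f x"
    and g_sym: "\<And>\<pi> x. \<pi> permutes {..<k} \<Longrightarrow> x \<in> {..<k} \<rightarrow>\<^sub>E UNIV \<Longrightarrow> g (x \<circ> \<pi>) \<omega> = g x \<omega>"
    and g01: "\<And>x. x \<in> {..<k} \<rightarrow>\<^sub>E UNIV \<Longrightarrow> g x \<omega> \<in> {0, 1}"
    and A: "A \<in> sets borel" and fin: "emeasure (xi_of k f g \<omega>) A \<noteq> \<infinity>"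
  shows "emeasure (xi_of k f g \<omega>) A \<in> \<nat>"
proof -
  let ?T = "inj_tuples k (point_indices \<omega>)"
  define S where "S = {t\<in>?T. g (tuple_points k t) \<omega> = 1 \<and> f (tuple_points k t) \<in> A}"
  have tpE: "tuple_points k t \<in> {..<k} \<rightarrow>\<^sub>E UNIV" for t :: "nat \<Rightarrow> 'a \<times> nat"
    by (auto simp: tuple_points_def)
  have "fact_sum k (\<lambda>z. of_nat (g z \<omega>) * indicator A (f z)) \<omega> = (\<integral>\<^sup>+t. indicator S t \<partial>count_space ?T)"
    unfolding fact_sum_def tuple_sum_def
  proof (rule nn_integral_cong)
    fix t assume "t \<in> space (count_space ?T)"
    then show "of_nat (g (tuple_points k t) \<omega>) * indicator A (f (tuple_points k t)) = (indicator S t :: ennreal)"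
      using g01[OF tpE, of t] by (cases "g (tuple_points k t) \<omega> = 0") (auto simp: S_def indicator_def)
  qed
  also have "\<dots> = emeasure (count_space ?T) S"
    by (intro nn_integral_indicator) (auto simp: S_def)
  finally have eq: "emeasure (xi_of k f g \<omega>) A = 1 / fact k * emeasure (count_space ?T) S"
    unfolding emeasure_xi_of_fact_sum[OF A] by simp
  have "S \<subseteq> ?T" by (auto simp: S_def)
  have finS: "finite S"
  proof (rule ccontr)
    assume "infinite S"
    then have "emeasure (count_space ?T) S = \<infinity>" using \<open>S \<subseteq> ?T\<close> by simp
    then have "emeasure (xi_of k f g \<omega>) A = \<infinity>"
      unfolding eq using one_div_fact_ennreal_pos[of k] by (simp only: ennreal_mult_top infinity_ennreal_def if_False)
    then show False using fin by simp
  qed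
  have "t \<circ> \<pi> \<in> S" if t: "t \<in> S" and p: "\<pi> permutes {..<k}" for t \<pi>
  proof -
    have t': "t \<in> {..<k} \<rightarrow>\<^sub>E point_indices \<omega>" "inj_on t {..<k}" using t by (auto simp: S_def inj_tuples_def)
    have "inj_on (t \<circ> \<pi>) {..<k}"
      using t'(2) permutes_image[OF p] by (intro comp_inj_on permutes_inj_on[OF p]) simp
    moreover have "t \<circ> \<pi> \<in> {..<k} \<rightarrow>\<^sub>E point_indices \<omega>"
      using t'(1) permutes_in_image[OF p] permutes_not_in[OF p] by (auto simp: PiE_iff extensional_def)
    ultimately show ?thesis
      using t by (simp add: S_def inj_tuples_def tuple_points_permute[OF p] f_sym[OF p tpE] g_sym[OF p tpE])
  qed
  then have "fact k dvd card S" by (rule fact_dvd_card_inj_tuples[OF finS \<open>S \<subseteq> ?T\<close>])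
  then obtain n where n: "card S = fact k * n" by (elim dvdE)
  have "emeasure (xi_of k f g \<omega>) A = ennreal (1 / fact k) * ennreal (real (fact k * n))"
    unfolding eq one_div_fact_ennreal using finS \<open>S \<subseteq> ?T\<close> n
    by (simp only: emeasure_count_space_finite ennreal_of_nat_eq_real_of_nat)
  also have "\<dots> = ennreal (1 / fact k * real (fact k * n))" by (rule ennreal_mult[symmetric]) auto
  also have "\<dots> = of_nat n" by (simp add: ennreal_of_nat_eq_real_of_nat)
  finally show ?thesis by simp
qed

lemma xi_of_finite_counting:
  fixes f :: "(nat \<Rightarrow> 'a) \<Rightarrow> 'b::topological_space"
  assumes f_sym: "\<And>\<pi> x. \<pi> permutes {..<k} \<Longrightarrow> x \<in> {..<k} \<rightarrow>\<^sub>E UNIV \<Longrightarrow> f (x \<circ> \<pi>) = f x"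
    and g_sym: "\<And>\<pi> x. \<pi> permutes {..<k} \<Longrightarrow> x \<in> {..<k} \<rightarrow>\<^sub>E UNIV \<Longrightarrow> g (x \<circ> \<pi>) \<omega> = g x \<omega>"
    and g01: "\<And>x. x \<in> {..<k} \<rightarrow>\<^sub>E UNIV \<Longrightarrow> g x \<omega> \<in> {0, 1}"
    and fin: "emeasure (xi_of k f g \<omega>) UNIV \<noteq> \<infinity>"
  shows "xi_of k f g \<omega> \<in> finite_counting_measures"
proof -
  have fm: "finite_measure (xi_of k f g \<omega>)" using fin by (intro finite_measureI) simp
  then have "emeasure (xi_of k f g \<omega>) A \<in> \<nat>" if "A \<in> sets borel" for A
    using that by (intro xi_of_Nats f_sym g_sym g01) (auto simp: finite_measure.emeasure_finite)
  then show ?thesis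
    using fm by (auto simp: finite_counting_measures_def counting_measures_def intro: finite_measure.axioms(1))
qed

text \<open>The labels must be distinct even if points of \<open>x\<close> coincide: the \<open>i\<close>-th entry is labelled by the number
  of earlier entries at the same point.\<close>

lemma inj_tuple_of_points:
  fixes B :: "nat \<Rightarrow> 'a::{second_countable_topology, t2_space} set"
  assumes B: "partition B" and \<omega>: "\<omega> \<in> loc_counting B" and x: "x \<in> {..<k} \<rightarrow>\<^sub>E UNIV"
  shows "\<exists>t\<in>inj_tuples k (point_indices (plus_measure \<omega> (dirac_tuple k x))). tuple_points k t = x"
proof -
  let ?\<omega> = "plus_measure \<omega> (dirac_tuple k x)"
  note c = loc_counting_subset[OF plus_dirac_tuple_loc[OF B \<omega>, of k x]]
  define r where "r i = card {j. j < i \<and> x j = x i}" for i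
  define t where "t = (\<lambda>i\<in>{..<k}. (x i, r i))"
  have r_less: "r i < r j" if "i < j" "x i = x j" for i j
    unfolding r_def using that by (intro psubset_card_mono) auto
  have "r i < multiplicity_at ?\<omega> (x i)" if i: "i < k" for i
  proof -
    have "(of_nat (r i + 1) :: ennreal) \<le> of_nat (card {j. j < k \<and> x j = x i})"
    proof -
      have "{j. j < i \<and> x j = x i} \<subset> {j. j < k \<and> x j = x i}" using i by auto
      then have "r i < card {j. j < k \<and> x j = x i}" unfolding r_def by (intro psubset_card_mono) auto
      then show ?thesis unfolding of_nat_le_iff by simp
    qed
    also have "\<dots> = (\<Sum>j<k. indicator {x i} (x j))"
    proof -
      have "{j. j < k \<and> x j = x i} = {j\<in>{..<k}. x j = x i}" by auto
      then show ?thesis by (simp add: indicator_def sum.If_cases Int_def)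
    qed
    also have "\<dots> \<le> emeasure ?\<omega> {x i}"
      by (subst emeasure_plus_dirac_tuple[OF B \<omega>]) auto
    also have "\<dots> = of_nat (multiplicity_at ?\<omega> (x i))"
      by (rule emeasure_singleton_eq_multiplicity(1)[OF c])
    finally show ?thesis unfolding of_nat_le_iff by simp
  qed
  then have "t \<in> {..<k} \<rightarrow>\<^sub>E point_indices ?\<omega>" by (auto simp: t_def point_indices_eq[OF c])
  moreover have "inj_on t {..<k}"
  proof (rule inj_onI)
    fix i j assume ij: "i \<in> {..<k}" "j \<in> {..<k}" "t i = t j"
    then have "x i = x j" "r i = r j" by (auto simp: t_def)
    then show "i = j" using r_less[of i j] r_less[of j i] by (cases i j rule: linorder_cases) auto
  qed
  moreover have "tuple_points k t = x"
    using x by (auto simp: tuple_points_def t_def fun_eq_iff PiE_def extensional_def)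
  ultimately show ?thesis by (intro bexI[of _ t]) (auto simp: inj_tuples_def)
qed

text \<open>This is what makes \<open>\<xi>[\<omega> + \<delta>\<^sub>x] - \<delta>\<^bsub>f x\<^esub>\<close> a measure when \<open>g\<close> selects \<open>x\<close>.\<close>

lemma xi_of_atom:
  fixes B :: "nat \<Rightarrow> 'a::{second_countable_topology, t2_space} set" and f :: "(nat \<Rightarrow> 'a) \<Rightarrow> 'b::t1_space"
  assumes B: "partition B" and \<omega>: "\<omega> \<in> loc_counting B" and x: "x \<in> {..<k} \<rightarrow>\<^sub>E UNIV"
    and g: "g x (plus_measure \<omega> (dirac_tuple k x)) = 1"
  shows "emeasure (xi_of k f g (plus_measure \<omega> (dirac_tuple k x))) {f x} \<noteq> 0"
proof -
  let ?\<omega> = "plus_measure \<omega> (dirac_tuple k x)"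
  obtain t where t: "t \<in> inj_tuples k (point_indices ?\<omega>)" "tuple_points k t = x"
    using inj_tuple_of_points[OF B \<omega> x] by blast
  have "1 \<le> fact_sum k (\<lambda>z. of_nat (g z ?\<omega>) * indicator {f x} (f z)) ?\<omega>"
    unfolding fact_sum_def tuple_sum_def
    using nn_integral_ge_point[OF t(1), of "\<lambda>t. of_nat (g (tuple_points k t) ?\<omega>) * indicator {f x} (f (tuple_points k t))"]
    by (simp add: t(2) g)
  then have "fact_sum k (\<lambda>z. of_nat (g z ?\<omega>) * indicator {f x} (f z)) ?\<omega> \<noteq> 0" by auto
  then show ?thesis
    using one_div_fact_ennreal_pos[of k] by (subst emeasure_xi_of_fact_sum) (simp_all only: mult_eq_0_iff simp_thms borel_singleton sets.empty_sets)
qed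

section \<open>The functional \<open>\<xi>[\<eta>]\<close> of a Poisson process\<close>

lemma plus_dirac_tuple_counting:
  fixes \<omega> :: "'a::{second_countable_topology, t2_space} measure"
  assumes \<omega>: "\<omega> \<in> counting_measures"
  shows "plus_measure \<omega> (dirac_tuple k x) \<in> counting_measures"
    and "A \<in> sets borel \<Longrightarrow> emeasure (plus_measure \<omega> (dirac_tuple k x)) A = emeasure \<omega> A + (\<Sum>i<k. indicator A (x i))"
proof -
  note D = counting_measuresD[OF \<omega>]
  interpret sigma_finite_measure \<omega> by (rule D)
  obtain B :: "nat \<Rightarrow> 'a set" where B: "range B \<subseteq> sets \<omega>" "(\<Union>i. B i) = space \<omega>"
    "\<And>i. emeasure \<omega> (B i) \<noteq> \<infinity>" "disjoint_family B" using sigma_finite_disjoint by blast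
  have p: "partition B" using B D by (simp add: partition_def)
  have l: "\<omega> \<in> loc_counting B" using \<omega> B by (simp add: loc_counting_def)
  show "plus_measure \<omega> (dirac_tuple k x) \<in> counting_measures"
    by (rule loc_counting_subset[OF plus_dirac_tuple_loc[OF p l]])
  show "A \<in> sets borel \<Longrightarrow> emeasure (plus_measure \<omega> (dirac_tuple k x)) A = emeasure \<omega> A + (\<Sum>i<k. indicator A (x i))"
    by (rule emeasure_plus_dirac_tuple[OF p l])
qed

lemma measurable_plus_dirac_tuple_N:
  fixes \<eta> :: "'p \<Rightarrow> 'a::{second_countable_topology, t2_space} measure"
  assumes \<eta>: "\<eta> \<in> P \<rightarrow>\<^sub>M N_space"
  shows "(\<lambda>w. plus_measure (\<eta> w) (dirac_tuple k x)) \<in> P \<rightarrow>\<^sub>M N_space"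
proof (rule measurable_evaluation_algebra)
  have c: "\<eta> w \<in> counting_measures" if "w \<in> space P" for w using measurable_space[OF \<eta> that] by simp
  show "plus_measure (\<eta> w) (dirac_tuple k x) \<in> counting_measures" if "w \<in> space P" for w
    by (rule plus_dirac_tuple_counting(1)[OF c[OF that]])
  fix A :: "'a set" assume A: "A \<in> sets borel"
  have "(\<lambda>w. emeasure (\<eta> w) A + (\<Sum>i<k. indicator A (x i))) \<in> borel_measurable P"
    by (intro borel_measurable_add measurable_eval_compose[OF \<eta> A] borel_measurable_const)
  then show "(\<lambda>w. emeasure (plus_measure (\<eta> w) (dirac_tuple k x)) A) \<in> borel_measurable P"
    by (rule measurable_cong[THEN iffD1, rotated]) (simp add: plus_dirac_tuple_counting(2)[OF c A])
qed

lemma nn_integral_xi_of: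
  assumes u: "u \<in> borel_measurable borel"
  shows "(\<integral>\<^sup>+y. u y \<partial>xi_of k f g \<omega>) = 1 / fact k * fact_sum k (\<lambda>z. of_nat (g z \<omega>) * u (f z)) \<omega>"
proof -
  let ?D = "density (count_space (distinct_index_tuples k \<omega>)) (\<lambda>t. of_nat (g (tuple_points k t) \<omega>))"
  have "(\<integral>\<^sup>+y. u y \<partial>distr ?D borel (\<lambda>t. f (tuple_points k t))) = (\<integral>\<^sup>+t. u (f (tuple_points k t)) \<partial>?D)"
    using u by (intro nn_integral_distr) (simp_all add: measurable_distr_eq1 cong: measurable_cong_sets)
  also have "\<dots> = fact_sum k (\<lambda>z. of_nat (g z \<omega>) * u (f z)) \<omega>"
    unfolding fact_sum_def tuple_sum_def distinct_index_tuples_eq by (intro nn_integral_density) simp_all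
  finally show ?thesis
    unfolding xi_of_def using u by (subst nn_integral_scale_measure) (simp_all add: measurable_distr_eq1)
qed

text \<open>The process \<open>\<eta>\<close> is accompanied by a version \<open>\<eta>0\<close> that is finite on the pieces of a partition \<open>B\<close>, for
  which the Mecke formula is available.\<close>

locale poisson_functional =
  fixes k :: nat and f :: "(nat \<Rightarrow> 'a::{second_countable_topology, t2_space}) \<Rightarrow> 'b::{second_countable_topology, t2_space}"
    and g :: "(nat \<Rightarrow> 'a) \<Rightarrow> 'a measure \<Rightarrow> nat"
    and P :: "'p measure" and K :: "'a measure" and \<eta> \<eta>0 :: "'p \<Rightarrow> 'a measure" and B :: "nat \<Rightarrow> 'a set"
  assumes pp: "poisson_process P K \<eta>" and sets_K: "sets K = sets borel" and K: "sigma_finite_measure K"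
    and B: "partition B" and KB: "\<And>n. emeasure K (B n) < \<infinity>"
    and \<eta>0: "\<eta>0 \<in> P \<rightarrow>\<^sub>M N_loc B" and ae: "AE w in P. \<eta> w = \<eta>0 w"
    and f: "f \<in> borel_measurable (Pi\<^sub>M {..<k} (\<lambda>_. borel))"
    and f_sym: "\<And>\<pi> x. \<pi> permutes {..<k} \<Longrightarrow> x \<in> {..<k} \<rightarrow>\<^sub>E UNIV \<Longrightarrow> f (x \<circ> \<pi>) = f x"
    and g: "(\<lambda>(x, \<omega>). g x \<omega>) \<in> Pi\<^sub>M {..<k} (\<lambda>_. borel) \<Otimes>\<^sub>M N_space \<rightarrow>\<^sub>M count_space {0, 1}"
    and g_sym: "\<And>\<pi> x \<omega>. \<pi> permutes {..<k} \<Longrightarrow> x \<in> {..<k} \<rightarrow>\<^sub>E UNIV \<Longrightarrow> \<omega> \<in> counting_measures \<Longrightarrow> g (x \<circ> \<pi>) \<omega> = g x \<omega>"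
begin

interpretation P: prob_space P using pp by (simp add: poisson_process_def)

abbreviation "Xk \<equiv> Pi\<^sub>M {..<k} (\<lambda>_. borel :: 'a measure)"
abbreviation "Kk \<equiv> Pi\<^sub>M {..<k} (\<lambda>_. K)"
abbreviation "add_pts w x \<equiv> plus_measure (\<eta>0 w) (dirac_tuple k x)"

lemma sets_Kk: "sets Kk = sets Xk"
  by (intro sets_PiM_cong refl sets_K)

lemma space_Kk: "space Kk = {..<k} \<rightarrow>\<^sub>E UNIV"
  using sets_eq_imp_space_eq[OF sets_Kk] by (simp add: space_PiM)

lemma \<eta>0l: "w \<in> space P \<Longrightarrow> \<eta>0 w \<in> loc_counting B"
  using measurable_space[OF \<eta>0] by simp

lemma shift_loc: "w \<in> space P \<Longrightarrow> add_pts w x \<in> loc_counting B"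
  by (rule plus_dirac_tuple_loc[OF B \<eta>0l])

lemma g01: "x \<in> {..<k} \<rightarrow>\<^sub>E UNIV \<Longrightarrow> \<omega> \<in> counting_measures \<Longrightarrow> g x \<omega> = 0 \<or> g x \<omega> = 1"
  using measurable_space[OF g, of "(x, \<omega>)"] by (auto simp: space_pair_measure space_PiM)

lemma g_loc: "(\<lambda>p. g (fst p) (snd p)) \<in> Xk \<Otimes>\<^sub>M N_loc B \<rightarrow>\<^sub>M count_space {0, 1}"
proof -
  have "(\<lambda>p. (fst p, snd p)) \<in> Xk \<Otimes>\<^sub>M N_loc B \<rightarrow>\<^sub>M Xk \<Otimes>\<^sub>M N_space"
    by (rule measurable_Pair[OF measurable_fst measurable_compose[OF measurable_snd measurable_N_loc_N_space]])
  from measurable_compose[OF this g] show ?thesis by (simp only: prod.case)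
qed

lemma g_ennreal: "(\<lambda>p. of_nat (g (fst p) (snd p)) :: ennreal) \<in> borel_measurable (Xk \<Otimes>\<^sub>M N_loc B)"
  by (rule measurable_compose[OF g_loc]) (simp add: measurable_count_space_eq1)

lemma g_real: "(\<lambda>p. real (g (fst p) (snd p))) \<in> borel_measurable (Xk \<Otimes>\<^sub>M N_loc B)"
  by (rule measurable_compose[OF g_loc]) (simp add: measurable_count_space_eq1)

lemma measurable_xi_eval:
  assumes A: "A \<in> sets borel"
  shows "(\<lambda>\<omega>. emeasure (xi_of k f g \<omega>) A) \<in> borel_measurable (N_loc B)"
proof -
  have "(\<lambda>p. of_nat (g (fst p) (snd p)) * indicator A (f (fst p)) :: ennreal) \<in> borel_measurable (Xk \<Otimes>\<^sub>M N_loc B)"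
    by (rule borel_measurable_times_ennreal[OF g_ennreal
          measurable_compose[OF measurable_compose[OF measurable_fst f] borel_measurable_indicator[OF A]]])
  from measurable_fact_sum[OF B measurable_ident this]
  have "(\<lambda>\<omega>. fact_sum k (\<lambda>z. of_nat (g z \<omega>) * indicator A (f z)) \<omega>) \<in> borel_measurable (N_loc B)"
    by (simp only: fst_conv snd_conv id_apply)
  then show ?thesis
    unfolding emeasure_xi_of_fact_sum[OF A] by (intro borel_measurable_times_ennreal borel_measurable_const)
qed

text \<open>The empty multiset is a default for infinite mass, which has probability \<open>0\<close> under the law of \<open>\<eta>\<close>.\<close>

definition Xi :: "'a measure \<Rightarrow> 'b multiset" where
  "Xi \<omega> = (if emeasure (xi_of k f g \<omega>) UNIV \<noteq> \<infinity> then measure_mset (xi_of k f g \<omega>) else {#})"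

lemma xi_finite_counting:
  assumes "\<omega> \<in> counting_measures" "emeasure (xi_of k f g \<omega>) UNIV \<noteq> \<infinity>"
  shows "xi_of k f g \<omega> \<in> finite_counting_measures"
  by (rule xi_of_finite_counting) (use assms f_sym g_sym g01 in auto)

lemma mset_measure_Xi:
  assumes "\<omega> \<in> counting_measures" "emeasure (xi_of k f g \<omega>) UNIV \<noteq> \<infinity>"
  shows "mset_measure (Xi \<omega>) = xi_of k f g \<omega>"
  using mset_measure_measure_mset[OF xi_finite_counting[OF assms]] assms(2) by (simp add: Xi_def)

lemma measurable_Xi: "Xi \<in> N_loc B \<rightarrow>\<^sub>M MS"
  unfolding measurable_MS_iff
proof
  fix A :: "'b set" assume A: "A \<in> sets borel"
  have "emeasure (mset_measure (Xi \<omega>)) A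
      = (if emeasure (xi_of k f g \<omega>) UNIV \<noteq> \<infinity> then emeasure (xi_of k f g \<omega>) A else 0)"
    if "\<omega> \<in> space (N_loc B)" for \<omega>
  proof (cases "emeasure (xi_of k f g \<omega>) UNIV = \<infinity>")
    case False
    then show ?thesis using that mset_measure_Xi[of \<omega>] loc_counting_subset[of \<omega> B] by simp
  next
    case True
    then show ?thesis using A by (simp add: Xi_def emeasure_mset_measure)
  qed
  moreover have "(\<lambda>\<omega>. if emeasure (xi_of k f g \<omega>) UNIV \<noteq> \<infinity> then emeasure (xi_of k f g \<omega>) A else 0)
      \<in> borel_measurable (N_loc B)"
  proof (rule measurable_If[OF measurable_xi_eval[OF A] borel_measurable_const])
    have "(UNIV :: 'b set) \<in> sets borel" by simp
    from measurable_sets[OF measurable_xi_eval[OF this], of "- {\<infinity>}"]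
    show "{\<omega> \<in> space (N_loc B). emeasure (xi_of k f g \<omega>) UNIV \<noteq> \<infinity>} \<in> sets (N_loc B)"
      by (simp add: vimage_def Int_def conj_commute)
  qed
  ultimately show "(\<lambda>\<omega>. emeasure (mset_measure (Xi \<omega>)) A) \<in> borel_measurable (N_loc B)"
    by (subst measurable_cong)
qed

definition X :: "'p \<Rightarrow> 'b multiset" where "X w = Xi (\<eta>0 w)"

definition Y :: "(nat \<Rightarrow> 'a) \<Rightarrow> 'p \<Rightarrow> 'b multiset" where "Y x w = Xi (add_pts w x) - {#f x#}"

definition prob_g :: "(nat \<Rightarrow> 'a) \<Rightarrow> real" where "prob_g x = (LINT w|P. real (g x (add_pts w x)))"

lemma measurable_X: "X \<in> P \<rightarrow>\<^sub>M MS"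
  unfolding X_def[abs_def] by (rule measurable_compose[OF \<eta>0 measurable_Xi])

lemma f_Kk: "f \<in> borel_measurable Kk"
  using f by (simp only: measurable_cong_sets[OF sets_Kk refl])

lemma measurable_shift_pair:
  "(\<lambda>q. (fst q, add_pts (snd q) (fst q))) \<in> Kk \<Otimes>\<^sub>M P \<rightarrow>\<^sub>M Xk \<Otimes>\<^sub>M N_loc B"
proof -
  have 1: "fst \<in> Kk \<Otimes>\<^sub>M P \<rightarrow>\<^sub>M Xk"
    using measurable_fst[of Kk P] by (simp only: measurable_cong_sets[OF refl sets_Kk])
  from measurable_compose[OF measurable_Pair[OF 1 measurable_compose[OF measurable_snd \<eta>0]] measurable_plus_dirac_tuple[OF B]]
  have "(\<lambda>q. add_pts (snd q) (fst q)) \<in> Kk \<Otimes>\<^sub>M P \<rightarrow>\<^sub>M N_loc B" by (simp only: fst_conv snd_conv)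
  with 1 show ?thesis by (rule measurable_Pair)
qed

lemma measurable_shift:
  assumes "x \<in> space Kk" shows "(\<lambda>w. (x, add_pts w x)) \<in> P \<rightarrow>\<^sub>M Xk \<Otimes>\<^sub>M N_loc B"
  using measurable_compose[OF measurable_Pair1'[OF assms] measurable_shift_pair] by (simp only: fst_conv snd_conv)

lemma measurable_Y_pair: "(\<lambda>q. Y (fst q) (snd q)) \<in> Kk \<Otimes>\<^sub>M P \<rightarrow>\<^sub>M MS"
proof -
  have "(\<lambda>p. Xi (snd p) - {#f (fst p)#}) \<in> Xk \<Otimes>\<^sub>M N_loc B \<rightarrow>\<^sub>M MS"
    by (rule measurable_mset_remove1[OF measurable_compose[OF measurable_fst f] measurable_compose[OF measurable_snd measurable_Xi]])
  from measurable_compose[OF measurable_shift_pair this] show ?thesis unfolding Y_def by (simp only: fst_conv snd_conv)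
qed

lemma measurable_Y:
  assumes "x \<in> space Kk" shows "Y x \<in> P \<rightarrow>\<^sub>M MS"
  using measurable_compose[OF measurable_Pair1'[OF assms] measurable_Y_pair] by (simp only: fst_conv snd_conv)

lemma g_shift:
  assumes x: "x \<in> space Kk" and w: "w \<in> space P"
  shows "g x (add_pts w x) = 0 \<or> g x (add_pts w x) = 1"
  using g01[OF _ loc_counting_subset[OF shift_loc[OF w]]] x by (simp add: space_Kk)

lemma g_shift_integrable:
  assumes x: "x \<in> space Kk" and u: "u \<in> borel_measurable P" and b: "\<And>w. \<bar>u w\<bar> \<le> (1::real)"
  shows "integrable P (\<lambda>w. real (g x (add_pts w x)) * u w)"
    and "integrable P (\<lambda>w. real (g x (add_pts w x)))"
    and "\<bar>LINT w|P. real (g x (add_pts w x)) * u w\<bar> \<le> prob_g x"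
proof -
  have gm: "(\<lambda>w. real (g x (add_pts w x))) \<in> borel_measurable P"
    using measurable_compose[OF measurable_shift[OF x] g_real] by (simp only: fst_conv snd_conv)
  have bd: "\<bar>real (g x (add_pts w x)) * u w\<bar> \<le> real (g x (add_pts w x))" for w
    using b[of w] by (simp add: abs_mult mult_left_le)
  have g1: "real (g x (add_pts w x)) \<le> 1" if "w \<in> space P" for w using g_shift[OF x that] by auto
  show i1: "integrable P (\<lambda>w. real (g x (add_pts w x)))"
    using gm g1 by (intro P.integrable_const_bound[of _ 1]) auto
  show i2: "integrable P (\<lambda>w. real (g x (add_pts w x)) * u w)"
    by (rule Bochner_Integration.integrable_bound[OF i1 borel_measurable_times[OF gm u]]) (use bd in auto)
  have "\<bar>LINT w|P. real (g x (add_pts w x)) * u w\<bar> \<le> (LINT w|P. \<bar>real (g x (add_pts w x)) * u w\<bar>)"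
    by (rule integral_abs_bound)
  also have "\<dots> \<le> prob_g x"
    unfolding prob_g_def using i1 i2 bd by (intro integral_mono) auto
  finally show "\<bar>LINT w|P. real (g x (add_pts w x)) * u w\<bar> \<le> prob_g x" .
qed

lemma prob_g_nonneg: "0 \<le> prob_g x"
  unfolding prob_g_def by (intro integral_nonneg_AE) auto

lemma nn_integral_g_shift:
  assumes x: "x \<in> space Kk"
  shows "(\<integral>\<^sup>+w. of_nat (g x (add_pts w x)) \<partial>P) = ennreal (prob_g x)"
  unfolding prob_g_def ennreal_of_nat_eq_real_of_nat
  using g_shift_integrable(2)[OF x, of "\<lambda>_. 0"] by (intro nn_integral_eq_integral) auto

lemma measurable_prob_g: "prob_g \<in> borel_measurable Kk"
  unfolding prob_g_def[abs_def]
proof (rule P.borel_measurable_lebesgue_integral)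
  show "(\<lambda>(x, w). real (g x (add_pts w x))) \<in> borel_measurable (Kk \<Otimes>\<^sub>M P)"
    using measurable_compose[OF measurable_shift_pair g_real] by (simp only: fst_conv snd_conv case_prod_beta')
qed

lemma prob_g_eq:
  assumes x: "x \<in> space Kk"
  shows "(LINT w|P. real (g x (plus_measure (\<eta> w) (dirac_tuple k x)))) = prob_g x"
  unfolding prob_g_def
proof (rule integral_cong_AE)
  have "x \<in> space Xk" using x sets_eq_imp_space_eq[OF sets_Kk] by simp
  from measurable_compose[OF measurable_compose[OF measurable_plus_dirac_tuple_N[OF poisson_measurable[OF pp sets_K]] measurable_Pair1'[OF this]] g]
  have "(\<lambda>w. g x (plus_measure (\<eta> w) (dirac_tuple k x))) \<in> P \<rightarrow>\<^sub>M count_space {0, 1}" by (simp only: prod.case)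
  then show "(\<lambda>w. real (g x (plus_measure (\<eta> w) (dirac_tuple k x)))) \<in> borel_measurable P"
    by (rule measurable_compose) (simp add: measurable_count_space_eq1)
  show "(\<lambda>w. real (g x (add_pts w x))) \<in> borel_measurable P"
    using measurable_compose[OF measurable_shift[OF x] g_real] by (simp only: fst_conv snd_conv)
  show "AE w in P. real (g x (plus_measure (\<eta> w) (dirac_tuple k x))) = real (g x (add_pts w x))"
    using ae by (rule AE_mp) (auto intro!: AE_I2)
qed

lemma nn_integral_xi_\<eta>0:
  "(\<integral>\<^sup>+w. emeasure (xi_of k f g (\<eta> w)) A \<partial>P) = (\<integral>\<^sup>+w. emeasure (xi_of k f g (\<eta>0 w)) A \<partial>P)"
  using ae by (intro nn_integral_cong_AE) (rule AE_mp, auto intro!: AE_I2)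

lemma sets_intensity: "sets (intensity_measure P \<xi>) = sets borel"
  unfolding intensity_measure_def by (metis sets.sets_measure_of_eq space_borel)

text \<open>Countable additivity is inherited from \<open>\<xi>[\<omega>]\<close> by monotone convergence, once \<open>\<eta>\<close> is replaced by \<open>\<eta>0\<close> to
  have measurable integrands.\<close>

lemma emeasure_intensity:
  assumes A: "A \<in> sets borel"
  shows "emeasure (intensity_measure P (\<lambda>w. xi_of k f g (\<eta> w))) A = (\<integral>\<^sup>+w. emeasure (xi_of k f g (\<eta> w)) A \<partial>P)"
  unfolding intensity_measure_def
proof (rule emeasure_measure_of_sigma)
  show "sigma_algebra UNIV (sets (borel :: 'b measure))" using sets.sigma_algebra_axioms[of "borel :: 'b measure"] by simp
  show "positive (sets borel) (\<lambda>A. \<integral>\<^sup>+w. emeasure (xi_of k f g (\<eta> w)) A \<partial>P)" by (simp add: positive_def)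
  show "countably_additive (sets borel) (\<lambda>A. \<integral>\<^sup>+w. emeasure (xi_of k f g (\<eta> w)) A \<partial>P)"
  proof (rule countably_additiveI)
    fix A :: "nat \<Rightarrow> 'b set" assume A: "range A \<subseteq> sets borel" "disjoint_family A"
    have s: "sets (xi_of k f g \<omega>) = sets borel" for \<omega> by (simp add: xi_of_def)
    have "(\<Sum>i. \<integral>\<^sup>+w. emeasure (xi_of k f g (\<eta>0 w)) (A i) \<partial>P) = (\<integral>\<^sup>+w. (\<Sum>i. emeasure (xi_of k f g (\<eta>0 w)) (A i)) \<partial>P)"
      by (rule nn_integral_suminf[symmetric]) (use A in \<open>auto intro!: measurable_compose[OF \<eta>0 measurable_xi_eval]\<close>)
    also have "\<dots> = (\<integral>\<^sup>+w. emeasure (xi_of k f g (\<eta>0 w)) (\<Union>i. A i) \<partial>P)"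
      using A by (intro nn_integral_cong suminf_emeasure) (simp_all add: s)
    finally show "(\<Sum>i. \<integral>\<^sup>+w. emeasure (xi_of k f g (\<eta> w)) (A i) \<partial>P)
        = (\<integral>\<^sup>+w. emeasure (xi_of k f g (\<eta> w)) (\<Union>i. A i) \<partial>P)"
      by (simp only: nn_integral_xi_\<eta>0)
  qed
qed (rule A)

end

locale finite_poisson_functional = poisson_functional +
  assumes L_finite: "emeasure (intensity_measure P (\<lambda>w. xi_of k f g (\<eta> w))) UNIV < \<infinity>"
begin

interpretation P: prob_space P using pp by (simp add: poisson_process_def)

lemma xi_ae: "AE w in P. emeasure (xi_of k f g (\<eta>0 w)) UNIV \<noteq> \<infinity>"
proof -
  have m: "(\<lambda>w. emeasure (xi_of k f g (\<eta>0 w)) UNIV) \<in> borel_measurable P"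
    by (rule measurable_compose[OF \<eta>0 measurable_xi_eval]) simp
  have "(UNIV :: 'b set) \<in> sets borel" by simp
  from L_finite[unfolded emeasure_intensity[OF this] nn_integral_xi_\<eta>0]
  show ?thesis by (intro nn_integral_PInf_AE[OF m]) simp
qed

lemma xi_X_ae: "AE w in P. xi_of k f g (\<eta> w) = mset_measure (X w)"
proof (rule AE_mp[OF ae], rule AE_mp[OF xi_ae], rule AE_I2, intro impI)
  fix w assume "w \<in> space P" "emeasure (xi_of k f g (\<eta>0 w)) UNIV \<noteq> \<infinity>" "\<eta> w = \<eta>0 w"
  then show "xi_of k f g (\<eta> w) = mset_measure (X w)"
    using mset_measure_Xi[OF loc_counting_subset[OF \<eta>0l]] by (simp add: X_def)
qed

text \<open>The reduced Campbell formula for \<open>\<xi>\<close>: a sum over the points of \<open>\<xi>\<close> is a sum over \<open>k\<close>-tuples of points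
  of \<open>\<eta>\<close>, to which the Mecke formula applies.\<close>

lemma xi_mecke_nn:
  fixes V :: "'b \<times> 'b multiset \<Rightarrow> ennreal"
  assumes V: "V \<in> borel_measurable (borel \<Otimes>\<^sub>M MS)"
  shows "(\<integral>\<^sup>+w. (\<Sum>y\<in>#X w. V (y, X w - {#y#})) \<partial>P)
    = 1 / fact k * (\<integral>\<^sup>+x. \<integral>\<^sup>+w. of_nat (g x (add_pts w x)) * V (f x, Y x w) \<partial>P \<partial>Kk)"
proof -
  define F where "F p = of_nat (g (fst p) (snd p)) * V (f (fst p), Xi (snd p) - {#f (fst p)#})" for p
  have F: "F \<in> borel_measurable (Xk \<Otimes>\<^sub>M N_loc B)"
    unfolding F_def[abs_def]
    by (rule borel_measurable_times_ennreal[OF g_ennreal measurable_compose[OF measurable_Pair[OF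
          measurable_compose[OF measurable_fst f] measurable_mset_remove1[OF measurable_compose[OF measurable_fst f]
          measurable_compose[OF measurable_snd measurable_Xi]]] V]])
  have mF: "(\<lambda>w. fact_sum k (\<lambda>z. F (z, \<eta>0 w)) (\<eta>0 w)) \<in> borel_measurable P"
  proof -
    from measurable_fact_sum[OF B measurable_ident F]
    have "(\<lambda>\<omega>. fact_sum k (\<lambda>z. F (z, \<omega>)) \<omega>) \<in> borel_measurable (N_loc B)" by (simp only: id_apply)
    from measurable_compose[OF \<eta>0 this] show ?thesis .
  qed
  have "(\<integral>\<^sup>+w. (\<Sum>y\<in>#X w. V (y, X w - {#y#})) \<partial>P) = (\<integral>\<^sup>+w. 1 / fact k * fact_sum k (\<lambda>z. F (z, \<eta>0 w)) (\<eta>0 w) \<partial>P)"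
  proof (rule nn_integral_cong_AE, rule AE_mp[OF xi_ae], rule AE_I2, rule impI)
    fix w assume w: "w \<in> space P" and fin: "emeasure (xi_of k f g (\<eta>0 w)) UNIV \<noteq> \<infinity>"
    have u: "(\<lambda>y. V (y, X w - {#y#})) \<in> borel_measurable borel"
      by (rule measurable_compose[OF measurable_Pair[OF measurable_ident_sets[OF refl]
            measurable_mset_remove1[OF measurable_ident_sets[OF refl] measurable_const]] V]) simp
    have "(\<Sum>y\<in>#X w. V (y, X w - {#y#})) = (\<integral>\<^sup>+y. V (y, X w - {#y#}) \<partial>xi_of k f g (\<eta>0 w))"
      using nn_integral_mset_measure[OF u, of "X w"] mset_measure_Xi[OF loc_counting_subset[OF \<eta>0l[OF w]] fin]
      by (simp add: X_def)
    also have "\<dots> = 1 / fact k * fact_sum k (\<lambda>z. F (z, \<eta>0 w)) (\<eta>0 w)"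
      unfolding nn_integral_xi_of[OF u] by (simp only: F_def fst_conv snd_conv X_def)
    finally show "(\<Sum>y\<in>#X w. V (y, X w - {#y#})) = 1 / fact k * fact_sum k (\<lambda>z. F (z, \<eta>0 w)) (\<eta>0 w)" .
  qed
  also have "\<dots> = 1 / fact k * (\<integral>\<^sup>+w. fact_sum k (\<lambda>z. F (z, \<eta>0 w)) (\<eta>0 w) \<partial>P)"
    by (rule nn_integral_cmult[OF mF])
  also have "(\<integral>\<^sup>+w. fact_sum k (\<lambda>z. F (z, \<eta>0 w)) (\<eta>0 w) \<partial>P) = (\<integral>\<^sup>+x. \<integral>\<^sup>+w. F (x, add_pts w x) \<partial>P \<partial>Kk)"
    by (rule mecke_tuples[OF pp sets_K K B KB \<eta>0 ae F])
  finally show ?thesis by (simp only: F_def fst_conv snd_conv Y_def)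
qed

lemma nn_integral_xi_intensity:
  assumes A: "A \<in> sets borel"
  shows "(\<integral>\<^sup>+w. emeasure (xi_of k f g (\<eta> w)) A \<partial>P) = (\<integral>\<^sup>+x. ennreal (prob_g x / fact k) * indicator A (f x) \<partial>Kk)"
proof -
  have V: "(\<lambda>p. indicator A (fst p) :: ennreal) \<in> borel_measurable (borel \<Otimes>\<^sub>M (MS :: 'b multiset measure))"
    by (rule measurable_compose[OF measurable_fst borel_measurable_indicator[OF A]])
  have "(\<integral>\<^sup>+w. emeasure (xi_of k f g (\<eta> w)) A \<partial>P) = (\<integral>\<^sup>+w. (\<Sum>y\<in>#X w. indicator A y) \<partial>P)"
  proof (rule nn_integral_cong_AE, rule AE_mp[OF xi_X_ae], rule AE_I2, rule impI)
    fix w assume "xi_of k f g (\<eta> w) = mset_measure (X w)"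
    then have "emeasure (xi_of k f g (\<eta> w)) A = (\<integral>\<^sup>+y. indicator A y \<partial>mset_measure (X w))"
      using A by simp
    also have "\<dots> = (\<Sum>y\<in>#X w. indicator A y)"
      by (rule nn_integral_mset_measure[OF borel_measurable_indicator[OF A]])
    finally show "emeasure (xi_of k f g (\<eta> w)) A = (\<Sum>y\<in>#X w. indicator A y)" .
  qed
  also have "\<dots> = 1 / fact k * (\<integral>\<^sup>+x. \<integral>\<^sup>+w. of_nat (g x (add_pts w x)) * indicator A (f x) \<partial>P \<partial>Kk)"
    using xi_mecke_nn[OF V] by (simp only: fst_conv)
  also have "(\<integral>\<^sup>+x. \<integral>\<^sup>+w. of_nat (g x (add_pts w x)) * indicator A (f x) \<partial>P \<partial>Kk)
      = (\<integral>\<^sup>+x. ennreal (prob_g x) * indicator A (f x) \<partial>Kk)"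
    by (intro nn_integral_cong) (auto simp: indicator_def nn_integral_g_shift)
  also have "1 / fact k * \<dots> = (\<integral>\<^sup>+x. 1 / fact k * (ennreal (prob_g x) * indicator A (f x)) \<partial>Kk)"
    using measurable_compose[OF f_Kk borel_measurable_indicator[OF A]] measurable_prob_g
    by (intro nn_integral_cmult[symmetric] borel_measurable_times_ennreal measurable_compose[OF _ measurable_ennreal])
  also have "\<dots> = (\<integral>\<^sup>+x. ennreal (prob_g x / fact k) * indicator A (f x) \<partial>Kk)"
    unfolding one_div_fact_ennreal using prob_g_nonneg
    by (intro nn_integral_cong) (simp add: mult.assoc[symmetric] ennreal_mult[symmetric])
  finally show ?thesis .
qed

end

section \<open>Transfer of laws\<close>

lemma completion_AE_event:
  assumes ae: "AE w in P. Q w \<longleftrightarrow> Q' w" and m: "{w \<in> space P. Q' w} \<in> sets P"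
  shows "{w \<in> space P. Q w} \<in> sets (completion P)"
    and "measure (completion P) {w \<in> space P. Q w} = measure P {w \<in> space P. Q' w}"
proof -
  obtain N where N: "N \<in> null_sets P" "{w \<in> space P. \<not> (Q w \<longleftrightarrow> Q' w)} \<subseteq> N"
    using ae unfolding eventually_ae_filter by blast
  have 1: "{w \<in> space P. Q w} \<inter> N \<in> sets (completion P)"
    by (rule null_setsD2[OF null_sets_completion_subset[OF _ null_sets_completionI[OF N(1)]]]) simp
  have 2: "{w \<in> space P. Q' w} - N \<in> sets (completion P)"
    using m null_setsD2[OF N(1)] by (intro sets_completionI_sets sets.Diff)
  have 3: "{w \<in> space P. Q w} = ({w \<in> space P. Q' w} - N) \<union> ({w \<in> space P. Q w} \<inter> N)"
    using N(2) by blast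
  show s: "{w \<in> space P. Q w} \<in> sets (completion P)"
    by (subst 3) (rule sets.Un[OF 2 1])
  have "measure (completion P) {w \<in> space P. Q w} = measure (completion P) {w \<in> space P. Q' w}"
  proof (rule measure_eq_AE)
    show "AE w in completion P. w \<in> {w \<in> space P. Q w} \<longleftrightarrow> w \<in> {w \<in> space P. Q' w}"
      using AE_completion[OF ae] by (rule AE_mp) (auto intro!: AE_I2)
  qed (use s m in auto)
  then show "measure (completion P) {w \<in> space P. Q w} = measure P {w \<in> space P. Q' w}"
    using m by simp
qed

lemma integral_completion_AE:
  fixes u u' :: "'w \<Rightarrow> real"
  assumes u': "u' \<in> borel_measurable P" and ae: "AE w in P. u w = u' w"
  shows "(LINT w|completion P. u w) = (LINT w|P. u' w)"
proof -
  have "u \<in> borel_measurable (completion P)"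
  proof (rule measurableI)
    fix C :: "real set" assume C: "C \<in> sets borel"
    have "{w \<in> space P. u' w \<in> C} \<in> sets P"
      using measurable_sets[OF u' C] by (simp add: vimage_def Int_def conj_commute)
    moreover have "AE w in P. u w \<in> C \<longleftrightarrow> u' w \<in> C"
      using ae by (rule AE_mp) (auto intro!: AE_I2)
    ultimately have "{w \<in> space P. u w \<in> C} \<in> sets (completion P)" by (intro completion_AE_event(1))
    then show "u -` C \<inter> space (completion P) \<in> sets (completion P)"
      by (simp add: vimage_def Int_def conj_commute)
  qed simp
  then have "(LINT w|completion P. u w) = (LINT w|completion P. u' w)"
    using measurable_completion[OF u'] AE_completion[OF ae] by (rule integral_cong_AE)
  then show ?thesis using integral_completion[OF u'] by simp
qed

lemma sets_MS_eq:
  assumes "A \<in> sets MS"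
  obtains A' where "A' \<in> sets Nfin_space" "\<And>m. m \<in> A \<longleftrightarrow> mset_measure m \<in> A'"
proof -
  have "sets MS = {mset_measure -` A \<inter> UNIV | A. A \<in> sets (Nfin_space :: 'a measure measure)}"
    unfolding MS_def by (rule sets_vimage_algebra2) (simp add: mset_measure_finite_counting)
  then obtain A' where "A' \<in> sets Nfin_space" "A = mset_measure -` A'" using assms by auto
  then show ?thesis by (intro that[of A']) auto
qed

lemma as_finite_mset:
  fixes \<xi> :: "'v \<Rightarrow> 'b::{second_countable_topology, t2_space} measure"
  assumes "as_finite_point_process Q \<xi>"
  obtains X where "prob_space Q" "X \<in> Q \<rightarrow>\<^sub>M MS" "AE v in Q. \<xi> v = mset_measure (X v)"
proof -
  obtain \<xi>' where \<xi>': "prob_space Q" "\<xi>' \<in> Q \<rightarrow>\<^sub>M Nfin_space" "AE v in Q. \<xi> v = \<xi>' v"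
    using assms unfolding as_finite_point_process_def by blast
  have "AE v in Q. \<xi> v = mset_measure (measure_mset (\<xi>' v))"
  proof (rule AE_mp[OF \<xi>'(3)], rule AE_I2, rule impI)
    fix v assume v: "v \<in> space Q" and e: "\<xi> v = \<xi>' v"
    have "\<xi>' v \<in> finite_counting_measures" using measurable_space[OF \<xi>'(2) v] by simp
    then show "\<xi> v = mset_measure (measure_mset (\<xi>' v))" by (simp add: e mset_measure_measure_mset)
  qed
  then show ?thesis
    by (rule that[OF \<xi>'(1) measurable_compose[OF \<xi>'(2) measurable_measure_mset]])
qed

lemma measure_law_MS:
  assumes X: "X \<in> Q \<rightarrow>\<^sub>M MS" and ae: "AE v in Q. \<xi> v = mset_measure (X v)"
    and A': "\<And>m. m \<in> A \<longleftrightarrow> mset_measure m \<in> A'" and A: "A \<in> sets MS"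
  shows "measure (completion Q) {v \<in> space Q. \<xi> v \<in> A'} = measure Q {v \<in> space Q. X v \<in> A}"
proof (rule completion_AE_event(2))
  show "AE v in Q. \<xi> v \<in> A' \<longleftrightarrow> X v \<in> A"
    using ae by (rule AE_mp) (auto intro!: AE_I2 simp: A')
  show "{v \<in> space Q. X v \<in> A} \<in> sets Q"
    using measurable_sets[OF X A] by (simp add: vimage_def Int_def conj_commute)
qed

lemma same_law_distr:
  assumes same: "same_law Q \<xi>1 P \<xi>2" and Q: "prob_space Q" and P: "prob_space P"
    and X1: "X1 \<in> Q \<rightarrow>\<^sub>M MS" "AE v in Q. \<xi>1 v = mset_measure (X1 v)"
    and X2: "X2 \<in> P \<rightarrow>\<^sub>M MS" "AE w in P. \<xi>2 w = mset_measure (X2 w)"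
  shows "distr Q MS X1 = distr P MS X2"
proof (rule measure_eqI)
  fix A assume "A \<in> sets (distr Q MS X1)"
  then have A: "A \<in> sets MS" by simp
  obtain A' where A': "A' \<in> sets Nfin_space" "\<And>m. m \<in> A \<longleftrightarrow> mset_measure m \<in> A'"
    using sets_MS_eq[OF A] by blast
  have "measure Q {v \<in> space Q. X1 v \<in> A} = measure P {w \<in> space P. X2 w \<in> A}"
    using same A'(1) measure_law_MS[OF X1 A'(2) A] measure_law_MS[OF X2 A'(2) A]
    unfolding same_law_def by simp
  then show "emeasure (distr Q MS X1) A = emeasure (distr P MS X2) A"
    using A X1(1) X2(1)
    by (simp add: emeasure_distr vimage_def Int_def conj_commute
        finite_measure.emeasure_eq_measure[OF prob_space.finite_measure[OF Q]]
        finite_measure.emeasure_eq_measure[OF prob_space.finite_measure[OF P]])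
qed simp

lemma ennreal_of_nat_diff_ge_1: "b < a \<Longrightarrow> 1 \<le> (of_nat a - of_nat b :: ennreal)"
proof -
  assume "b < a"
  then have "ennreal 1 \<le> ennreal (real a - real b)" by (intro ennreal_leI) linarith
  also have "\<dots> = of_nat a - of_nat b" by (simp add: ennreal_minus ennreal_of_nat_eq_real_of_nat)
  finally show "1 \<le> (of_nat a - of_nat b :: ennreal)" by simp
qed

text \<open>At a point where the multiplicities differ, one of the two truncated differences is at least \<open>1\<close>.\<close>

lemma symdiff_ge_1:
  assumes "m1 \<noteq> m2"
  shows "1 \<le> emeasure (mset_symdiff (mset_measure m1) (mset_measure (m2 :: 'b::t1_space multiset))) UNIV"
proof -
  obtain x where x: "count m1 x \<noteq> count m2 x" using assms by (auto simp: multiset_eq_iff)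
  have p: "1 \<le> (\<integral>\<^sup>+x. emeasure (mset_measure n1) {x} - emeasure (mset_measure n2) {x} \<partial>count_space UNIV)"
    if "count n2 x < count n1 x" for n1 n2 :: "'b multiset"
  proof -
    have "1 \<le> (of_nat (count n1 x) - of_nat (count n2 x) :: ennreal)" using that by (rule ennreal_of_nat_diff_ge_1)
    also have "\<dots> = emeasure (mset_measure n1) {x} - emeasure (mset_measure n2) {x}"
      by (simp only: emeasure_mset_measure_singleton)
    also have "\<dots> \<le> (\<integral>\<^sup>+x. emeasure (mset_measure n1) {x} - emeasure (mset_measure n2) {x} \<partial>count_space UNIV)"
      by (rule nn_integral_ge_point) simp
    finally show ?thesis .
  qed
  from x consider "count m1 x < count m2 x" | "count m2 x < count m1 x" by linarith
  then show ?thesis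
    unfolding emeasure_mset_symdiff
  proof cases
    case 1
    show "1 \<le> (\<integral>\<^sup>+x. emeasure (mset_measure m1) {x} - emeasure (mset_measure m2) {x} \<partial>count_space UNIV) +
        (\<integral>\<^sup>+x. emeasure (mset_measure m2) {x} - emeasure (mset_measure m1) {x} \<partial>count_space UNIV)"
      by (rule order_trans[OF p[OF 1]]) simp
  next
    case 2
    show "1 \<le> (\<integral>\<^sup>+x. emeasure (mset_measure m1) {x} - emeasure (mset_measure m2) {x} \<partial>count_space UNIV) +
        (\<integral>\<^sup>+x. emeasure (mset_measure m2) {x} - emeasure (mset_measure m1) {x} \<partial>count_space UNIV)"
      by (rule order_trans[OF p[OF 2]]) simp
  qed
qed

section \<open>The Palm formula for \<open>\<xi>\<close>\<close>

context finite_poisson_functional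
begin

interpretation P: prob_space P using pp by (simp add: poisson_process_def)

lemma integrable_prob_g: "integrable Kk prob_g"
proof -
  have "(\<integral>\<^sup>+x. ennreal (prob_g x / fact k) \<partial>Kk) < \<infinity>"
    using L_finite emeasure_intensity[of UNIV] nn_integral_xi_intensity[of UNIV] by simp
  then have "integrable Kk (\<lambda>x. prob_g x / fact k)"
    using measurable_prob_g prob_g_nonneg by (intro integrableI_nonneg) auto
  then have "integrable Kk (\<lambda>x. fact k * (prob_g x / fact k))" by (rule integrable_mult_right)
  then show ?thesis by simp
qed

text \<open>The reduced Palm expectation of \<open>G\<close> at \<open>f x\<close>, taken on the event that \<open>x\<close> is selected and not divided
  by the probability of that event.\<close>

definition palm :: "('b \<times> 'b multiset \<Rightarrow> real) \<Rightarrow> (nat \<Rightarrow> 'a) \<Rightarrow> real" where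
  "palm G x = (LINT w|P. real (g x (add_pts w x)) * G (f x, Y x w))"

lemma measurable_G_Y:
  fixes G :: "'b \<times> 'b multiset \<Rightarrow> real"
  assumes G: "G \<in> borel_measurable (borel \<Otimes>\<^sub>M MS)" and x: "x \<in> space Kk"
  shows "(\<lambda>w. G (f x, Y x w)) \<in> borel_measurable P"
  by (rule measurable_compose[OF measurable_Pair[OF measurable_const measurable_Y[OF x]] G]) simp

lemma integrable_palm:
  fixes G :: "'b \<times> 'b multiset \<Rightarrow> real"
  assumes G: "G \<in> borel_measurable (borel \<Otimes>\<^sub>M MS)" and b: "\<And>p. \<bar>G p\<bar> \<le> 1"
  shows "integrable Kk (palm G)" and "x \<in> space Kk \<Longrightarrow> \<bar>palm G x\<bar> \<le> prob_g x"
proof -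
  show bd: "x \<in> space Kk \<Longrightarrow> \<bar>palm G x\<bar> \<le> prob_g x" for x
    unfolding palm_def by (rule g_shift_integrable(3)[OF _ measurable_G_Y[OF G] b])
  have "palm G \<in> borel_measurable Kk"
    unfolding palm_def[abs_def]
  proof (rule P.borel_measurable_lebesgue_integral)
    have "(\<lambda>q. real (g (fst q) (add_pts (snd q) (fst q)))) \<in> borel_measurable (Kk \<Otimes>\<^sub>M P)"
      using measurable_compose[OF measurable_shift_pair g_real] by (simp only: fst_conv snd_conv)
    moreover have "(\<lambda>q. G (f (fst q), Y (fst q) (snd q))) \<in> borel_measurable (Kk \<Otimes>\<^sub>M P)"
      by (rule measurable_compose[OF measurable_Pair[OF measurable_compose[OF measurable_fst f_Kk] measurable_Y_pair] G])
    ultimately show "(\<lambda>(x, w). real (g x (add_pts w x)) * G (f x, Y x w)) \<in> borel_measurable (Kk \<Otimes>\<^sub>M P)"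
      unfolding case_prod_beta' by (rule borel_measurable_times)
  qed
  then show "integrable Kk (palm G)"
    using bd by (intro Bochner_Integration.integrable_bound[OF integrable_prob_g]) (auto intro!: AE_I2 simp: prob_g_nonneg)
qed

text \<open>The shift by \<open>1\<close> makes the integrand nonnegative, so that the Campbell formula for nonnegative
  functions applies.\<close>

lemma xi_mecke_shifted:
  fixes G :: "'b \<times> 'b multiset \<Rightarrow> real"
  assumes G: "G \<in> borel_measurable (borel \<Otimes>\<^sub>M MS)" and b: "\<And>p. \<bar>G p\<bar> \<le> 1"
  shows "integrable P (\<lambda>w. \<Sum>y\<in>#X w. G (y, X w - {#y#}) + 1)"
    and "(LINT w|P. (\<Sum>y\<in>#X w. G (y, X w - {#y#}) + 1)) = 1 / fact k * ((LINT x|Kk. palm G x) + (LINT x|Kk. prob_g x))"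
proof -
  have b0: "0 \<le> G p + 1" for p using b[of p] by linarith
  have G1: "(\<lambda>p. G p + 1) \<in> borel_measurable (borel \<Otimes>\<^sub>M MS)"
    by (intro borel_measurable_add G borel_measurable_const)
  have V: "(\<lambda>p. ennreal (G p + 1)) \<in> borel_measurable (borel \<Otimes>\<^sub>M MS)"
    by (rule measurable_compose[OF G1 measurable_ennreal])
  note ip = integrable_palm[OF G b]
  have nn: "0 \<le> palm G x + prob_g x" if "x \<in> space Kk" for x using ip(2)[OF that] by linarith
  have "(\<integral>\<^sup>+w. ennreal (\<Sum>y\<in>#X w. G (y, X w - {#y#}) + 1) \<partial>P) = (\<integral>\<^sup>+w. (\<Sum>y\<in>#X w. ennreal (G (y, X w - {#y#}) + 1)) \<partial>P)"
    by (intro nn_integral_cong) (simp only: sum_mset_ennreal(1)[OF b0])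
  also have "\<dots> = 1 / fact k * (\<integral>\<^sup>+x. \<integral>\<^sup>+w. of_nat (g x (add_pts w x)) * ennreal (G (f x, Y x w) + 1) \<partial>P \<partial>Kk)"
    by (rule xi_mecke_nn[OF V])
  also have "(\<integral>\<^sup>+x. \<integral>\<^sup>+w. of_nat (g x (add_pts w x)) * ennreal (G (f x, Y x w) + 1) \<partial>P \<partial>Kk)
      = (\<integral>\<^sup>+x. ennreal (palm G x + prob_g x) \<partial>Kk)"
  proof (rule nn_integral_cong)
    fix x assume x: "x \<in> space Kk"
    note i = g_shift_integrable[OF x measurable_G_Y[OF G x] b]
    have "(\<integral>\<^sup>+w. of_nat (g x (add_pts w x)) * ennreal (G (f x, Y x w) + 1) \<partial>P)
        = (\<integral>\<^sup>+w. ennreal (real (g x (add_pts w x)) * G (f x, Y x w) + real (g x (add_pts w x))) \<partial>P)"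
      using b0 by (intro nn_integral_cong) (simp add: ennreal_of_nat_eq_real_of_nat ennreal_mult[symmetric] algebra_simps)
    also have "\<dots> = ennreal (LINT w|P. real (g x (add_pts w x)) * G (f x, Y x w) + real (g x (add_pts w x)))"
    proof (rule nn_integral_eq_integral)
      have "0 \<le> real (g x (add_pts w x)) * (G (f x, Y x w) + 1)" for w using b0 by simp
      then show "AE w in P. 0 \<le> real (g x (add_pts w x)) * G (f x, Y x w) + real (g x (add_pts w x))"
        by (simp add: algebra_simps)
    qed (intro Bochner_Integration.integrable_add i)
    also have "\<dots> = ennreal (palm G x + prob_g x)"
      unfolding palm_def prob_g_def using i by simp
    finally show "(\<integral>\<^sup>+w. of_nat (g x (add_pts w x)) * ennreal (G (f x, Y x w) + 1) \<partial>P) = ennreal (palm G x + prob_g x)" .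
  qed
  also have "\<dots> = ennreal (LINT x|Kk. palm G x + prob_g x)"
    using nn by (intro nn_integral_eq_integral Bochner_Integration.integrable_add ip integrable_prob_g) auto
  also have "1 / fact k * \<dots> = ennreal (1 / fact k * ((LINT x|Kk. palm G x) + (LINT x|Kk. prob_g x)))"
  proof -
    have e: "(LINT x|Kk. palm G x + prob_g x) = (LINT x|Kk. palm G x) + (LINT x|Kk. prob_g x)"
      by (rule Bochner_Integration.integral_add[OF ip(1) integrable_prob_g])
    have "0 \<le> (LINT x|Kk. palm G x + prob_g x)" using nn by (intro integral_nonneg_AE AE_I2)
    then show ?thesis unfolding one_div_fact_ennreal e[symmetric] by (intro ennreal_mult[symmetric]) auto
  qed
  finally have eq: "(\<integral>\<^sup>+w. ennreal (\<Sum>y\<in>#X w. G (y, X w - {#y#}) + 1) \<partial>P)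
      = ennreal (1 / fact k * ((LINT x|Kk. palm G x) + (LINT x|Kk. prob_g x)))" .
  have m: "(\<lambda>w. \<Sum>y\<in>#X w. G (y, X w - {#y#}) + 1) \<in> borel_measurable P"
  proof -
    have "(\<lambda>q. (fst q, X (snd q) - {#fst q#})) \<in> borel \<Otimes>\<^sub>M P \<rightarrow>\<^sub>M borel \<Otimes>\<^sub>M MS"
      by (rule measurable_Pair[OF measurable_fst measurable_mset_remove1[OF measurable_fst measurable_compose[OF measurable_snd measurable_X]]])
    from measurable_sum_mset[OF measurable_X measurable_compose[OF this G1]] show ?thesis by (simp only: fst_conv snd_conv)
  qed
  have nnS: "0 \<le> (\<Sum>y\<in>#X w. G (y, X w - {#y#}) + 1)" for w by (rule sum_mset_ennreal(2)) (rule b0)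
  show "integrable P (\<lambda>w. \<Sum>y\<in>#X w. G (y, X w - {#y#}) + 1)"
    using m nnS eq by (intro integrableI_nonneg) auto
  have "(LINT x|Kk. palm G x + prob_g x) \<ge> 0" using nn by (intro integral_nonneg_AE AE_I2)
  then have nnR: "0 \<le> 1 / fact k * ((LINT x|Kk. palm G x) + (LINT x|Kk. prob_g x))"
    using Bochner_Integration.integral_add[OF ip(1) integrable_prob_g] by simp
  have "(LINT w|P. (\<Sum>y\<in>#X w. G (y, X w - {#y#}) + 1)) = enn2real (\<integral>\<^sup>+w. ennreal (\<Sum>y\<in>#X w. G (y, X w - {#y#}) + 1) \<partial>P)"
    using m nnS by (intro integral_eq_nn_integral) auto
  also have "\<dots> = 1 / fact k * ((LINT x|Kk. palm G x) + (LINT x|Kk. prob_g x))"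
    unfolding eq by (rule enn2real_ennreal[OF nnR])
  finally show "(LINT w|P. (\<Sum>y\<in>#X w. G (y, X w - {#y#}) + 1)) = 1 / fact k * ((LINT x|Kk. palm G x) + (LINT x|Kk. prob_g x))" .
qed

text \<open>The choice \<open>G = 0\<close> in the shifted formula gives the mean number of points, which is subtracted.\<close>

lemma xi_mecke_real:
  fixes G :: "'b \<times> 'b multiset \<Rightarrow> real"
  assumes G: "G \<in> borel_measurable (borel \<Otimes>\<^sub>M MS)" and b: "\<And>p. \<bar>G p\<bar> \<le> 1"
  shows "integrable P (\<lambda>w. \<Sum>y\<in>#X w. G (y, X w - {#y#}))"
    and "(LINT w|P. (\<Sum>y\<in>#X w. G (y, X w - {#y#}))) = 1 / fact k * (LINT x|Kk. palm G x)"
proof -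
  note V = xi_mecke_shifted[OF G b]
  have "palm (\<lambda>_. 0) = (\<lambda>_. 0)" by (simp add: palm_def fun_eq_iff)
  then have I: "integrable P (\<lambda>w. real (size (X w)))" "(LINT w|P. real (size (X w))) = 1 / fact k * (LINT x|Kk. prob_g x)"
    using xi_mecke_shifted[of "\<lambda>_. 0"] by simp_all
  have split: "(\<Sum>y\<in>#X w. G (y, X w - {#y#})) = (\<Sum>y\<in>#X w. G (y, X w - {#y#}) + 1) - real (size (X w))" for w
    by (simp add: sum_mset.distrib)
  show "integrable P (\<lambda>w. \<Sum>y\<in>#X w. G (y, X w - {#y#}))"
    unfolding split by (rule Bochner_Integration.integrable_diff[OF V(1) I(1)])
  have "(LINT w|P. (\<Sum>y\<in>#X w. G (y, X w - {#y#})))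
      = (LINT w|P. (\<Sum>y\<in>#X w. G (y, X w - {#y#}) + 1)) - (LINT w|P. real (size (X w)))"
    unfolding split by (rule Bochner_Integration.integral_diff[OF V(1) I(1)])
  then show "(LINT w|P. (\<Sum>y\<in>#X w. G (y, X w - {#y#}))) = 1 / fact k * (LINT x|Kk. palm G x)"
    unfolding V(2) I(2) by (simp add: algebra_simps add_divide_distrib)
qed

lemma intensity_eq:
  "intensity_measure P (\<lambda>w. xi_of k f g (\<eta> w)) = distr (density Kk (\<lambda>x. ennreal (prob_g x / fact k))) borel f"
    (is "?L = ?D")
proof (rule measure_eqI)
  have dm: "(\<lambda>x. ennreal (prob_g x / fact k)) \<in> borel_measurable Kk"
    by (intro measurable_compose[OF _ measurable_ennreal] borel_measurable_divide measurable_prob_g borel_measurable_const)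
  show "sets ?L = sets ?D" by (simp add: sets_intensity)
  have D: "emeasure ?D A = (\<integral>\<^sup>+w. emeasure (xi_of k f g (\<eta> w)) A \<partial>P)" if A: "A \<in> sets borel" for A
  proof -
    have fA: "f -` A \<inter> space Kk \<in> sets Kk" by (rule measurable_sets[OF f_Kk A])
    have "emeasure ?D A = emeasure (density Kk (\<lambda>x. ennreal (prob_g x / fact k))) (f -` A \<inter> space Kk)"
      using A f_Kk by (subst emeasure_distr) (simp_all cong: measurable_cong_sets)
    also have "\<dots> = (\<integral>\<^sup>+x. ennreal (prob_g x / fact k) * indicator (f -` A \<inter> space Kk) x \<partial>Kk)"
      by (rule emeasure_density[OF dm fA])
    also have "\<dots> = (\<integral>\<^sup>+x. ennreal (prob_g x / fact k) * indicator A (f x) \<partial>Kk)"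
      by (intro nn_integral_cong) (auto simp: indicator_def)
    finally show ?thesis unfolding nn_integral_xi_intensity[OF A] .
  qed
  fix A assume "A \<in> sets ?L"
  then have A: "A \<in> sets borel" by (simp add: sets_intensity)
  show "emeasure ?L A = emeasure ?D A" unfolding D[OF A] by (rule emeasure_intensity[OF A])
qed

lemma integral_intensity:
  fixes F :: "'b \<Rightarrow> real"
  assumes F: "F \<in> borel_measurable borel"
  shows "(LINT y|intensity_measure P (\<lambda>w. xi_of k f g (\<eta> w)). F y) = 1 / fact k * (LINT x|Kk. prob_g x * F (f x))"
proof -
  have "(LINT y|intensity_measure P (\<lambda>w. xi_of k f g (\<eta> w)). F y) = (LINT x|density Kk (\<lambda>x. ennreal (prob_g x / fact k)). F (f x))"
    unfolding intensity_eq using F f_Kk by (intro integral_distr) (simp_all cong: measurable_cong_sets)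
  also have "\<dots> = (LINT x|Kk. (prob_g x / fact k) *\<^sub>R F (f x))"
    using measurable_prob_g prob_g_nonneg measurable_compose[OF f_Kk F] by (intro integral_density) auto
  also have "\<dots> = (LINT x|Kk. 1 / fact k * (prob_g x * F (f x)))" by (intro Bochner_Integration.integral_cong) auto
  also have "\<dots> = 1 / fact k * (LINT x|Kk. prob_g x * F (f x))" by (rule integral_mult_right_zero)
  finally show ?thesis .
qed

text \<open>By the Mecke formula, the integral over \<open>x\<close> of the probability that \<open>x\<close> is selected and
  \<open>\<xi>[\<eta> + \<delta>\<^sub>x]\<close> is infinite equals an expected number of selected tuples of \<open>\<eta>\<close> on a null event.\<close>

lemma xi_shifted_finite:
  "AE x in Kk. AE w in P. g x (add_pts w x) = 1 \<longrightarrow> emeasure (xi_of k f g (add_pts w x)) UNIV \<noteq> \<infinity>"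
proof -
  define F :: "(nat \<Rightarrow> 'a) \<times> 'a measure \<Rightarrow> ennreal" where
    "F p = of_nat (g (fst p) (snd p)) * indicator {\<infinity>} (emeasure (xi_of k f g (snd p)) UNIV)" for p
  have "(UNIV :: 'b set) \<in> sets borel" by simp
  note x = measurable_compose[OF measurable_snd measurable_xi_eval[OF this]]
  have "(indicator {\<infinity>} :: ennreal \<Rightarrow> ennreal) \<in> borel_measurable borel" by (intro borel_measurable_indicator) simp
  from borel_measurable_times_ennreal[OF g_ennreal measurable_compose[OF x this]]
  have F: "F \<in> borel_measurable (Xk \<Otimes>\<^sub>M N_loc B)" unfolding F_def[abs_def] .
  have "(\<integral>\<^sup>+x. \<integral>\<^sup>+w. F (x, add_pts w x) \<partial>P \<partial>Kk) = (\<integral>\<^sup>+w. fact_sum k (\<lambda>z. F (z, \<eta>0 w)) (\<eta>0 w) \<partial>P)"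
    by (rule mecke_tuples[OF pp sets_K K B KB \<eta>0 ae F, symmetric])
  also have "\<dots> = (\<integral>\<^sup>+w. 0 \<partial>P)"
  proof (rule nn_integral_cong_AE, rule AE_mp[OF xi_ae], rule AE_I2, rule impI)
    fix w assume "emeasure (xi_of k f g (\<eta>0 w)) UNIV \<noteq> \<infinity>"
    then have "F (z, \<eta>0 w) = 0" for z by (simp add: F_def)
    then show "fact_sum k (\<lambda>z. F (z, \<eta>0 w)) (\<eta>0 w) = 0" by (simp add: fact_sum_def tuple_sum_def)
  qed
  finally have z: "(\<integral>\<^sup>+x. \<integral>\<^sup>+w. F (x, add_pts w x) \<partial>P \<partial>Kk) = 0" by simp
  note FP = measurable_compose[OF measurable_shift_pair F]
  have "(\<lambda>x. \<integral>\<^sup>+w. F (x, add_pts w x) \<partial>P) \<in> borel_measurable Kk"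
    using P.borel_measurable_nn_integral_fst[OF FP] by (simp only: fst_conv snd_conv)
  then have ae0: "AE x in Kk. (\<integral>\<^sup>+w. F (x, add_pts w x) \<partial>P) = 0" using z by (simp only: nn_integral_0_iff_AE)
  show ?thesis
  proof (rule AE_mp[OF ae0], rule AE_I2, rule impI)
    fix x assume x: "x \<in> space Kk" and 0: "(\<integral>\<^sup>+w. F (x, add_pts w x) \<partial>P) = 0"
    have "(\<lambda>w. F (x, add_pts w x)) \<in> borel_measurable P" by (rule measurable_compose[OF measurable_shift[OF x] F])
    then have "AE w in P. F (x, add_pts w x) = 0" using 0 by (simp only: nn_integral_0_iff_AE)
    then show "AE w in P. g x (add_pts w x) = 1 \<longrightarrow> emeasure (xi_of k f g (add_pts w x)) UNIV \<noteq> \<infinity>"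
      by (rule AE_mp) (auto intro!: AE_I2 simp: F_def)
  qed
qed

lemma diff_measure_xi:
  assumes x: "x \<in> space Kk" and w: "w \<in> space P" and g1: "g x (add_pts w x) = 1"
    and fin: "emeasure (xi_of k f g (add_pts w x)) UNIV \<noteq> \<infinity>"
  shows "diff_measure (xi_of k f g (add_pts w x)) (return borel (f x)) = mset_measure (Y x w)"
proof -
  let ?\<omega> = "add_pts w x"
  note c = loc_counting_subset[OF shift_loc[OF w, of x]]
  note xi = mset_measure_Xi[OF c fin]
  have "emeasure (xi_of k f g ?\<omega>) {f x} \<noteq> 0"
    using x g1 by (intro xi_of_atom[OF B \<eta>0l[OF w]]) (simp_all add: space_Kk)
  then have "f x \<in># Xi ?\<omega>" unfolding xi[symmetric] emeasure_mset_measure_singleton by (simp add: count_eq_zero_iff)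
  from multi_member_split[OF this] obtain m where m: "Xi ?\<omega> = add_mset (f x) m" by blast
  have Y: "Y x w = m" by (simp add: Y_def m)
  have le: "emeasure (return borel (f x)) A \<le> emeasure (mset_measure (Xi ?\<omega>)) A" if "A \<in> sets borel" for A
    using that by (simp add: m emeasure_mset_measure indicator_def)
  have fm: "finite_measure (mset_measure (Xi ?\<omega>))" "finite_measure (return borel (f x))"
    by (rule finite_counting_measuresD(2)[OF mset_measure_finite_counting]) (rule finite_measureI, simp)
  show ?thesis
    unfolding xi[symmetric] Y
  proof (rule measure_eqI)
    fix A assume "A \<in> sets (diff_measure (mset_measure (Xi ?\<omega>)) (return borel (f x)))"
    then have A: "A \<in> sets borel" by simp
    have "emeasure (diff_measure (mset_measure (Xi ?\<omega>)) (return borel (f x))) A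
        = emeasure (mset_measure (Xi ?\<omega>)) A - emeasure (return borel (f x)) A"
      using fm le A by (intro emeasure_diff_measure) simp_all
    then show "emeasure (diff_measure (mset_measure (Xi ?\<omega>)) (return borel (f x))) A = emeasure (mset_measure m) A"
      using A by (auto simp: m emeasure_mset_measure indicator_def)
  qed simp
qed

end

section \<open>The coupling\<close>

context finite_poisson_functional
begin

interpretation P: prob_space P using pp by (simp add: poisson_process_def)

text \<open>The conditional law of \<open>\<xi>[\<eta> + \<delta>\<^sub>x] - \<delta>\<^bsub>f x\<^esub>\<close> is turned into an unnormalised identity, the form
  in which it occurs in the Palm functional.\<close>

lemma conditional_law_measure:
  assumes law: "has_conditional_law Q \<xi>2 P
      (\<lambda>w. diff_measure (xi_of k f g (plus_measure (\<eta> w) (dirac_tuple k x))) (return borel (f x)))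
      (\<lambda>w. g x (plus_measure (\<eta> w) (dirac_tuple k x)) = 1)"
    and x: "x \<in> space Kk" and pos: "0 < prob_g x"
    and fin: "AE w in P. g x (add_pts w x) = 1 \<longrightarrow> emeasure (xi_of k f g (add_pts w x)) UNIV \<noteq> \<infinity>"
    and X2: "X2 \<in> Q \<rightarrow>\<^sub>M MS" "AE v in Q. \<xi>2 v = mset_measure (X2 v)" and A: "A \<in> sets MS"
  shows "{w \<in> space P. Y x w \<in> A \<and> g x (add_pts w x) = 1} \<in> sets P"
    and "prob_g x * measure Q {v \<in> space Q. X2 v \<in> A} = measure P {w \<in> space P. Y x w \<in> A \<and> g x (add_pts w x) = 1}"
proof -
  obtain A' where A': "A' \<in> sets Nfin_space" "\<And>m. m \<in> A \<longleftrightarrow> mset_measure m \<in> A'"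
    using sets_MS_eq[OF A] by blast
  have gm: "(\<lambda>w. real (g x (add_pts w x))) \<in> borel_measurable P"
    using measurable_compose[OF measurable_shift[OF x] g_real] by (simp only: fst_conv snd_conv)
  have g1: "{w \<in> space P. g x (add_pts w x) = 1} \<in> sets P"
  proof -
    have "{w \<in> space P. g x (add_pts w x) = 1} = (\<lambda>w. real (g x (add_pts w x))) -` {1} \<inter> space P" by auto
    then show ?thesis using measurable_sets[OF gm, of "{1}"] by simp
  qed
  have YA: "{w \<in> space P. Y x w \<in> A} \<in> sets P"
    using measurable_sets[OF measurable_Y[OF x] A] by (simp add: vimage_def Int_def conj_commute)
  have "{w \<in> space P. Y x w \<in> A \<and> g x (add_pts w x) = 1} = {w \<in> space P. Y x w \<in> A} \<inter> {w \<in> space P. g x (add_pts w x) = 1}"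
    by auto
  then show m: "{w \<in> space P. Y x w \<in> A \<and> g x (add_pts w x) = 1} \<in> sets P" using sets.Int[OF YA g1] by simp
  have p: "measure P {w \<in> space P. g x (add_pts w x) = 1} = prob_g x"
  proof -
    have "prob_g x = (LINT w|P. indicator {w \<in> space P. g x (add_pts w x) = 1} w)"
      unfolding prob_g_def using g_shift[OF x] by (intro Bochner_Integration.integral_cong) (auto simp: indicator_def)
    then show ?thesis using g1 by simp
  qed
  have E: "measure (completion P) {w \<in> space P. g x (plus_measure (\<eta> w) (dirac_tuple k x)) = 1} = prob_g x"
  proof (subst completion_AE_event(2)[OF _ g1])
    show "AE w in P. g x (plus_measure (\<eta> w) (dirac_tuple k x)) = 1 \<longleftrightarrow> g x (add_pts w x) = 1"
      using ae by (rule AE_mp) (auto intro!: AE_I2)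
  qed (rule p)
  have D: "measure (completion P) {w \<in> space P. diff_measure (xi_of k f g (plus_measure (\<eta> w) (dirac_tuple k x))) (return borel (f x)) \<in> A'
        \<and> g x (plus_measure (\<eta> w) (dirac_tuple k x)) = 1}
      = measure P {w \<in> space P. Y x w \<in> A \<and> g x (add_pts w x) = 1}"
  proof (rule completion_AE_event(2)[OF _ m], rule AE_mp[OF ae], rule AE_mp[OF fin], rule AE_I2, intro impI)
    fix w assume w: "w \<in> space P" and e: "\<eta> w = \<eta>0 w"
      and fin: "g x (add_pts w x) = 1 \<longrightarrow> emeasure (xi_of k f g (add_pts w x)) UNIV \<noteq> \<infinity>"
    show "(diff_measure (xi_of k f g (plus_measure (\<eta> w) (dirac_tuple k x))) (return borel (f x)) \<in> A'
          \<and> g x (plus_measure (\<eta> w) (dirac_tuple k x)) = 1) \<longleftrightarrow> (Y x w \<in> A \<and> g x (add_pts w x) = 1)"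
      unfolding e A'(2) using diff_measure_xi[OF x w] fin by auto
  qed
  have "measure Q {v \<in> space Q. X2 v \<in> A} = measure (completion Q) {v \<in> space Q. \<xi>2 v \<in> A'}"
    by (rule measure_law_MS[OF X2 A'(2) A, symmetric])
  also have "\<dots> = measure P {w \<in> space P. Y x w \<in> A \<and> g x (add_pts w x) = 1} / prob_g x"
    using law A'(1) unfolding has_conditional_law_def cond_prob_def by (simp add: D[unfolded One_nat_def] E[unfolded One_nat_def])
  finally show "prob_g x * measure Q {v \<in> space Q. X2 v \<in> A} = measure P {w \<in> space P. Y x w \<in> A \<and> g x (add_pts w x) = 1}"
    using pos by simp
qed

lemma conditional_law_integral:
  fixes \<Phi> :: "'b multiset \<Rightarrow> real"
  assumes law: "has_conditional_law Q \<xi>2 P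
      (\<lambda>w. diff_measure (xi_of k f g (plus_measure (\<eta> w) (dirac_tuple k x))) (return borel (f x)))
      (\<lambda>w. g x (plus_measure (\<eta> w) (dirac_tuple k x)) = 1)"
    and x: "x \<in> space Kk" and pos: "0 < prob_g x"
    and fin: "AE w in P. g x (add_pts w x) = 1 \<longrightarrow> emeasure (xi_of k f g (add_pts w x)) UNIV \<noteq> \<infinity>"
    and Q: "prob_space Q"
    and X2: "X2 \<in> Q \<rightarrow>\<^sub>M MS" "AE v in Q. \<xi>2 v = mset_measure (X2 v)" and \<Phi>: "\<Phi> \<in> borel_measurable MS"
  shows "(LINT w|P. real (g x (add_pts w x)) * \<Phi> (Y x w)) = prob_g x * (LINT v|Q. \<Phi> (X2 v))"
proof -
  interpret Q: prob_space Q by fact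
  let ?g = "\<lambda>w. real (g x (add_pts w x))"
  have gm: "?g \<in> borel_measurable P"
    using measurable_compose[OF measurable_shift[OF x] g_real] by (simp only: fst_conv snd_conv)
  have Yd: "Y x \<in> density P (\<lambda>w. ennreal (?g w)) \<rightarrow>\<^sub>M MS"
    using measurable_Y[OF x] by (simp cong: measurable_cong_sets)
  have eq: "distr (density P (\<lambda>w. ennreal (?g w))) MS (Y x) = density (distr Q MS X2) (\<lambda>_. ennreal (prob_g x))"
  proof (rule measure_eqI)
    fix A assume "A \<in> sets (distr (density P (\<lambda>w. ennreal (?g w))) MS (Y x))"
    then have A: "A \<in> sets MS" by simp
    note C = conditional_law_measure[OF law x pos fin X2 A]
    have YA: "Y x -` A \<inter> space P \<in> sets P" by (rule measurable_sets[OF measurable_Y[OF x] A])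
    have "emeasure (distr (density P (\<lambda>w. ennreal (?g w))) MS (Y x)) A = (\<integral>\<^sup>+w. ennreal (?g w) * indicator (Y x -` A \<inter> space P) w \<partial>P)"
      using A Yd YA gm by (simp add: emeasure_distr emeasure_density)
    also have "\<dots> = (\<integral>\<^sup>+w. indicator {w \<in> space P. Y x w \<in> A \<and> g x (add_pts w x) = 1} w \<partial>P)"
    proof (rule nn_integral_cong)
      fix w assume w: "w \<in> space P"
      show "ennreal (?g w) * indicator (Y x -` A \<inter> space P) w
          = indicator {w \<in> space P. Y x w \<in> A \<and> g x (add_pts w x) = 1} w"
        using g_shift[OF x w] w by (auto simp: indicator_def)
    qed
    also have "\<dots> = ennreal (prob_g x * measure Q {v \<in> space Q. X2 v \<in> A})"
      unfolding C(2) using C(1) by (simp add: P.emeasure_eq_measure)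
    also have "\<dots> = ennreal (prob_g x) * emeasure (distr Q MS X2) A"
      using A X2(1) prob_g_nonneg
      by (simp add: emeasure_distr Q.emeasure_eq_measure ennreal_mult vimage_def Int_def conj_commute)
    finally show "emeasure (distr (density P (\<lambda>w. ennreal (?g w))) MS (Y x)) A
        = emeasure (density (distr Q MS X2) (\<lambda>_. ennreal (prob_g x))) A"
      using A by (subst emeasure_density_const) simp_all
  qed simp
  have "(LINT w|P. ?g w * \<Phi> (Y x w)) = (LINT w|density P (\<lambda>w. ennreal (?g w)). \<Phi> (Y x w))"
    using gm measurable_compose[OF measurable_Y[OF x] \<Phi>] by (subst integral_density) auto
  also have "\<dots> = (LINT m|distr (density P (\<lambda>w. ennreal (?g w))) MS (Y x). \<Phi> m)"
    by (rule integral_distr[OF Yd \<Phi>, symmetric])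
  also have "\<dots> = (LINT m|distr Q MS X2. prob_g x *\<^sub>R \<Phi> m)"
    unfolding eq using \<Phi> prob_g_nonneg by (intro integral_density) auto
  also have "\<dots> = prob_g x * (LINT m|distr Q MS X2. \<Phi> m)" by simp
  also have "(LINT m|distr Q MS X2. \<Phi> m) = (LINT v|Q. \<Phi> (X2 v))" by (rule integral_distr[OF X2(1) \<Phi>])
  finally show ?thesis .
qed

text \<open>The coupling enters through \<open>|G(m\<^sub>1) - G(m\<^sub>2)| \<le> 2 \<cdot> 1{m\<^sub>1 \<noteq> m\<^sub>2}\<close>, where the indicator is at most the
  size of the symmetric difference.\<close>

lemma coupling_bound:
  fixes G :: "'b \<times> 'b multiset \<Rightarrow> real"
  assumes G: "G \<in> borel_measurable (borel \<Otimes>\<^sub>M MS)" and b: "\<And>p. \<bar>G p\<bar> \<le> 1"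
    and x: "x \<in> space Kk" and pos: "0 < prob_g x"
    and fin: "AE w in P. g x (add_pts w x) = 1 \<longrightarrow> emeasure (xi_of k f g (add_pts w x)) UNIV \<noteq> \<infinity>"
    and c1: "as_finite_point_process Q \<xi>1" and c2: "as_finite_point_process Q \<xi>2"
    and same: "same_law Q \<xi>1 P (\<lambda>w. xi_of k f g (\<eta> w))"
    and law: "has_conditional_law Q \<xi>2 P
      (\<lambda>w. diff_measure (xi_of k f g (plus_measure (\<eta> w) (dirac_tuple k x))) (return borel (f x)))
      (\<lambda>w. g x (plus_measure (\<eta> w) (dirac_tuple k x)) = 1)"
  shows "ennreal (\<bar>palm G x - prob_g x * (LINT w|P. G (f x, X w))\<bar> / 2)
    \<le> (\<integral>\<^sup>+v. emeasure (mset_symdiff (\<xi>1 v) (\<xi>2 v)) UNIV \<partial>Q) * ennreal (prob_g x)"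
proof -
  obtain X1 where Q: "prob_space Q" and X1: "X1 \<in> Q \<rightarrow>\<^sub>M MS" "AE v in Q. \<xi>1 v = mset_measure (X1 v)"
    using as_finite_mset[OF c1] by blast
  obtain X2 where X2: "X2 \<in> Q \<rightarrow>\<^sub>M MS" "AE v in Q. \<xi>2 v = mset_measure (X2 v)"
    using as_finite_mset[OF c2] by blast
  have \<Phi>: "(\<lambda>m. G (f x, m)) \<in> borel_measurable MS"
    by (rule measurable_compose[OF measurable_Pair1' G]) simp
  note m1 = measurable_compose[OF X1(1) \<Phi>] and m2 = measurable_compose[OF X2(1) \<Phi>]
  note i1 = prob_integral_abs_le_1(1)[OF Q m1 b] and i2 = prob_integral_abs_le_1(1)[OF Q m2 b]
  have p: "palm G x = prob_g x * (LINT v|Q. G (f x, X2 v))"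
    unfolding palm_def by (rule conditional_law_integral[OF law x pos fin Q X2 \<Phi>])
  have "(LINT w|P. G (f x, X w)) = (LINT m|distr P MS X. G (f x, m))"
    by (rule integral_distr[OF measurable_X \<Phi>, symmetric])
  also have "\<dots> = (LINT v|Q. G (f x, X1 v))"
    unfolding same_law_distr[OF same Q P.prob_space_axioms X1 measurable_X xi_X_ae, symmetric]
    by (rule integral_distr[OF X1(1) \<Phi>])
  finally have q: "(LINT w|P. G (f x, X w)) = (LINT v|Q. G (f x, X1 v))" .
  let ?D = "\<lambda>v. (G (f x, X2 v) - G (f x, X1 v)) / 2"
  have iD: "integrable Q ?D" by (rule integrable_divide_zero, rule Bochner_Integration.integrable_diff[OF i2 i1])
  have "palm G x - prob_g x * (LINT w|P. G (f x, X w)) = prob_g x * (2 * (LINT v|Q. ?D v))"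
    unfolding p q integral_divide_zero Bochner_Integration.integral_diff[OF i2 i1] by (simp add: right_diff_distrib)
  then have "\<bar>palm G x - prob_g x * (LINT w|P. G (f x, X w))\<bar> / 2 = \<bar>LINT v|Q. ?D v\<bar> * prob_g x"
    using pos by (simp only: abs_mult) simp
  also have "ennreal \<dots> = ennreal \<bar>LINT v|Q. ?D v\<bar> * ennreal (prob_g x)"
    using pos by (intro ennreal_mult) simp_all
  also have "\<dots> \<le> (\<integral>\<^sup>+v. emeasure (mset_symdiff (\<xi>1 v) (\<xi>2 v)) UNIV \<partial>Q) * ennreal (prob_g x)"
  proof (rule mult_right_mono)
    have "ennreal \<bar>LINT v|Q. ?D v\<bar> \<le> ennreal (LINT v|Q. \<bar>?D v\<bar>)"
      by (rule ennreal_leI[OF integral_abs_bound])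
    also have "\<dots> = (\<integral>\<^sup>+v. ennreal \<bar>?D v\<bar> \<partial>Q)"
      using iD by (intro nn_integral_eq_integral[symmetric] integrable_abs) auto
    also have "\<dots> \<le> (\<integral>\<^sup>+v. emeasure (mset_symdiff (\<xi>1 v) (\<xi>2 v)) UNIV \<partial>Q)"
    proof (rule nn_integral_mono_AE, rule AE_mp[OF X1(2)], rule AE_mp[OF X2(2)], rule AE_I2, intro impI)
      fix v assume e: "\<xi>1 v = mset_measure (X1 v)" "\<xi>2 v = mset_measure (X2 v)"
      show "ennreal \<bar>?D v\<bar> \<le> emeasure (mset_symdiff (\<xi>1 v) (\<xi>2 v)) UNIV"
      proof (cases "X1 v = X2 v")
        case False
        have "\<bar>G (f x, X2 v) - G (f x, X1 v)\<bar> \<le> 2" using b[of "(f x, X1 v)"] b[of "(f x, X2 v)"] by linarith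
        then have "\<bar>?D v\<bar> \<le> 1" by simp
        then have "ennreal \<bar>?D v\<bar> \<le> ennreal 1" by (rule ennreal_leI)
        also have "\<dots> \<le> emeasure (mset_symdiff (\<xi>1 v) (\<xi>2 v)) UNIV"
          using symdiff_ge_1[OF False] by (simp add: e)
        finally show ?thesis .
      qed simp
    qed
    finally show "ennreal \<bar>LINT v|Q. ?D v\<bar> \<le> (\<integral>\<^sup>+v. emeasure (mset_symdiff (\<xi>1 v) (\<xi>2 v)) UNIV \<partial>Q)" .
  qed simp
  finally show ?thesis .
qed

text \<open>Both the sum over the points of \<open>\<xi>\<close> and the intensity of \<open>\<xi>\<close> are expressed by integrals over
  \<open>k\<close>-tuples; comparing them leaves the coupling error, and replacing the intensity by \<open>M\<close> leaves the
  total variation error.\<close>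

lemma stein_bound:
  fixes G :: "'b \<times> 'b multiset \<Rightarrow> real"
  assumes G: "G \<in> borel_measurable (borel \<Otimes>\<^sub>M MS)" and b: "\<And>p. \<bar>G p\<bar> \<le> 1"
    and osc: "\<And>y z A. \<bar>G (y, A) - G (z, A)\<bar> \<le> 1"
    and M: "sets M = sets borel" "finite_measure M"
    and c: "AE x in Kk. ennreal (\<bar>palm G x - prob_g x * (LINT w|P. G (f x, X w))\<bar> / 2) \<le> S x * ennreal (prob_g x)"
  shows "integrable P (\<lambda>w. (\<Sum>y\<in>#X w. G (y, X w - {#y#})) - (LINT y|M. G (y, X w)))"
    and "ennreal \<bar>LINT w|P. (\<Sum>y\<in>#X w. G (y, X w - {#y#})) - (LINT y|M. G (y, X w))\<bar>
      \<le> d_TV (intensity_measure P (\<lambda>w. xi_of k f g (\<eta> w))) M + 2 / fact k * (\<integral>\<^sup>+x. S x * ennreal (prob_g x) \<partial>Kk)"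
proof -
  let ?L = "intensity_measure P (\<lambda>w. xi_of k f g (\<eta> w))"
  interpret M: finite_measure M by fact
  interpret PM: pair_sigma_finite P M ..
  define F where "F y = (LINT w|P. G (y, X w))" for y
  have GX: "(\<lambda>w. G (y, X w)) \<in> borel_measurable P" for y
    by (rule measurable_compose[OF measurable_compose[OF measurable_X measurable_Pair1'] G]) simp
  have F: "F \<in> borel_measurable borel"
    unfolding F_def[abs_def]
  proof (rule P.borel_measurable_lebesgue_integral)
    have "(\<lambda>q. G (fst q, X (snd q))) \<in> borel_measurable (borel \<Otimes>\<^sub>M P)"
      by (rule measurable_compose[OF measurable_Pair[OF measurable_fst measurable_compose[OF measurable_snd measurable_X]] G])
    then show "(\<lambda>(y, w). G (y, X w)) \<in> borel_measurable (borel \<Otimes>\<^sub>M P)" by (simp only: case_prod_beta')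
  qed
  have Fb: "\<bar>F y\<bar> \<le> 1" for y unfolding F_def by (rule prob_integral_abs_le_1(2)[OF P.prob_space_axioms GX b])
  have Fosc: "\<bar>F y - F z\<bar> \<le> 1" for y z
  proof -
    have "F y - F z = (LINT w|P. G (y, X w) - G (z, X w))"
      unfolding F_def using prob_integral_abs_le_1(1)[OF P.prob_space_axioms GX b]
      by (intro Bochner_Integration.integral_diff[symmetric])
    then show ?thesis
      using prob_integral_abs_le_1(2)[OF P.prob_space_axioms borel_measurable_diff[OF GX GX] osc] by simp
  qed
  have "fst \<in> M \<Otimes>\<^sub>M P \<rightarrow>\<^sub>M borel" using measurable_fst[of M P] by (simp only: measurable_cong_sets[OF refl M(1)])
  have GPM: "(\<lambda>(w, y). G (y, X w)) \<in> borel_measurable (P \<Otimes>\<^sub>M M)"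
  proof -
    have "snd \<in> P \<Otimes>\<^sub>M M \<rightarrow>\<^sub>M borel" using measurable_snd[of P M] by (simp only: measurable_cong_sets[OF refl M(1)])
    from measurable_compose[OF measurable_Pair[OF this measurable_compose[OF measurable_fst measurable_X]] G]
    show ?thesis by (simp only: case_prod_beta')
  qed
  have iPM: "integrable (P \<Otimes>\<^sub>M M) (\<lambda>(w, y). G (y, X w))"
  proof (rule finite_measure.integrable_const_bound[OF _ _ GPM])
    show "finite_measure (P \<Otimes>\<^sub>M M)" by (rule finite_measure_pair_measure) unfold_locales
    show "AE q in P \<Otimes>\<^sub>M M. norm (case q of (w, y) \<Rightarrow> G (y, X w)) \<le> 1" using b by (auto intro!: AE_I2)
  qed
  have iT: "integrable P (\<lambda>w. LINT y|M. G (y, X w))"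
    using PM.integrable_fst'[OF iPM] by simp
  have fub: "(LINT w|P. LINT y|M. G (y, X w)) = (LINT y|M. F y)"
    unfolding F_def by (rule PM.Fubini_integral[OF iPM, symmetric])
  note S = xi_mecke_real[OF G b]
  show "integrable P (\<lambda>w. (\<Sum>y\<in>#X w. G (y, X w - {#y#})) - (LINT y|M. G (y, X w)))"
    by (rule Bochner_Integration.integrable_diff[OF S(1) iT])
  have Ff: "(\<lambda>x. F (f x)) \<in> borel_measurable Kk" by (rule measurable_compose[OF f_Kk F])
  have ipF: "integrable Kk (\<lambda>x. prob_g x * F (f x))"
  proof (rule Bochner_Integration.integrable_bound[OF integrable_prob_g])
    show "AE x in Kk. norm (prob_g x * F (f x)) \<le> norm (prob_g x)"
      using Fb by (auto intro!: AE_I2 mult_left_le simp: abs_mult)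
  qed (intro borel_measurable_times measurable_prob_g Ff)
  note ip = integrable_palm[OF G b]
  define d where "d x = palm G x - prob_g x * F (f x)" for x
  have id: "integrable Kk d" unfolding d_def[abs_def] by (rule Bochner_Integration.integrable_diff[OF ip(1) ipF])
  have split: "(LINT w|P. (\<Sum>y\<in>#X w. G (y, X w - {#y#})) - (LINT y|M. G (y, X w)))
      = 1 / fact k * (LINT x|Kk. d x) + ((LINT y|?L. F y) - (LINT y|M. F y))"
    unfolding Bochner_Integration.integral_diff[OF S(1) iT] S(2) fub integral_intensity[OF F] d_def
      Bochner_Integration.integral_diff[OF ip(1) ipF] by (simp add: algebra_simps)
  have TV: "ennreal \<bar>(LINT y|?L. F y) - (LINT y|M. F y)\<bar> \<le> d_TV ?L M"
  proof (rule integral_diff_le_d_TV[OF _ M(2)])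
    have "space ?L = UNIV" using sets_eq_imp_space_eq[OF sets_intensity] by simp
    then show "finite_measure ?L" using L_finite by (intro finite_measureI) simp
    show "F \<in> borel_measurable M" using F by (simp only: measurable_cong_sets[OF M(1) refl])
  qed (use M Fb Fosc in \<open>auto simp: sets_intensity\<close>)
  have "ennreal \<bar>1 / fact k * (LINT x|Kk. d x)\<bar> \<le> ennreal (1 / fact k * (LINT x|Kk. \<bar>d x\<bar>))"
    using integral_abs_bound[of Kk d] by (intro ennreal_leI) (simp add: abs_mult divide_right_mono)
  also have "\<dots> = ennreal (2 / fact k * (LINT x|Kk. \<bar>d x\<bar> / 2))" by simp
  also have "\<dots> = 2 / fact k * ennreal (LINT x|Kk. \<bar>d x\<bar> / 2)"
  proof -
    have "(2 / fact k :: ennreal) = ennreal (2 / fact k)"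
      using one_div_fact_ennreal[of k] by (simp add: divide_ennreal_def ennreal_mult ennreal_numeral divide_inverse)
    moreover have "0 \<le> (LINT x|Kk. \<bar>d x\<bar> / 2)" by (intro integral_nonneg_AE) auto
    ultimately show ?thesis by (simp only: ennreal_mult) (rule ennreal_mult, simp_all)
  qed
  also have "ennreal (LINT x|Kk. \<bar>d x\<bar> / 2) = (\<integral>\<^sup>+x. ennreal (\<bar>d x\<bar> / 2) \<partial>Kk)"
    using id by (intro nn_integral_eq_integral[symmetric]) auto
  also have "\<dots> \<le> (\<integral>\<^sup>+x. S x * ennreal (prob_g x) \<partial>Kk)"
    by (rule nn_integral_mono_AE) (use c in \<open>simp only: d_def F_def\<close>)
  finally have C: "ennreal \<bar>1 / fact k * (LINT x|Kk. d x)\<bar> \<le> 2 / fact k * (\<integral>\<^sup>+x. S x * ennreal (prob_g x) \<partial>Kk)"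
    by (simp add: mult_left_mono)
  have "ennreal \<bar>LINT w|P. (\<Sum>y\<in>#X w. G (y, X w - {#y#})) - (LINT y|M. G (y, X w))\<bar>
      \<le> ennreal (\<bar>(LINT y|?L. F y) - (LINT y|M. F y)\<bar> + \<bar>1 / fact k * (LINT x|Kk. d x)\<bar>)"
    unfolding split by (intro ennreal_leI) linarith
  also have "\<dots> = ennreal \<bar>(LINT y|?L. F y) - (LINT y|M. F y)\<bar> + ennreal \<bar>1 / fact k * (LINT x|Kk. d x)\<bar>"
    by (rule ennreal_plus) simp_all
  also have "\<dots> \<le> d_TV ?L M + 2 / fact k * (\<integral>\<^sup>+x. S x * ennreal (prob_g x) \<partial>Kk)"
    by (rule add_mono[OF TV C])
  finally show "ennreal \<bar>LINT w|P. (\<Sum>y\<in>#X w. G (y, X w - {#y#})) - (LINT y|M. G (y, X w))\<bar>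
      \<le> d_TV ?L M + 2 / fact k * (\<integral>\<^sup>+x. S x * ennreal (prob_g x) \<partial>Kk)" .
qed

end

section \<open>The Kantorovich--Rubinstein bound\<close>

lemma d_TV_mset_measure_le_1:
  assumes "\<And>A. \<bar>real (size (filter_mset (\<lambda>x. x \<in> A) m1)) - real (size (filter_mset (\<lambda>x. x \<in> A) m2))\<bar> \<le> 1"
  shows "d_TV (mset_measure m1) (mset_measure m2) \<le> 1"
  unfolding d_TV_def
proof (rule SUP_least)
  fix A assume "A \<in> {A \<in> sets (mset_measure m1) \<inter> sets (mset_measure m2).
    emeasure (mset_measure m1) A < \<infinity> \<and> emeasure (mset_measure m2) A < \<infinity>}"
  then have "A \<in> sets borel" by simp
  then have "measure (mset_measure m) A = real (size (filter_mset (\<lambda>x. x \<in> A) m))" for m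
    by (simp add: measure_def emeasure_mset_measure)
  then have "ennreal \<bar>measure (mset_measure m1) A - measure (mset_measure m2) A\<bar> \<le> ennreal 1"
    using assms[of A] by (intro ennreal_leI) simp
  then show "ennreal \<bar>measure (mset_measure m1) A - measure (mset_measure m2) A\<bar> \<le> 1" by simp
qed

lemma TV_Lipschitz_mset:
  fixes h :: "'b::{second_countable_topology, t2_space} measure \<Rightarrow> real"
  assumes h: "h \<in> TV_Lipschitz"
  shows "(\<lambda>m. h (mset_measure m)) \<in> borel_measurable MS"
    and "\<bar>h (mset_measure (add_mset y m)) - h (mset_measure m)\<bar> \<le> 1"
    and "\<bar>h (mset_measure (add_mset y m)) - h (mset_measure (add_mset z m))\<bar> \<le> 1"
proof -
  have hm: "h \<in> Nfin_space \<rightarrow>\<^sub>M borel"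
    and hl: "\<And>\<omega>1 \<omega>2. \<omega>1 \<in> finite_counting_measures \<Longrightarrow> \<omega>2 \<in> finite_counting_measures
      \<Longrightarrow> ennreal \<bar>h \<omega>1 - h \<omega>2\<bar> \<le> d_TV \<omega>1 \<omega>2"
    using h by (auto simp: TV_Lipschitz_def)
  show "(\<lambda>m. h (mset_measure m)) \<in> borel_measurable MS"
    by (rule measurable_compose[OF measurable_mset_measure hm])
  have "\<bar>h (mset_measure m1) - h (mset_measure m2)\<bar> \<le> 1" if "d_TV (mset_measure m1) (mset_measure m2) \<le> 1" for m1 m2 :: "'b multiset"
  proof -
    have "ennreal \<bar>h (mset_measure m1) - h (mset_measure m2)\<bar> \<le> ennreal 1"
      using order_trans[OF hl[OF mset_measure_finite_counting mset_measure_finite_counting] that] by simp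
    then show ?thesis by (subst (asm) ennreal_le_iff) simp_all
  qed
  note le = this[OF d_TV_mset_measure_le_1]
  show "\<bar>h (mset_measure (add_mset y m)) - h (mset_measure m)\<bar> \<le> 1"
    "\<bar>h (mset_measure (add_mset y m)) - h (mset_measure (add_mset z m))\<bar> \<le> 1"
    by (rule le, simp)+
qed

theorem theorem3p3:
  fixes k :: nat
    and f :: "(nat \<Rightarrow> 'a::{second_countable_topology, t2_space}) \<Rightarrow>
                'b::{second_countable_topology, t2_space}"
    and g :: "(nat \<Rightarrow> 'a) \<Rightarrow> 'a measure \<Rightarrow> nat"
    and K :: "'a measure" and M L :: "'b measure"
    and P :: "'p measure" and \<eta> :: "'p \<Rightarrow> 'a measure" and \<xi> :: "'p \<Rightarrow> 'b measure"
    and R :: "'r measure" and \<zeta> :: "'r \<Rightarrow> 'b measure"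
    and Q :: "(nat \<Rightarrow> 'a) \<Rightarrow> 'q measure"
    and \<xi>1 \<xi>2 :: "(nat \<Rightarrow> 'a) \<Rightarrow> 'q \<Rightarrow> 'b measure"
    and p :: "(nat \<Rightarrow> 'a) \<Rightarrow> real"
  assumes "locally_compact_space (euclidean :: 'a topology)"
    and "locally_compact_space (euclidean :: 'b topology)"
    and "k \<ge> 1"
    and f_measurable: "f \<in> borel_measurable (Pi\<^sub>M {..<k} (\<lambda>_. borel))"
    and f_symmetric: "\<And>\<pi> x. \<pi> permutes {..<k} \<Longrightarrow> x \<in> {..<k} \<rightarrow>\<^sub>E UNIV \<Longrightarrow> f (x \<circ> \<pi>) = f x"
    and g_measurable:
      "(\<lambda>(x, \<omega>). g x \<omega>) \<in> Pi\<^sub>M {..<k} (\<lambda>_. borel) \<Otimes>\<^sub>M N_space \<rightarrow>\<^sub>M count_space {0, 1}"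
    and g_symmetric:
      "\<And>\<pi> x \<omega>. \<pi> permutes {..<k} \<Longrightarrow> x \<in> {..<k} \<rightarrow>\<^sub>E UNIV \<Longrightarrow> \<omega> \<in> counting_measures \<Longrightarrow>
         g (x \<circ> \<pi>) \<omega> = g x \<omega>"
    and K: "sets K = sets borel" "sigma_finite_measure K"
    and \<eta>: "poisson_process P K \<eta>"
    and \<xi>: "\<xi> = (\<lambda>w. xi_of k f g (\<eta> w))"
    and L: "L = intensity_measure P \<xi>"
    and L_finite: "emeasure L UNIV < \<infinity>"
    and p: "p = (\<lambda>x. LINT w|P. real (g x (plus_measure (\<eta> w) (dirac_tuple k x))))"
    and coupling:
      "AE x in Pi\<^sub>M {..<k} (\<lambda>_. K). p x > 0 \<longrightarrow>
         as_finite_point_process (Q x) (\<xi>1 x) \<and>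
         as_finite_point_process (Q x) (\<xi>2 x) \<and>
         same_law (Q x) (\<xi>1 x) P \<xi> \<and>
         has_conditional_law (Q x) (\<xi>2 x) P
           (\<lambda>w. diff_measure (xi_of k f g (plus_measure (\<eta> w) (dirac_tuple k x)))
                             (return borel (f x)))
           (\<lambda>w. g x (plus_measure (\<eta> w) (dirac_tuple k x)) = 1)"
    and coupling_measurable:
      "(\<lambda>x. \<integral>\<^sup>+v. emeasure (mset_symdiff (\<xi>1 x v) (\<xi>2 x v)) UNIV \<partial>Q x)
         \<in> borel_measurable (restrict_space (Pi\<^sub>M {..<k} (\<lambda>_. K))
                               {x \<in> {..<k} \<rightarrow>\<^sub>E UNIV. p x > 0})"
    and M: "sets M = sets borel" "finite_measure M"
    and \<zeta>: "poisson_process R M \<zeta>"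
  shows "d_KR P \<xi> R \<zeta> \<le> d_TV L M +
           2 / fact k * (\<integral>\<^sup>+x. (\<integral>\<^sup>+v. emeasure (mset_symdiff (\<xi>1 x v) (\<xi>2 x v)) UNIV \<partial>Q x)
                              * ennreal (p x) \<partial>Pi\<^sub>M {..<k} (\<lambda>_. K))"
proof -
  interpret K: sigma_finite_measure K by (rule K(2))
  obtain B :: "nat \<Rightarrow> 'a set" where B: "range B \<subseteq> sets K" "(\<Union>i. B i) = space K"
    "\<And>i. emeasure K (B i) \<noteq> \<infinity>" "disjoint_family B" using K.sigma_finite_disjoint by blast
  have sK: "space K = UNIV" using sets_eq_imp_space_eq[OF K(1)] by simp
  have part: "partition B" using B by (simp add: partition_def K(1) sK)
  have KB: "emeasure K (B n) < \<infinity>" for n using B(3)[of n] by (simp add: less_top)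
  obtain \<eta>0 where \<eta>0: "\<eta>0 \<in> P \<rightarrow>\<^sub>M N_loc B" "AE w in P. \<eta> w = \<eta>0 w"
    using poisson_loc_version[OF \<eta> K(1) part KB] by blast
  interpret F: finite_poisson_functional k f g P K \<eta> \<eta>0 B
    by standard (fact \<eta> K part KB \<eta>0 f_measurable f_symmetric g_measurable g_symmetric L_finite[unfolded L \<xi>])+
  have P: "prob_space P" and R: "prob_space R" using \<eta> \<zeta> by (simp_all add: poisson_process_def)
  interpret P: prob_space P by (rule P)
  obtain Z where Z: "Z \<in> R \<rightarrow>\<^sub>M MS" "AE w in R. \<zeta> w = mset_measure (Z w)" and
    mecke_Z: "\<forall>F\<in>borel_measurable (borel \<Otimes>\<^sub>M MS).
      (\<integral>\<^sup>+w. (\<Sum>x\<in>#Z w. F (x, Z w)) \<partial>R) = (\<integral>\<^sup>+x. \<integral>\<^sup>+w. F (x, add_mset x (Z w)) \<partial>R \<partial>M)"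
    using finite_poisson_mset[OF \<zeta> M] by blast
  define S where "S x = (\<integral>\<^sup>+v. emeasure (mset_symdiff (\<xi>1 x v) (\<xi>2 x v)) UNIV \<partial>Q x)" for x
  have p': "p x = F.prob_g x" if "x \<in> space (Pi\<^sub>M {..<k} (\<lambda>_. K))" for x
    unfolding p by (rule F.prob_g_eq[OF that])
  have "d_KR P \<xi> R \<zeta> \<le> d_TV L M + 2 / fact k * (\<integral>\<^sup>+x. S x * ennreal (F.prob_g x) \<partial>Pi\<^sub>M {..<k} (\<lambda>_. K))"
    unfolding d_KR_def
  proof (rule SUP_least)
    fix h :: "'b measure \<Rightarrow> real" assume h: "h \<in> TV_Lipschitz"
    define h0 where "h0 m = h (mset_measure m)" for m
    define G where "G q = stein_sol R Z h0 (fst q) (snd q)" for q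
    note H = TV_Lipschitz_mset[OF h, folded h0_def]
    note st = stein_sol[OF R M Z(1) mecke_Z H]
    have G: "G \<in> borel_measurable (borel \<Otimes>\<^sub>M MS)" unfolding G_def[abs_def] by (rule st(1))
    have b: "\<bar>G q\<bar> \<le> 1" for q unfolding G_def by (rule st(2))
    have osc: "\<bar>G (y, A) - G (z, A)\<bar> \<le> 1" for y z A unfolding G_def fst_conv snd_conv by (rule st(3))
    have id: "h0 A = (LINT w|R. h0 (Z w)) + ((\<Sum>y\<in>#A. G (y, A - {#y#})) - (LINT y|M. G (y, A)))" for A
      using st(4)[of A] unfolding G_def fst_conv snd_conv by linarith
    have c: "AE x in Pi\<^sub>M {..<k} (\<lambda>_. K).
      ennreal (\<bar>F.palm G x - F.prob_g x * (LINT w|P. G (f x, F.X w))\<bar> / 2) \<le> S x * ennreal (F.prob_g x)"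
    proof (rule AE_mp[OF coupling], rule AE_mp[OF F.xi_shifted_finite], rule AE_I2, intro impI)
      fix x assume x: "x \<in> space (Pi\<^sub>M {..<k} (\<lambda>_. K))"
        and fin: "AE w in P. g x (plus_measure (\<eta>0 w) (dirac_tuple k x)) = 1
          \<longrightarrow> emeasure (xi_of k f g (plus_measure (\<eta>0 w) (dirac_tuple k x))) UNIV \<noteq> \<infinity>"
        and cp: "0 < p x \<longrightarrow> as_finite_point_process (Q x) (\<xi>1 x) \<and> as_finite_point_process (Q x) (\<xi>2 x) \<and>
         same_law (Q x) (\<xi>1 x) P \<xi> \<and>
         has_conditional_law (Q x) (\<xi>2 x) P
           (\<lambda>w. diff_measure (xi_of k f g (plus_measure (\<eta> w) (dirac_tuple k x))) (return borel (f x)))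
           (\<lambda>w. g x (plus_measure (\<eta> w) (dirac_tuple k x)) = 1)"
      show "ennreal (\<bar>F.palm G x - F.prob_g x * (LINT w|P. G (f x, F.X w))\<bar> / 2) \<le> S x * ennreal (F.prob_g x)"
      proof (cases "0 < F.prob_g x")
        case True
        then have "0 < p x" using p'[OF x] by simp
        with cp have "as_finite_point_process (Q x) (\<xi>1 x)" "as_finite_point_process (Q x) (\<xi>2 x)"
          "same_law (Q x) (\<xi>1 x) P (\<lambda>w. xi_of k f g (\<eta> w))"
          "has_conditional_law (Q x) (\<xi>2 x) P
           (\<lambda>w. diff_measure (xi_of k f g (plus_measure (\<eta> w) (dirac_tuple k x))) (return borel (f x)))
           (\<lambda>w. g x (plus_measure (\<eta> w) (dirac_tuple k x)) = 1)" unfolding \<xi> by blast+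
        from F.coupling_bound[OF G b x True fin this] show ?thesis unfolding S_def .
      next
        case False
        then have 0: "F.prob_g x = 0" using F.prob_g_nonneg[of x] by linarith
        then have "F.palm G x = 0" using F.integrable_palm(2)[OF G b x] by simp
        then show ?thesis by (simp add: 0)
      qed
    qed
    note sb = F.stein_bound[OF G b osc M c]
    have "(LINT w|completion P. h (\<xi> w)) = (LINT w|P. h0 (F.X w))"
    proof (rule integral_completion_AE)
      show "(\<lambda>w. h0 (F.X w)) \<in> borel_measurable P" by (rule measurable_compose[OF F.measurable_X H(1)])
      show "AE w in P. h (\<xi> w) = h0 (F.X w)"
        using F.xi_X_ae by (rule AE_mp) (auto intro!: AE_I2 simp: \<xi> h0_def)
    qed
    also have "\<dots> = (LINT w|P. (LINT w|R. h0 (Z w)) + ((\<Sum>y\<in>#F.X w. G (y, F.X w - {#y#})) - (LINT y|M. G (y, F.X w))))"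
      by (rule Bochner_Integration.integral_cong[OF refl id])
    also have "\<dots> = (LINT w|R. h0 (Z w)) + (LINT w|P. (\<Sum>y\<in>#F.X w. G (y, F.X w - {#y#})) - (LINT y|M. G (y, F.X w)))"
      by (subst Bochner_Integration.integral_add[OF _ sb(1)]) (simp_all add: P.prob_space)
    finally have 1: "(LINT w|completion P. h (\<xi> w)) = \<dots>" .
    have 2: "(LINT w|completion R. h (\<zeta> w)) = (LINT w|R. h0 (Z w))"
    proof (rule integral_completion_AE)
      show "(\<lambda>w. h0 (Z w)) \<in> borel_measurable R" by (rule measurable_compose[OF Z(1) H(1)])
      show "AE w in R. h (\<zeta> w) = h0 (Z w)"
        using Z(2) by (rule AE_mp) (auto intro!: AE_I2 simp: h0_def)
    qed
    have "(LINT w|completion P. h (\<xi> w)) - (LINT w|completion R. h (\<zeta> w))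
        = (LINT w|P. (\<Sum>y\<in>#F.X w. G (y, F.X w - {#y#})) - (LINT y|M. G (y, F.X w)))"
      unfolding 1 2 by simp
    then show "ennreal \<bar>(LINT w|completion P. h (\<xi> w)) - (LINT w|completion R. h (\<zeta> w))\<bar>
        \<le> d_TV L M + 2 / fact k * (\<integral>\<^sup>+x. S x * ennreal (F.prob_g x) \<partial>Pi\<^sub>M {..<k} (\<lambda>_. K))"
      using sb(2) unfolding L \<xi> by simp
  qed
  also have "(\<integral>\<^sup>+x. S x * ennreal (F.prob_g x) \<partial>Pi\<^sub>M {..<k} (\<lambda>_. K)) = (\<integral>\<^sup>+x. S x * ennreal (p x) \<partial>Pi\<^sub>M {..<k} (\<lambda>_. K))"
    by (intro nn_integral_cong) (simp add: p')
  finally show ?thesis unfolding S_def .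
qed

end
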